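(* Let $W$ and $W'$ be two non-trivial subspaces of $\mathbb{C}^n$ (i.e. different from $0$ and $\mathbb{C}^n$). Then there exists a geodesic in $Z$ joining $z_W$ and $z_{W'}$ if and only if $W\oplus W'=\mathbb{C}^n$.
   Context: $n\ge2$, $G=SL(n,\mathbb{C})$, $K=SU(n)$, $Z=G/K$, $u\in Z$ the class of $1$. Let $\mathfrak p\subset\mathfrak{sl}(n,\mathbb{C})$ be the space of trace-zero hermitian matrices, identified with $T_uZ$ via the projection $G\to Z$. $Z$ carries the $G$-invariant Riemannian metric which on $T_uZ\simeq\mathfrak p$ is given by the Killing form $(X,Y)\mapsto4n\,\mathrm{Re}\,\mathrm{Tr}(XY)$. A ray is a unit speed half-geodesic $\mathbb{R}_{\ge0}\to Z$; two rays are asymptotic if their distance is bounded; $Z(\infty)$ is the set of asymptoty classes of rays, on which $G$ acts. For a subspace $0\ne W\subsetneq\mathbb{C}^n$, $z_W\in Z(\infty)$ is the unique point whose stabilizer in $G$ is the stabilizer of $W$. A geodesic $\gamma:\mathbb{R}\to Z$ joins two points of $Z(\infty)$ if (after normalizing to unit speed) one of them is the class of the ray $t\mapsto\gamma(t)$, $t\ge0$, and the other is the class of $t\mapsto\gamma(-t)$, $t\ge0$. *)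

theory Defs
  imports "HOL-Analysis.Analysis"
begin

definition adj :: "complex^'n^'n \<Rightarrow> complex^'n^'n" where
  "adj A = (\<chi> i j. cnj (A $ j $ i))"

definition SL :: "(complex^'n^'n) set" where
  "SL = {g. det g = 1}"

definition SU :: "(complex^'n^'n) set" where
  "SU = {k \<in> SL. k ** adj k = mat 1}"

definition coset :: "complex^'n^'n \<Rightarrow> (complex^'n^'n) set" where
  "coset g = (\<lambda>k. g ** k) ` SU"

definition Z :: "(complex^'n^'n) set set" where
  "Z = coset ` SL"

definition translate :: "complex^'n^'n \<Rightarrow> (complex^'n^'n) set \<Rightarrow> (complex^'n^'n) set" where
  "translate g p = (\<lambda>h. g ** h) ` p"

definition sl_alg :: "(complex^'n^'n) set" where
  "sl_alg = {A. trace A = 0}"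

definition su_alg :: "(complex^'n^'n) set" where
  "su_alg = {A \<in> sl_alg. adj A = - A}"

definition p_space :: "(complex^'n^'n) set" where
  "p_space = {A \<in> sl_alg. adj A = A}"

definition killing :: "complex^'n^'n \<Rightarrow> complex^'n^'n \<Rightarrow> real" where
  "killing X Y = 4 * real CARD('n) * Re (trace (X ** Y))"

text \<open>
  The differential at 1 of the projection from \<open>SL\<close> to \<open>Z\<close> is the projection of
  \<open>sl_alg = su_alg \<oplus> p_space\<close> onto the second summand, which takes a matrix to its
  hermitian part.
\<close>

definition herm_part :: "complex^'n^'n \<Rightarrow> complex^'n^'n" where
  "herm_part A = (1/2) *\<^sub>R (A + adj A)"

lemma herm_part_p_space:
  assumes "A \<in> sl_alg"
  shows "herm_part A \<in> p_space" and "A - herm_part A \<in> su_alg"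
proof -
  have tr: "trace (adj A) = cnj (trace A)"
    by (simp add: trace_def adj_def)
  have "trace (herm_part A) = (1/2) *\<^sub>R (trace A + trace (adj A))"
    by (simp add: trace_def herm_part_def sum.distrib scaleR_right_distrib scaleR_sum_right)
  then have t0: "trace (herm_part A) = 0"
    using assms by (simp add: sl_alg_def tr)
  show "herm_part A \<in> p_space"
    using t0 by (simp add: p_space_def sl_alg_def)
      (simp add: herm_part_def adj_def vec_eq_iff add.commute)
  have "adj (A - herm_part A) = - (A - herm_part A)"
    by (simp add: herm_part_def adj_def vec_eq_iff complex_eq_iff) (simp add: field_simps)
  then show "A - herm_part A \<in> su_alg"
    using t0 assms by (simp add: su_alg_def sl_alg_def trace_sub)
qed

text \<open>
  A curve in \<open>Z\<close> is given through a lift \<open>g\<close> to \<open>SL\<close>; since \<open>SL\<close> is a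
  principal bundle over \<open>Z\<close>, every \<open>C\<^sup>1\<close> curve in \<open>Z\<close> has a \<open>C\<^sup>1\<close> lift.
  The velocity of \<open>coset \<circ> g\<close> at \<open>t\<close> is the translate by \<open>g t\<close> of the tangent
  vector at \<open>u\<close> that is the image of the inverse of \<open>g t\<close> times the derivative of
  \<open>g\<close>, so \<open>speed g t\<close> is its Riemannian norm.
\<close>

definition speed :: "(real \<Rightarrow> complex^'n^'n) \<Rightarrow> real \<Rightarrow> real" where
  "speed g t = (let X = herm_part (matrix_inv (g t) ** vector_derivative g (at t))
                in sqrt (killing X X))"

definition curve_length :: "(real \<Rightarrow> complex^'n^'n) \<Rightarrow> real" where
  "curve_length g = integral {0..1} (speed g)"

text \<open>
  The infimum is over curves that are \<open>C\<^sup>1\<close> on all of the closed interval, so that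
  \<open>speed g\<close> is continuous and its integral is not a default value. Admitting
  piecewise \<open>C\<^sup>1\<close> curves of the usual kind does not change the infimum.
\<close>

definition dist_Z :: "(complex^'n^'n) set \<Rightarrow> (complex^'n^'n) set \<Rightarrow> real" where
  "dist_Z p q = Inf {curve_length g | g.
      g C1_differentiable_on {0..1} \<and> g ` {0..1} \<subseteq> SL \<and> coset (g 0) = p \<and> coset (g 1) = q}"

text \<open>
  Geodesics of a Riemannian manifold are the curves of constant speed that locally
  realise the Riemannian distance.
\<close>

definition geodesic_on :: "real set \<Rightarrow> real \<Rightarrow> (real \<Rightarrow> (complex^'n^'n) set) \<Rightarrow> bool" where
  "geodesic_on I c \<gamma> \<longleftrightarrow> \<gamma> ` I \<subseteq> Z \<and>
     (\<forall>t\<in>I. \<exists>e>0. \<forall>r\<in>I \<inter> ball t e. \<forall>s\<in>I \<inter> ball t e. dist_Z (\<gamma> r) (\<gamma> s) = c * \<bar>r - s\<bar>)"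

definition geodesic :: "(real \<Rightarrow> (complex^'n^'n) set) \<Rightarrow> bool" where
  "geodesic \<gamma> \<longleftrightarrow> (\<exists>c>0. geodesic_on UNIV c \<gamma>)"

text \<open>
  Rays are total functions whose values at negative arguments are irrelevant: any two
  rays agreeing on \<open>{0..}\<close> are asymptotic.
\<close>

definition ray :: "(real \<Rightarrow> (complex^'n^'n) set) \<Rightarrow> bool" where
  "ray \<rho> \<longleftrightarrow> geodesic_on {0..} 1 \<rho>"

definition asymptotic :: "((real \<Rightarrow> (complex^'n^'n) set) \<times> (real \<Rightarrow> (complex^'n^'n) set)) set" where
  "asymptotic = {(\<rho>, \<sigma>). ray \<rho> \<and> ray \<sigma> \<and> (\<exists>B. \<forall>t\<ge>0. dist_Z (\<rho> t) (\<sigma> t) \<le> B)}"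

definition Z_inf :: "(real \<Rightarrow> (complex^'n^'n) set) set set" where
  "Z_inf = Collect ray // asymptotic"

definition ray_class :: "(real \<Rightarrow> (complex^'n^'n) set) \<Rightarrow> (real \<Rightarrow> (complex^'n^'n) set) set" where
  "ray_class \<rho> = asymptotic `` {\<rho>}"

definition act_inf ::
    "complex^'n^'n \<Rightarrow> (real \<Rightarrow> (complex^'n^'n) set) set \<Rightarrow> (real \<Rightarrow> (complex^'n^'n) set) set" where
  "act_inf g z = (\<lambda>\<rho>. translate g \<circ> \<rho>) ` z"

definition stab_inf :: "(real \<Rightarrow> (complex^'n^'n) set) set \<Rightarrow> (complex^'n^'n) set" where
  "stab_inf z = {g \<in> SL. act_inf g z = z}"

definition stab_subspace :: "(complex^'n) set \<Rightarrow> (complex^'n^'n) set" where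
  "stab_subspace W = {g \<in> SL. (\<lambda>v. g *v v) ` W = W}"

definition z_point :: "(complex^'n) set \<Rightarrow> (real \<Rightarrow> (complex^'n^'n) set) set" where
  "z_point W = (THE z. z \<in> Z_inf \<and> stab_inf z = stab_subspace W)"

definition joins ::
    "(real \<Rightarrow> (complex^'n^'n) set) \<Rightarrow> (real \<Rightarrow> (complex^'n^'n) set) set \<Rightarrow>
     (real \<Rightarrow> (complex^'n^'n) set) set \<Rightarrow> bool" where
  "joins \<gamma> z z' \<longleftrightarrow> (\<exists>c>0. geodesic_on UNIV c \<gamma> \<and>
     (let pos = ray_class (\<lambda>t. \<gamma> (t / c)); neg = ray_class (\<lambda>t. \<gamma> (- t / c))
      in z = pos \<and> z' = neg \<or> z = neg \<and> z' = pos))"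

end

theory Submission
  imports Defs
begin

text \<open>
  For \<open>x \<in> zero_sum\<close> write \<open>e\<^sup>x\<close> for \<open>ediag x\<close>. The geodesics of \<open>Z\<close> are the curves
  \<open>flow g x\<close>, that is \<open>t \<mapsto> g e\<^sup>t\<^sup>x K\<close> with \<open>g \<in> SL\<close> (\<open>geodesic_line_is_flow\<close>), and so every
  point at infinity is the class \<open>endpoint g x\<close> of such a ray with \<open>x\<close> of unit length. The rays
  given by \<open>(g, x)\<close> and \<open>(h, y)\<close> are asymptotic iff the matrices
  \<open>e\<^sup>-\<^sup>t\<^sup>x g\<^sup>-\<^sup>1 h e\<^sup>t\<^sup>y\<close>, \<open>t \<ge> 0\<close>, stay bounded, that is iff the \<open>(i, j)\<close> entry of
  \<open>g\<^sup>-\<^sup>1 h\<close> vanishes whenever \<open>x\<^sub>i < y\<^sub>j\<close> (\<open>endpoint_eq_iff\<close>). In particular the stabilizer of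
  \<open>endpoint g x\<close> consists of the matrices that preserve the flag formed by the images under \<open>g\<close> of
  the spaces spanned by the unit vectors \<open>e\<^sub>i\<close> with \<open>x\<^sub>i \<ge> c\<close>. If it is the stabilizer of a single
  subspace \<open>W\<close>, this flag has one proper member only: \<open>x\<close> takes exactly two values, and \<open>W\<close> is the
  image under \<open>g\<close> of \<open>coord T\<close>, where \<open>T\<close> is the set on which \<open>x\<close> is maximal
  (\<open>endpoint_with_subspace_stabilizer\<close>). The two values are determined by the dimension of \<open>W\<close>,
  which gives the existence and uniqueness of \<open>z_point W\<close> (\<open>z_point_eq_endpoint\<close>).

  Running backwards along \<open>flow g x\<close> replaces \<open>x\<close> by \<open>- x\<close>, hence \<open>T\<close> by its complement. So a
  geodesic joins \<open>z_point W\<close> and \<open>z_point W'\<close> iff some \<open>g \<in> SL\<close> and some \<open>T\<close> satisfy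
  \<open>W = g (coord T)\<close> and \<open>W' = g (coord (- T))\<close>, and that is possible iff \<open>W\<close> and \<open>W'\<close> are
  complementary (\<open>adapted_frame\<close>).

  The metric part rests on one inequality. Write a point of \<open>Z\<close> as \<open>U e\<^sup>x K\<close> with \<open>U \<in> SU\<close> and
  call \<open>U (rdiag x) U\<^sup>*\<close> its logarithm. Then \<open>dist_Z\<close> is at least \<open>2 \<surd>n\<close> times the
  Frobenius distance of the logarithms (\<open>dist_Z_lower\<close>), with equality if one of the points is the
  base point. So comparison with the Euclidean space \<open>p_space\<close> shows that a point is determined by
  its distances to the ends of a geodesic segment containing it (\<open>point_between\<close>). The inequality
  comes from finite differences, so that the logarithm need not be differentiated: for \<open>g\<close> and
  \<open>h\<close> in \<open>SL\<close> and \<open>m = g\<^sup>-\<^sup>1 h\<close>, twice the distance of the logarithms of their cosets is at most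
  the norm of \<open>m - (m\<^sup>-\<^sup>1)\<^sup>*\<close>, which in suitable unitary coordinates is \<open>\<bar>t\<bar> \<le> \<bar>sinh t\<bar>\<close> in
  every entry (\<open>exponential_metric_increasing\<close>). For neighbouring points of a curve this norm is the
  length element up to a constant factor and terms of higher order, and summation along the curve
  bounds the distance of the logarithms of its ends by its length.
\<close>

section \<open>Matrices: adjoints, inverses and the Frobenius norm\<close>

lemma adj_nth [simp]: "adj A $ i $ j = cnj (A $ j $ i)"
  by (simp add: adj_def)

lemma adj_adj [simp]: "adj (adj A) = A"
  by (simp add: vec_eq_iff)

lemma adj_mult: "adj (A ** B) = adj B ** adj A"
  by (simp add: vec_eq_iff matrix_matrix_mult_def mult.commute)

lemma adj_mat1 [simp]: "adj (mat 1) = mat 1"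
  by (simp add: vec_eq_iff mat_def)

lemma det_adj: "det (adj A) = cnj (det A)"
proof -
  have "det (adj A) = det (transpose (adj A))"
    by simp
  also have "\<dots> = cnj (det A)"
    by (simp add: det_def transpose_def)
  finally show ?thesis .
qed

lemma bounded_bilinear_matrix_mult:
  "bounded_bilinear ((**) :: complex^'n^'n \<Rightarrow> complex^'n^'n \<Rightarrow> complex^'n^'n)"
proof -
  have "bilinear ((**) :: complex^'n^'n \<Rightarrow> complex^'n^'n \<Rightarrow> complex^'n^'n)"
    unfolding bilinear_def
    by (auto intro!: linearI simp: vec_eq_iff matrix_matrix_mult_def sum.distrib
        algebra_simps scaleR_sum_right)
  then show ?thesis
    by (simp add: bilinear_conv_bounded_bilinear)
qed

lemmas matrix_mult_diff_left = bounded_bilinear.diff_left [OF bounded_bilinear_matrix_mult]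
lemmas matrix_mult_diff_right = bounded_bilinear.diff_right [OF bounded_bilinear_matrix_mult]
lemmas tendsto_matrix_mult = bounded_bilinear.tendsto [OF bounded_bilinear_matrix_mult]
lemmas continuous_on_matrix_mult = bounded_bilinear.continuous_on [OF bounded_bilinear_matrix_mult]

lemma bounded_linear_adj: "bounded_linear (adj :: complex^'n^'n \<Rightarrow> complex^'n^'n)"
proof -
  have "linear (adj :: complex^'n^'n \<Rightarrow> complex^'n^'n)"
    by (auto intro!: linearI simp: vec_eq_iff)
  then show ?thesis
    by (rule linear_conv_bounded_linear [THEN iffD1])
qed

lemma norm_matrix_sq: "(norm (A :: complex^'n^'n))\<^sup>2 = (\<Sum>i\<in>UNIV. \<Sum>j\<in>UNIV. (cmod (A $ i $ j))\<^sup>2)"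
  by (simp add: norm_vec_def L2_set_def sum_nonneg)

lemma norm_sq_trace: "complex_of_real ((norm A)\<^sup>2) = trace (A ** adj A)"
  by (simp add: norm_matrix_sq trace_def matrix_matrix_mult_def complex_norm_square [symmetric])

lemma norm_adj: "norm (adj A) = norm A"
proof -
  have "(norm (adj A))\<^sup>2 = (norm A)\<^sup>2"
    by (simp add: norm_matrix_sq) (rule sum.swap)
  then show ?thesis by simp
qed

lemma norm_mult_unitary_right:
  fixes A U :: "complex^'n^'n"
  assumes "U ** adj U = mat 1"
  shows "norm (A ** U) = norm A"
proof -
  have "(A ** U) ** adj (A ** U) = A ** (U ** adj U) ** adj A"
    by (simp add: adj_mult matrix_mul_assoc)
  then have "complex_of_real ((norm (A ** U))\<^sup>2) = complex_of_real ((norm A)\<^sup>2)"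
    by (simp only: norm_sq_trace assms matrix_mul_rid)
  then show ?thesis
    by (simp only: of_real_eq_iff) simp
qed

lemma norm_mult_unitary_left:
  fixes A U :: "complex^'n^'n"
  assumes "adj U ** U = mat 1"
  shows "norm (U ** A) = norm A"
proof -
  have "norm (adj A ** adj U) = norm (adj A)"
    by (rule norm_mult_unitary_right) (simp add: assms)
  then show ?thesis
    by (metis adj_mult norm_adj)
qed

lemma SL_right_inverse: "g \<in> SL \<Longrightarrow> g ** matrix_inv g = mat 1"
  and SL_left_inverse: "g \<in> SL \<Longrightarrow> matrix_inv g ** g = mat 1"
proof -
  assume "g \<in> SL"
  then have "invertible g"
    by (simp add: SL_def invertible_det_nz)
  then have "g ** matrix_inv g = mat 1 \<and> matrix_inv g ** g = mat 1"
    unfolding invertible_def matrix_inv_def by (rule someI_ex)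
  then show "g ** matrix_inv g = mat 1" and "matrix_inv g ** g = mat 1"
    by auto
qed

lemma SL_cancel_left: "g \<in> SL \<Longrightarrow> matrix_inv g ** (g ** A) = A"
  and SL_cancel_left': "g \<in> SL \<Longrightarrow> g ** (matrix_inv g ** A) = A"
  by (simp_all add: matrix_mul_assoc SL_left_inverse SL_right_inverse)

lemma SL_mult: "g \<in> SL \<Longrightarrow> h \<in> SL \<Longrightarrow> g ** h \<in> SL"
  by (simp add: SL_def det_mul)

lemma SL_one: "mat 1 \<in> SL"
  by (simp add: SL_def)

lemma SL_inv: "g \<in> SL \<Longrightarrow> matrix_inv g \<in> SL"
  using SL_right_inverse [of g] det_mul [of g "matrix_inv g"] by (simp add: SL_def)

lemma matrix_inv_unique:
  fixes g h :: "complex^'n^'n"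
  assumes "g ** h = mat 1"
  shows "matrix_inv g = h"
proof -
  have "h ** g = mat 1"
    using assms by (simp add: matrix_left_right_inverse)
  then have "\<exists>h'. g ** h' = mat 1 \<and> h' ** g = mat 1"
    using assms by blast
  then have "g ** matrix_inv g = mat 1 \<and> matrix_inv g ** g = mat 1"
    unfolding matrix_inv_def by (rule someI_ex)
  then show ?thesis
    by (metis \<open>h ** g = mat 1\<close> matrix_mul_assoc matrix_mul_lid matrix_mul_rid)
qed

lemma matrix_inv_mult:
  assumes "g \<in> SL" "h \<in> SL"
  shows "matrix_inv (g ** h) = matrix_inv h ** matrix_inv g"
  by (rule matrix_inv_unique)
     (metis assms SL_right_inverse matrix_mul_assoc matrix_mul_rid)

lemma matrix_inv_inv: "g \<in> SL \<Longrightarrow> matrix_inv (matrix_inv g) = g"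
  by (rule matrix_inv_unique) (rule SL_left_inverse)

lemma SU_SL: "k \<in> SU \<Longrightarrow> k \<in> SL"
  by (simp add: SU_def)

lemma SU_right: "k \<in> SU \<Longrightarrow> k ** adj k = mat 1"
  by (simp add: SU_def)

lemma SU_left: "k \<in> SU \<Longrightarrow> adj k ** k = mat 1"
  by (simp add: SU_def matrix_left_right_inverse)

lemma SU_inv: "k \<in> SU \<Longrightarrow> matrix_inv k = adj k"
  by (rule matrix_inv_unique) (rule SU_right)

lemma SU_one: "mat 1 \<in> SU"
  by (simp add: SU_def SL_one)

lemma SU_adj: "k \<in> SU \<Longrightarrow> adj k \<in> SU"
  using SU_left [of k] by (simp add: SU_def SL_def det_adj)

lemma SU_mult: "k \<in> SU \<Longrightarrow> l \<in> SU \<Longrightarrow> k ** l \<in> SU"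
  by (simp add: SU_def SL_mult adj_mult)
     (metis matrix_mul_assoc matrix_mul_rid)

lemma coset_eq_iff:
  assumes "g \<in> SL" "h \<in> SL"
  shows "coset g = coset h \<longleftrightarrow> matrix_inv g ** h \<in> SU"
proof
  assume "coset g = coset h"
  moreover have "h \<in> coset h"
    unfolding coset_def using SU_one by force
  ultimately obtain k where "k \<in> SU" "h = g ** k"
    unfolding coset_def by blast
  then show "matrix_inv g ** h \<in> SU"
    using assms by (simp add: SL_cancel_left)
next
  assume k: "matrix_inv g ** h \<in> SU"
  define k where "k = matrix_inv g ** h"
  have h: "h = g ** k" and kU: "k \<in> SU"
    using assms k by (simp_all add: k_def SL_cancel_left')
  have "g ** l = h ** (adj k ** l)" for l
    by (metis SU_right h kU matrix_mul_assoc matrix_mul_rid)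
  moreover have "h ** l = g ** (k ** l)" for l
    by (simp add: h matrix_mul_assoc)
  ultimately show "coset g = coset h"
    unfolding coset_def
    by (auto simp: image_iff intro: SU_mult SU_adj kU)
qed

lemma coset_mult_SU: "g \<in> SL \<Longrightarrow> k \<in> SU \<Longrightarrow> coset (g ** k) = coset g"
  by (subst eq_commute) (simp add: coset_eq_iff SL_mult SU_SL SL_cancel_left)

lemma translate_coset: "translate s (coset g) = coset (s ** g)"
  by (simp add: translate_def coset_def image_image matrix_mul_assoc)

lemma continuous_on_det:
  assumes "continuous_on S (f :: real \<Rightarrow> complex^'n^'n)"
  shows "continuous_on S (\<lambda>t. det (f t))"
  unfolding det_def by (intro continuous_intros assms)

lemma mult_axis: "(A :: complex^'n^'n) *v axis l 1 = column l A"
  by (simp add: vec_eq_iff matrix_vector_mult_def column_def axis_def if_distrib cong: if_cong)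

text \<open>
  Only the continuity of the inverse is wanted from this formula: it makes the entries of the
  inverse polynomials in the entries of \<open>g\<close>.
\<close>

lemma matrix_inv_cramer:
  assumes "g \<in> SL"
  shows "matrix_inv g = (\<chi> k l. det (\<chi> i j. if j = k then axis l 1 $ i else g $ i $ j))"
proof -
  have "g *v column l (matrix_inv g) = axis l 1" for l
    using arg_cong [OF SL_right_inverse [OF assms], of "\<lambda>M. M *v axis l 1"]
    by (simp add: matrix_vector_mul_assoc [symmetric] mult_axis [of "matrix_inv g"])
  then have *: "column l (matrix_inv g)
      = (\<chi> k. det (\<chi> i j. if j = k then axis l 1 $ i else g $ i $ j) / det g)" for l
    using assms by (intro cramer [THEN iffD1]) (auto simp: SL_def)
  have "column l (matrix_inv g) $ k = matrix_inv g $ k $ l" for k l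
    by (simp add: column_def)
  then show ?thesis
    using assms by (simp add: vec_eq_iff * SL_def)
qed

lemma continuous_on_matrix_inv:
  assumes "continuous_on S (f :: real \<Rightarrow> complex^'n^'n)" and "f ` S \<subseteq> SL"
  shows "continuous_on S (\<lambda>t. matrix_inv (f t))"
proof -
  have "continuous_on S (\<lambda>t. if j = k then axis l 1 $ i else f t $ i $ j)" for i j k l
    by (cases "j = k") (auto intro!: continuous_intros assms(1))
  then have "continuous_on S
      (\<lambda>t. \<chi> k l. det (\<chi> i j. if j = k then axis l 1 $ i else f t $ i $ j))"
    by (intro continuous_on_vec_lambda continuous_on_det)
  then show ?thesis
    by (rule continuous_on_eq) (use assms(2) in \<open>auto simp: matrix_inv_cramer\<close>)
qed

section \<open>Singular value decomposition\<close>

definition rdiag :: "real^'n \<Rightarrow> complex^'n^'n" where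
  "rdiag x = (\<chi> i j. if i = j then complex_of_real (x $ i) else 0)"

definition ediag :: "real^'n \<Rightarrow> complex^'n^'n" where
  "ediag x = (\<chi> i j. if i = j then complex_of_real (exp (x $ i)) else 0)"

text \<open>
  Through \<open>rdiag\<close> this is the space of diagonal elements of \<open>p_space\<close>, a maximal abelian
  subspace; on it \<open>ediag\<close> is the exponential map.
\<close>

definition zero_sum :: "(real^'n) set" where
  "zero_sum = {x. (\<Sum>i\<in>UNIV. x $ i) = 0}"

lemma zero_sum_scaleR: "x \<in> zero_sum \<Longrightarrow> c *\<^sub>R x \<in> zero_sum"
  by (simp add: zero_sum_def sum_distrib_left [symmetric])

lemma zero_sum_minus: "x \<in> zero_sum \<Longrightarrow> - x \<in> zero_sum"
  using zero_sum_scaleR [of x "-1"] by simp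

lemma mult_rdiag_nth: "(A ** rdiag x) $ i $ j = A $ i $ j * complex_of_real (x $ j)"
  by (simp add: matrix_matrix_mult_def rdiag_def if_distrib cong: if_cong)

lemma rdiag_mult_nth: "(rdiag x ** A) $ i $ j = complex_of_real (x $ i) * A $ i $ j"
  by (simp add: matrix_matrix_mult_def rdiag_def if_distrib if_distribR cong: if_cong)

lemma mult_ediag_nth: "(A ** ediag x) $ i $ j = A $ i $ j * complex_of_real (exp (x $ j))"
  by (simp add: matrix_matrix_mult_def ediag_def if_distrib cong: if_cong)

lemma ediag_mult_nth: "(ediag x ** A) $ i $ j = complex_of_real (exp (x $ i)) * A $ i $ j"
  by (simp add: matrix_matrix_mult_def ediag_def if_distrib if_distribR cong: if_cong)

lemma ediag_add: "ediag (x + y) = ediag x ** ediag y"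
  by (simp add: vec_eq_iff mult_ediag_nth) (simp add: ediag_def exp_add)

lemma ediag_0 [simp]: "ediag 0 = mat 1"
  by (simp add: vec_eq_iff ediag_def mat_def)

lemma adj_ediag [simp]: "adj (ediag x) = ediag x"
  by (simp add: vec_eq_iff ediag_def)

lemma adj_rdiag [simp]: "adj (rdiag x) = rdiag x"
  by (simp add: vec_eq_iff rdiag_def)

lemma det_ediag: "det (ediag x) = complex_of_real (exp (\<Sum>i\<in>UNIV. x $ i))"
  by (subst det_diagonal) (simp_all add: ediag_def exp_sum)

lemma ediag_SL: "x \<in> zero_sum \<Longrightarrow> ediag x \<in> SL"
  by (simp add: SL_def det_ediag zero_sum_def)

lemma matrix_inv_ediag: "matrix_inv (ediag x) = ediag (- x)"
  by (rule matrix_inv_unique) (simp add: ediag_add [symmetric])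

lemma norm_rdiag: "norm (rdiag x) = norm x"
proof -
  have "(norm (rdiag x))\<^sup>2 = (\<Sum>i\<in>UNIV. \<Sum>j\<in>UNIV. if j = i then (x $ i)\<^sup>2 else 0)"
    unfolding norm_matrix_sq by (intro sum.cong refl) (auto simp: rdiag_def)
  also have "\<dots> = (norm x)\<^sup>2"
    by (simp add: norm_vec_def L2_set_def sum_nonneg)
  finally show ?thesis by simp
qed

text \<open>
  The number \<open>v\<^sup>* M v\<close>.
\<close>

definition qform :: "complex^'n^'n \<Rightarrow> complex^'n \<Rightarrow> complex" where
  "qform M v = (\<Sum>a\<in>UNIV. \<Sum>b\<in>UNIV. cnj (v $ a) * M $ a $ b * v $ b)"

text \<open>
  The matrix \<open>v v\<^sup>*\<close>.
\<close>

definition proj_mat :: "complex^'n \<Rightarrow> complex^'n^'n" where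
  "proj_mat v = (\<chi> a b. v $ a * cnj (v $ b))"

lemma trace_mult_proj_mat: "trace (M ** proj_mat v) = qform M v"
  by (simp add: trace_def matrix_matrix_mult_def proj_mat_def qform_def mult_ac)

lemma proj_mat_sandwich: "proj_mat v ** M ** proj_mat v = (\<chi> a b. qform M v * proj_mat v $ a $ b)"
proof -
  have "(proj_mat v ** M ** proj_mat v) $ a $ b = qform M v * proj_mat v $ a $ b" for a b
  proof -
    have "(proj_mat v ** M ** proj_mat v) $ a $ b
      = (\<Sum>d\<in>UNIV. (\<Sum>c\<in>UNIV. v $ a * cnj (v $ c) * M $ c $ d) * (v $ d * cnj (v $ b)))"
      by (simp add: matrix_matrix_mult_def proj_mat_def)
    also have "\<dots> = (\<Sum>d\<in>UNIV. \<Sum>c\<in>UNIV. (cnj (v $ c) * M $ c $ d * v $ d) * (v $ a * cnj (v $ b)))"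
      by (simp add: sum_distrib_right) (simp add: mult_ac)
    also have "\<dots> = (\<Sum>c\<in>UNIV. \<Sum>d\<in>UNIV. (cnj (v $ c) * M $ c $ d * v $ d) * (v $ a * cnj (v $ b)))"
      by (rule sum.swap)
    finally show ?thesis
      by (simp add: qform_def proj_mat_def sum_distrib_right)
  qed
  then show ?thesis by (simp add: vec_eq_iff)
qed

lemma qform_mat1: "qform (mat 1) v = complex_of_real ((norm v)\<^sup>2)"
proof -
  have "qform (mat 1) v = (\<Sum>a\<in>UNIV. cnj (v $ a) * v $ a)"
    by (simp add: qform_def mat_def if_distrib if_distribR cong: if_cong)
  also have "\<dots> = (\<Sum>a\<in>UNIV. complex_of_real ((cmod (v $ a))\<^sup>2))"
    by (intro sum.cong refl) (metis complex_norm_square mult.commute)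
  finally show ?thesis
    by (simp add: norm_vec_def L2_set_def sum_nonneg)
qed

lemma trace_scaleR: "trace (c *\<^sub>R (A :: complex^'n^'n)) = complex_of_real c * trace A"
  by (simp add: trace_def scaleR_conv_of_real [where 'a = complex] sum_distrib_left)

lemma matrix_scaleR_left: "(c *\<^sub>R A :: complex^'n^'n) ** (B :: complex^'n^'n) = c *\<^sub>R (A ** B)"
  by (simp add: bounded_bilinear.scaleR_left [OF bounded_bilinear_matrix_mult])

lemma matrix_scaleR_right: "A ** (c *\<^sub>R B :: complex^'n^'n) = c *\<^sub>R ((A :: complex^'n^'n) ** B)"
  by (simp add: bounded_bilinear.scaleR_right [OF bounded_bilinear_matrix_mult])

text \<open>
  The reflection \<open>1 - 2 v v\<^sup>* / \<bar>v\<bar>\<^sup>2\<close> is unitary for every \<open>v\<close>, and conjugation by it changes the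
  trace of \<open>N ** B\<close> by an expression in the quadratic forms at \<open>v\<close>. So reflections alone convert
  maximality among the unitary conjugates into inequalities without any curve in the unitary group.
\<close>

lemma householder_maximal:
  fixes B N :: "complex^'n^'n"
  assumes B: "adj B = B" and N: "adj N = N"
    and max: "\<And>R. R ** adj R = mat 1 \<Longrightarrow> Re (trace (N ** (adj R ** B ** R))) \<le> Re (trace (N ** B))"
  shows "Re (qform B v * qform N v) \<le> (norm v)\<^sup>2 * Re (qform (B ** N) v)"
proof (cases "v = 0")
  case True
  then show ?thesis by (simp add: qform_def)
next
  case False
  define s where "s = (norm v)\<^sup>2"
  have s: "s > 0" using False by (simp add: s_def)
  define Q where "Q = proj_mat v"
  define R where "R = mat 1 - (2 / s) *\<^sub>R Q"
  have adjQ: "adj Q = Q"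
    by (simp add: vec_eq_iff Q_def proj_mat_def)
  have adjR: "adj R = R"
  proof -
    have "adj R = adj (mat 1) - (2 / s) *\<^sub>R adj Q"
      by (simp add: R_def vec_eq_iff mat_def)
    then show ?thesis by (simp add: R_def adjQ)
  qed
  have QQ: "Q ** Q = s *\<^sub>R Q"
    using proj_mat_sandwich [of v "mat 1"]
    by (simp add: Q_def qform_mat1 s_def vec_eq_iff scaleR_conv_of_real [where 'a = complex])
  have RR: "R ** R = mat 1 - (2/s) *\<^sub>R Q - (2/s) *\<^sub>R Q + (2/s * (2/s)) *\<^sub>R (Q ** Q)"
    unfolding R_def
    by (simp add: matrix_mult_diff_left matrix_mult_diff_right matrix_scaleR_left matrix_scaleR_right
        algebra_simps)
  have "(2/s * (2/s)) *\<^sub>R (Q ** Q) = (2/s) *\<^sub>R Q + (2/s) *\<^sub>R Q"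
    unfolding QQ using s by (simp add: scaleR_add_left [symmetric])
  then have unit: "R ** adj R = mat 1"
    by (simp add: adjR RR)
  have "adj R ** B ** R = B - (2/s) *\<^sub>R (Q ** B) - (2/s) *\<^sub>R (B ** Q) + (2/s * (2/s)) *\<^sub>R (Q ** B ** Q)"
    unfolding adjR unfolding R_def
    by (simp add: matrix_mult_diff_left matrix_mult_diff_right matrix_scaleR_left matrix_scaleR_right
        algebra_simps)
  then have "trace (N ** (adj R ** B ** R)) = trace (N ** B) - complex_of_real (2/s) * trace (N ** (Q ** B))
     - complex_of_real (2/s) * trace (N ** (B ** Q)) + complex_of_real (2/s * (2/s)) * trace (N ** (Q ** B ** Q))"
    by (simp only: matrix_mult_diff_right matrix_add_ldistrib matrix_scaleR_right
        trace_add trace_sub trace_scaleR)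
  moreover have "trace (N ** (Q ** B)) = qform (B ** N) v"
    by (metis Q_def trace_mult_proj_mat matrix_mul_assoc trace_mul_sym)
  moreover have "trace (N ** (B ** Q)) = cnj (qform (B ** N) v)"
  proof -
    have *: "trace (adj M) = cnj (trace M)" for M :: "complex^'n^'n"
      by (simp add: trace_def)
    have "cnj (qform (B ** N) v) = trace (adj (B ** N ** Q))"
      by (simp add: * Q_def trace_mult_proj_mat)
    also have "\<dots> = trace (Q ** (N ** B))"
      by (simp add: adj_mult adjQ B N)
    finally show ?thesis
      by (metis matrix_mul_assoc trace_mul_sym)
  qed
  moreover have "trace (N ** (Q ** B ** Q)) = qform B v * qform N v"
  proof -
    have "N ** (Q ** B ** Q) = (\<chi> a b. qform B v * (N ** Q) $ a $ b)"
      unfolding Q_def proj_mat_sandwich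
      by (simp add: vec_eq_iff matrix_matrix_mult_def sum_distrib_left mult_ac)
    then have "trace (N ** (Q ** B ** Q)) = qform B v * trace (N ** Q)"
      by (simp add: trace_def sum_distrib_left)
    then show ?thesis
      by (simp add: Q_def trace_mult_proj_mat)
  qed
  ultimately have "0 \<ge> - 2 * (2/s) * Re (qform (B ** N) v) + (2/s * (2/s)) * Re (qform B v * qform N v)"
    using max [OF unit] by simp
  then have "(2/s * (2/s)) * Re (qform B v * qform N v) \<le> 2 * (2/s) * Re (qform (B ** N) v)"
    by simp
  then have "(2/s * (2/s)) * Re (qform B v * qform N v) * (s * s / 4) \<le> 2 * (2/s) * Re (qform (B ** N) v) * (s * s / 4)"
    using s by (intro mult_right_mono) auto
  moreover have "(2/s * (2/s)) * X * (s * s / 4) = X" "2 * (2/s) * X * (s * s / 4) = s * X" for X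
    using s by (simp_all add: field_simps)
  ultimately have "Re (qform B v * qform N v) \<le> s * Re (qform (B ** N) v)"
    by metis
  then show ?thesis
    unfolding s_def .
qed

lemma sum_two:
  fixes F :: "'n::finite \<Rightarrow> complex"
  assumes "i \<noteq> j"
  shows "(\<Sum>a\<in>UNIV. (if a = i then p else if a = j then q else 0) * F a) = p * F i + q * F j"
proof -
  have "(\<Sum>a\<in>UNIV. (if a = i then p else if a = j then q else 0) * F a)
      = (\<Sum>a\<in>UNIV. (if a = i then p * F i else 0) + (if a = j then q * F j else 0))"
    using assms by (intro sum.cong) auto
  then show ?thesis by (simp add: sum.distrib)
qed

lemma qform_two:
  fixes M :: "complex^'n^'n"
  assumes "i \<noteq> j"
  shows "qform M (\<chi> a. if a = i then 1 else if a = j then z else 0)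
    = M $ i $ i + z * M $ i $ j + cnj z * M $ j $ i + cnj z * z * M $ j $ j"
proof -
  let ?v = "\<lambda>a. if a = i then 1 else if a = j then z else 0"
  have "qform M (\<chi> a. ?v a)
    = (\<Sum>a\<in>UNIV. (if a = i then 1 else if a = j then cnj z else 0) * (\<Sum>b\<in>UNIV. ?v b * M $ a $ b))"
    unfolding qform_def
    by (intro sum.cong refl) (auto simp: sum_distrib_left mult_ac intro!: sum.cong)
  then show ?thesis
    by (simp only: sum_two [OF assms]) (simp add: algebra_simps)
qed

text \<open>
  Among the conjugates of \<open>P\<close> under the compact unitary group one maximises the trace of its
  product with a diagonal matrix \<open>N\<close> with distinct entries. At the maximum \<open>B\<close>, the inequality of
  \<open>householder_maximal\<close> for \<open>v = e\<^sub>i + z e\<^sub>j\<close> has a part of first order in \<open>z\<close>, which is a multiple of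
  \<open>(n\<^sub>i - n\<^sub>j) Re (z B\<^sub>i\<^sub>j)\<close>. Since \<open>z\<close> may be replaced by \<open>- z\<close>, this forces \<open>B\<^sub>i\<^sub>j = 0\<close>.
\<close>

lemma exists_unitary_diagonalisation:
  fixes P :: "complex^'n^'n"
  assumes P: "adj P = P"
  shows "\<exists>U. U ** adj U = mat 1 \<and> (\<forall>i j. i \<noteq> j \<longrightarrow> (adj U ** P ** U) $ i $ j = 0)"
proof -
  obtain f :: "'n \<Rightarrow> nat" where f: "inj f"
    using finite_imp_inj_to_nat_seg [of "UNIV :: 'n set"] by auto
  define n where "n = (\<chi> k. real (f k))"
  have n: "n $ i \<noteq> n $ j" if "i \<noteq> j" for i j
    using that f by (auto simp: n_def inj_def)
  define \<U> where "\<U> = {U :: complex^'n^'n. U ** adj U = mat 1}"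
  have cont: "continuous_on UNIV (\<lambda>U :: complex^'n^'n. U ** adj U)"
    by (intro continuous_on_matrix_mult continuous_on_id bounded_linear.continuous_on [OF bounded_linear_adj])
  have "closed \<U>"
    using continuous_closed_preimage_constant [OF cont closed_UNIV, of "mat 1"]
    by (simp add: \<U>_def)
  moreover have "bounded \<U>"
  proof -
    have "norm U = norm (mat 1 :: complex^'n^'n)" if "U \<in> \<U>" for U
      using norm_mult_unitary_right [of U "mat 1"] that by (simp add: \<U>_def)
    then show ?thesis
      unfolding bounded_iff by (intro exI [of _ "norm (mat 1 :: complex^'n^'n)"]) auto
  qed
  ultimately have "compact \<U>"
    by (simp add: compact_eq_bounded_closed)
  moreover have "mat 1 \<in> \<U>"
    by (simp add: \<U>_def)
  moreover have "continuous_on \<U> (\<lambda>U. Re (trace (rdiag n ** (adj U ** P ** U))))"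
  proof -
    have "continuous_on \<U> (\<lambda>U. rdiag n ** (adj U ** P ** U))"
      by (intro continuous_on_matrix_mult continuous_on_id continuous_on_const
          bounded_linear.continuous_on [OF bounded_linear_adj])
    then show ?thesis
      unfolding trace_def by (intro continuous_intros)
  qed
  ultimately obtain U where U: "U \<in> \<U>"
    and max: "\<And>V. V \<in> \<U> \<Longrightarrow> Re (trace (rdiag n ** (adj V ** P ** V))) \<le> Re (trace (rdiag n ** (adj U ** P ** U)))"
    using continuous_attains_sup [of \<U> "\<lambda>U. Re (trace (rdiag n ** (adj U ** P ** U)))"] by blast
  define B where "B = adj U ** P ** U"
  have B: "adj B = B"
    by (simp add: B_def adj_mult P matrix_mul_assoc)
  have Bm: "Re (trace (rdiag n ** (adj R ** B ** R))) \<le> Re (trace (rdiag n ** B))"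
    if "R ** adj R = mat 1" for R
  proof -
    have "(U ** R) ** adj (U ** R) = U ** (R ** adj R) ** adj U"
      by (simp add: adj_mult matrix_mul_assoc)
    then have "U ** R \<in> \<U>"
      using U that by (simp add: \<U>_def)
    from max [OF this] show ?thesis
      by (simp add: B_def adj_mult matrix_mul_assoc)
  qed
  have "B $ i $ j = 0" if ij: "i \<noteq> j" for i j
  proof (rule ccontr)
    assume b: "B $ i $ j \<noteq> 0"
    define m where "m = (cmod (B $ i $ j))\<^sup>2"
    define p q where "p = Re (B $ i $ i)" and "q = Re (B $ j $ j)"
    have m: "m > 0" using b by (simp add: m_def)
    have Bh: "B $ k $ l = cnj (B $ l $ k)" for k l
      using arg_cong [OF B, of "\<lambda>M. M $ k $ l"] by simp
    have p: "B $ i $ i = complex_of_real p" and q: "B $ j $ j = complex_of_real q"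
      using Bh [of i i] Bh [of j j] by (simp_all add: p_def q_def complex_eq_iff)
    have bb: "B $ i $ j * cnj (B $ i $ j) = complex_of_real m"
      by (simp add: m_def complex_norm_square [symmetric])
    have ineq: "m * r * (n $ i - n $ j) * (1 + r * (q - p) - r\<^sup>2 * m) \<le> 0" for r
    proof -
      define z where "z = complex_of_real r * cnj (B $ i $ j)"
      define v :: "complex^'n" where "v = (\<chi> a. if a = i then 1 else if a = j then z else 0)"
      have z1: "z * B $ i $ j = complex_of_real (r * m)"
        by (simp add: z_def mult.assoc mult.commute [of "cnj (B $ i $ j)"] bb)
      have z2: "cnj z * B $ j $ i = complex_of_real (r * m)"
        using arg_cong [OF z1, of cnj] Bh [of j i] by simp
      have z3: "cnj z * z = complex_of_real (r\<^sup>2 * m)"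
        using bb by (simp add: z_def power2_eq_square mult_ac)
      have qB: "qform B v = complex_of_real (p + 2 * r * m + r\<^sup>2 * m * q)"
        unfolding v_def qform_two [OF ij] z1 z2 z3 p q by simp
      have qN: "qform (rdiag n) v = complex_of_real (n $ i + r\<^sup>2 * m * n $ j)"
        unfolding v_def qform_two [OF ij] z3 using ij by (simp add: rdiag_def)
      have qBN: "qform (B ** rdiag n) v
          = complex_of_real (p * n $ i + r * m * n $ j + r * m * n $ i + r\<^sup>2 * m * q * n $ j)"
      proof -
        have "qform (B ** rdiag n) v = B $ i $ i * n $ i + (z * B $ i $ j) * n $ j
           + (cnj z * B $ j $ i) * n $ i + (cnj z * z) * B $ j $ j * n $ j"
          unfolding v_def qform_two [OF ij] mult_rdiag_nth by (simp add: mult_ac)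
        then show ?thesis unfolding z1 z2 z3 p q by simp
      qed
      have "complex_of_real ((norm v)\<^sup>2) = complex_of_real (1 + r\<^sup>2 * m)"
        unfolding qform_mat1 [symmetric] v_def qform_two [OF ij] z3 using ij by (simp add: mat_def)
      then have nv: "(norm v)\<^sup>2 = 1 + r\<^sup>2 * m"
        by (simp only: of_real_eq_iff)
      have "(p + 2 * r * m + r\<^sup>2 * m * q) * (n $ i + r\<^sup>2 * m * n $ j)
         \<le> (1 + r\<^sup>2 * m) * (p * n $ i + r * m * n $ j + r * m * n $ i + r\<^sup>2 * m * q * n $ j)"
        using householder_maximal [OF B adj_rdiag [of n] Bm, of v]
        unfolding qB qN qBN nv by simp
      then show ?thesis
        by (simp add: algebra_simps power2_eq_square)
    qed
    \<comment> \<open>For \<open>r = \<plusminus> d\<close> the last factor in \<open>ineq\<close> is positive, so the sign of the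
      first order part decides.\<close>
    define d where "d = 1 / (2 * (1 + \<bar>q - p\<bar> + m))"
    define w where "w = \<bar>q - p\<bar>"
    have w: "w \<ge> 0" by (simp add: w_def)
    define D where "D = 1 + w + m"
    have D: "D \<ge> 1" and dD: "d = 1 / (2 * D)"
      using w m by (simp_all add: D_def d_def w_def)
    have d: "d > 0" "d \<le> 1/2"
      using D by (simp_all add: dD)
    have "d * (w + m) \<le> d * D"
      using d by (intro mult_left_mono) (auto simp: D_def)
    also have "\<dots> = 1/2"
      using D by (simp add: dD)
    finally have d2: "d * \<bar>q - p\<bar> + d * m \<le> 1/2"
      by (simp add: w_def distrib_left)
    have "d\<^sup>2 * m \<le> d * m * (1/2)"
      using d m by (simp add: power2_eq_square)
    moreover have "\<bar>d * (q - p)\<bar> = d * \<bar>q - p\<bar>" "d * m > 0"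
      using d m by (simp_all add: abs_mult)
    ultimately have pos: "1 + d * (q - p) - d\<^sup>2 * m > 0" "1 + (-d) * (q - p) - (-d)\<^sup>2 * m > 0"
      using d2 by (auto simp: abs_if split: if_splits)
    have key: "A \<le> 0" if "A * c \<le> 0" "c > 0" for A c :: real
      using that by (simp add: mult_le_0_iff)
    have "m * d * (n $ i - n $ j) \<le> 0" "m * (-d) * (n $ i - n $ j) \<le> 0"
      by (rule key [OF ineq pos(1)], rule key [OF ineq pos(2)])
    then have "n $ i - n $ j = 0"
      using m d by (simp add: mult_le_0_iff zero_le_mult_iff)
    then show False using n [OF ij] by simp
  qed
  then show ?thesis
    using U unfolding B_def \<U>_def by blast
qed

text \<open>
  Diagonalising \<open>g g\<^sup>*\<close> gives \<open>g = U e\<^sup>x V\<close> with unitary \<open>U\<close> and \<open>V\<close>. Their determinants have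
  product 1 and become 1 separately when a phase is moved through the diagonal factor.
\<close>

lemma SL_singular_value_decomposition:
  fixes g :: "complex^'n^'n"
  assumes g: "g \<in> SL"
  obtains U x V where "U \<in> SU" "x \<in> zero_sum" "V \<in> SU" "g = U ** ediag x ** V"
proof -
  obtain U where U: "U ** adj U = mat 1"
    and diag: "\<And>i j. i \<noteq> j \<Longrightarrow> (adj U ** (g ** adj g) ** U) $ i $ j = 0"
    using exists_unitary_diagonalisation [of "g ** adj g"] by (auto simp: adj_mult)
  have U': "adj U ** U = mat 1"
    using U by (simp add: matrix_left_right_inverse)
  define h where "h = adj U ** g"
  define b where "b k = (\<Sum>m\<in>UNIV. (cmod (h $ k $ m))\<^sup>2)" for k
  have hh: "h ** adj h = adj U ** (g ** adj g) ** U"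
    by (simp add: h_def adj_mult matrix_mul_assoc)
  have bk: "(h ** adj h) $ k $ k = complex_of_real (b k)" for k
    by (simp add: b_def matrix_matrix_mult_def complex_norm_square [symmetric])
  have dU: "det U * cnj (det U) = 1"
    using arg_cong [OF U, of det] by (simp add: det_mul det_adj)
  have "det (h ** adj h) = 1"
    using g dU by (simp add: h_def det_mul det_adj SL_def mult_ac)
  moreover have "det (h ** adj h) = (\<Prod>k\<in>UNIV. complex_of_real (b k))"
    using diag by (subst det_diagonal) (simp_all add: hh [symmetric] bk)
  ultimately have "complex_of_real (\<Prod>k\<in>UNIV. b k) = complex_of_real 1"
    by simp
  then have prod1: "(\<Prod>k\<in>UNIV. b k) = 1"
    by (simp only: of_real_eq_iff)
  have pos: "b k > 0" for k
  proof -
    have "b k \<noteq> 0"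
    proof
      assume "b k = 0"
      then have "(\<Prod>k\<in>UNIV. b k) = 0"
        by (intro prod_zero) auto
      then show False by (simp add: prod1)
    qed
    then show ?thesis
      using sum_nonneg [of UNIV "\<lambda>m. (cmod (h $ k $ m))\<^sup>2"] by (simp add: b_def order_less_le)
  qed
  define x where "x = (\<chi> k. ln (b k) / 2)"
  have nz: "b k \<noteq> 0" for k
    using pos [of k] by simp
  have "(\<Sum>k\<in>UNIV. x $ k) = ln (\<Prod>k\<in>UNIV. b k) / 2"
    by (simp add: x_def sum_divide_distrib [symmetric] ln_prod nz)
  then have x: "x \<in> zero_sum"
    by (simp add: prod1 zero_sum_def)
  have ex: "exp (- x $ k) * b k * exp (- x $ k) = 1" for k
  proof -
    have "exp (- x $ k) * b k * exp (- x $ k) = exp (- x $ k) * exp (- x $ k) * exp (ln (b k))"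
      using pos by simp
    also have "\<dots> = 1"
      by (simp only: exp_add [symmetric]) (simp add: x_def)
    finally show ?thesis .
  qed
  define V where "V = ediag (- x) ** h"
  have "V ** adj V = ediag (- x) ** (h ** adj h) ** ediag (- x)"
    by (simp add: V_def adj_mult matrix_mul_assoc)
  also have "\<dots> = mat 1"
  proof -
    have "(ediag (- x) ** (h ** adj h) ** ediag (- x)) $ i $ j = mat 1 $ i $ j" for i j
    proof (cases "i = j")
      case True
      show ?thesis
        unfolding True mult_ediag_nth ediag_mult_nth bk
        using arg_cong [OF ex [of j], of complex_of_real] by (simp add: mat_def)
    next
      case False
      then show ?thesis
        using diag by (simp add: mult_ediag_nth ediag_mult_nth hh mat_def)
    qed
    then show ?thesis by (simp add: vec_eq_iff)
  qed
  finally have V: "V ** adj V = mat 1" .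
  have "ediag x ** V = h"
    unfolding V_def by (simp add: matrix_mul_assoc ediag_add [symmetric])
  then have gUV: "g = U ** ediag x ** V"
    by (metis U h_def matrix_mul_assoc matrix_mul_lid)
  obtain k0 :: 'n where "True" by simp
  \<comment> \<open>\<open>D\<close> carries the phase: it commutes with \<open>e\<^sup>x\<close> and its determinant is inverse to that of \<open>U\<close>.\<close>
  define c where "c i = (if i = k0 then cnj (det U) else 1)" for i
  define D :: "complex^'n^'n" where "D = (\<chi> i j. if i = j then c i else 0)"
  have c: "c i * cnj (c i) = 1" for i
    using dU by (simp add: c_def mult.commute)
  have D_mult: "(D ** A) $ i $ j = c i * A $ i $ j" for A :: "complex^'n^'n" and i j
    by (simp add: D_def matrix_matrix_mult_def if_distrib if_distribR cong: if_cong)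
  have DD: "D ** adj D = mat 1"
    by (simp add: vec_eq_iff D_mult) (simp add: D_def c mat_def)
  have DE: "D ** ediag x = ediag x ** D"
    by (simp add: vec_eq_iff D_mult ediag_mult_nth) (simp add: D_def ediag_def)
  have detD: "det D = cnj (det U)"
    by (subst det_diagonal) (simp_all add: D_def c_def)
  have "(U ** D) ** adj (U ** D) = U ** (D ** adj D) ** adj U"
    by (simp add: adj_mult matrix_mul_assoc)
  then have UD: "U ** D \<in> SU"
    using U dU by (simp add: SU_def SL_def DD det_mul detD)
  have DD': "adj D ** D = mat 1"
    using DD by (simp add: matrix_left_right_inverse)
  have "(adj D ** V) ** adj (adj D ** V) = adj D ** (V ** adj V) ** D"
    by (simp add: adj_mult matrix_mul_assoc)
  moreover have "det (adj D ** V) = 1"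
  proof -
    have "det U * det V = 1"
      using arg_cong [OF gUV, of det] g x by (simp add: det_mul SL_def det_ediag zero_sum_def)
    then show ?thesis by (simp add: det_mul det_adj detD)
  qed
  ultimately have DV: "adj D ** V \<in> SU"
    by (simp add: SU_def SL_def V DD')
  have "(U ** D) ** ediag x ** (adj D ** V) = U ** (D ** ediag x) ** adj D ** V"
    by (simp add: matrix_mul_assoc)
  also have "\<dots> = U ** ediag x ** (D ** adj D) ** V"
    by (simp add: DE matrix_mul_assoc)
  finally have "g = (U ** D) ** ediag x ** (adj D ** V)"
    by (simp add: DD gUV)
  then show thesis
    using that UD DV x by blast
qed

section \<open>The Riemannian distance\<close>

lemma abs_le_abs_sinh: "\<bar>t\<bar> \<le> \<bar>sinh t\<bar>" for t :: real
proof -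
  have mono: "sinh 0 - 0 \<le> sinh u - u" if "0 \<le> u" for u :: real
  proof (rule DERIV_nonneg_imp_nondecreasing [OF that])
    fix x :: real
    have "((\<lambda>x. sinh x - x) has_real_derivative cosh x - 1) (at x)"
      by (auto intro!: derivative_eq_intros)
    then show "\<exists>y. ((\<lambda>x. sinh x - x) has_real_derivative y) (at x) \<and> 0 \<le> y"
      using cosh_real_ge_1 [of x] by auto
  qed
  show ?thesis
    using mono [of t] mono [of "- t"] by (cases "0 \<le> t") auto
qed

lemma norm_matrix_mono:
  fixes A B :: "complex^'n^'n"
  assumes "\<And>i j. cmod (A $ i $ j) \<le> cmod (B $ i $ j)"
  shows "norm A \<le> norm B"
proof -
  have "(norm A)\<^sup>2 \<le> (norm B)\<^sup>2"
    unfolding norm_matrix_sq by (intro sum_mono power_mono assms) auto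
  then show ?thesis by (simp add: power2_le_iff_abs_le)
qed

text \<open>
  Put \<open>W = U\<^sup>* V\<close>. Up to unitary factors on both sides, which the Frobenius norm does not see, the
  matrices compared here have the entries \<open>2 W\<^sub>i\<^sub>j (x\<^sub>i - y\<^sub>j)\<close> and \<open>2 W\<^sub>i\<^sub>j sinh (y\<^sub>j - x\<^sub>i)\<close>. The
  right-hand side is an invariant of the pair of cosets that agrees to first order with a multiple of
  the Riemannian length.
\<close>

lemma exponential_metric_increasing:
  fixes g h :: "complex^'n^'n"
  assumes U: "U \<in> SU" and V: "V \<in> SU" and k: "k \<in> SU" and l: "l \<in> SU"
    and x: "x \<in> zero_sum" and y: "y \<in> zero_sum"
    and g: "g = U ** ediag x ** k" and h: "h = V ** ediag y ** l"
  shows "2 * norm (U ** rdiag x ** adj U - V ** rdiag y ** adj V)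
    \<le> norm (matrix_inv g ** h - adj (matrix_inv (matrix_inv g ** h)))"
proof -
  define W where "W = adj U ** V"
  have adjW: "adj W = adj V ** U"
    by (simp add: W_def adj_mult)
  have inv: "matrix_inv g = adj k ** ediag (- x) ** adj U"
    "matrix_inv h = adj l ** ediag (- y) ** adj V"
    using U V k l x y
    by (simp_all add: g h matrix_inv_mult SL_mult SU_SL ediag_SL SU_inv matrix_inv_ediag matrix_mul_assoc)
  have gSL: "g \<in> SL" and hSL: "h \<in> SL"
    using U V k l x y by (simp_all add: g h SL_mult SU_SL ediag_SL)
  have m: "matrix_inv g ** h = adj k ** (ediag (- x) ** W ** ediag y) ** l"
    by (simp add: inv h W_def matrix_mul_assoc)
  have "matrix_inv (matrix_inv g ** h) = adj l ** ediag (- y) ** adj W ** ediag x ** k"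
    using gSL hSL
    by (simp add: matrix_inv_mult SL_inv matrix_inv_inv)
       (simp add: inv g adjW matrix_mul_assoc)
  then have "adj (matrix_inv (matrix_inv g ** h)) = adj k ** (ediag x ** W ** ediag (- y)) ** l"
    by (simp add: adj_mult matrix_mul_assoc)
  then have "matrix_inv g ** h - adj (matrix_inv (matrix_inv g ** h))
    = adj k ** (ediag (- x) ** W ** ediag y - ediag x ** W ** ediag (- y)) ** l"
    by (simp add: m matrix_mult_diff_left matrix_mult_diff_right)
  then have "norm (matrix_inv g ** h - adj (matrix_inv (matrix_inv g ** h)))
    = norm (ediag (- x) ** W ** ediag y - ediag x ** W ** ediag (- y))" (is "_ = norm ?M")
    using k l by (simp add: norm_mult_unitary_left norm_mult_unitary_right SU_left SU_right)
  moreover have "norm (U ** rdiag x ** adj U - V ** rdiag y ** adj V) = norm (rdiag x ** W - W ** rdiag y)"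
  proof -
    have "adj U ** (U ** rdiag x ** adj U - V ** rdiag y ** adj V) ** V
      = (adj U ** U) ** rdiag x ** W - W ** rdiag y ** (adj V ** V)"
      by (simp add: W_def matrix_mult_diff_left matrix_mult_diff_right matrix_mul_assoc)
    also have "\<dots> = rdiag x ** W - W ** rdiag y"
      using U V by (simp add: SU_left)
    finally show ?thesis
      using U V by (metis SU_left SU_right adj_adj norm_mult_unitary_left norm_mult_unitary_right)
  qed
  moreover have "norm (2 *\<^sub>R (rdiag x ** W - W ** rdiag y)) \<le> norm ?M"
  proof (rule norm_matrix_mono)
    fix i j
    have "?M $ i $ j = W $ i $ j * complex_of_real (exp (y $ j - x $ i) - exp (x $ i - y $ j))"
      by (simp add: mult_ediag_nth ediag_mult_nth exp_diff exp_minus field_simps)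
    moreover have "2 * sinh (y $ j - x $ i) = exp (y $ j - x $ i) - exp (x $ i - y $ j)"
      by (simp add: sinh_field_def)
    ultimately have 1: "?M $ i $ j = W $ i $ j * complex_of_real (2 * sinh (y $ j - x $ i))"
      by (simp only:)
    have 2: "(2 *\<^sub>R (rdiag x ** W - W ** rdiag y)) $ i $ j = W $ i $ j * complex_of_real (2 * (x $ i - y $ j))"
      by (simp add: rdiag_mult_nth mult_rdiag_nth scaleR_conv_of_real [where 'a = complex] algebra_simps)
    have "\<bar>x $ i - y $ j\<bar> \<le> \<bar>sinh (y $ j - x $ i)\<bar>"
      using abs_le_abs_sinh [of "y $ j - x $ i"] by (simp add: abs_minus_commute)
    then show "cmod ((2 *\<^sub>R (rdiag x ** W - W ** rdiag y)) $ i $ j) \<le> cmod (?M $ i $ j)"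
      unfolding 1 2 norm_mult norm_of_real by (intro mult_left_mono) auto
  qed
  ultimately show ?thesis by simp
qed

text \<open>
  Half of the logarithm of \<open>g g\<^sup>*\<close>. It is read off from some singular value decomposition; by
  \<open>herm_log_eq\<close> all of them give the same result.
\<close>

definition herm_log :: "complex^'n^'n \<Rightarrow> complex^'n^'n" where
  "herm_log g = (SOME X. \<exists>U x k. U \<in> SU \<and> x \<in> zero_sum \<and> k \<in> SU \<and>
     g = U ** ediag x ** k \<and> X = U ** rdiag x ** adj U)"

lemma herm_log_witness:
  assumes "g \<in> SL"
  obtains U x k where "U \<in> SU" "x \<in> zero_sum" "k \<in> SU" "g = U ** ediag x ** k"
    "herm_log g = U ** rdiag x ** adj U"
proof -
  have "\<exists>X U x k. U \<in> SU \<and> x \<in> zero_sum \<and> k \<in> SU \<and>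
     g = U ** ediag x ** k \<and> X = U ** rdiag x ** adj U"
    using SL_singular_value_decomposition [OF assms] by metis
  from someI_ex [OF this] show thesis
    using that unfolding herm_log_def by blast
qed

lemma herm_log_increment:
  assumes "g \<in> SL" "h \<in> SL"
  shows "2 * norm (herm_log g - herm_log h)
    \<le> norm (matrix_inv g ** h - adj (matrix_inv (matrix_inv g ** h)))"
proof -
  obtain U x k where 1: "U \<in> SU" "x \<in> zero_sum" "k \<in> SU" "g = U ** ediag x ** k"
    "herm_log g = U ** rdiag x ** adj U"
    using herm_log_witness [OF assms(1)] .
  obtain V y l where 2: "V \<in> SU" "y \<in> zero_sum" "l \<in> SU" "h = V ** ediag y ** l"
    "herm_log h = V ** rdiag y ** adj V"
    using herm_log_witness [OF assms(2)] .
  show ?thesis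
    unfolding 1(5) 2(5) by (rule exponential_metric_increasing) (fact 1 2)+
qed

text \<open>
  For two decompositions of one matrix the right-hand side of \<open>exponential_metric_increasing\<close> is 0.
\<close>

lemma herm_log_eq:
  assumes "U \<in> SU" "x \<in> zero_sum" "k \<in> SU"
  shows "herm_log (U ** ediag x ** k) = U ** rdiag x ** adj U"
proof -
  let ?g = "U ** ediag x ** k"
  have g: "?g \<in> SL"
    using assms by (simp add: SL_mult SU_SL ediag_SL)
  obtain V y l where 2: "V \<in> SU" "y \<in> zero_sum" "l \<in> SU" "?g = V ** ediag y ** l"
    "herm_log ?g = V ** rdiag y ** adj V"
    using herm_log_witness [OF g] .
  have "2 * norm (U ** rdiag x ** adj U - V ** rdiag y ** adj V)
    \<le> norm (matrix_inv ?g ** ?g - adj (matrix_inv (matrix_inv ?g ** ?g)))"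
    by (rule exponential_metric_increasing [OF assms(1) 2(1) assms(3) 2(3) assms(2) 2(2) refl 2(4)])
  also have "\<dots> = 0"
    using g by (simp add: SL_left_inverse matrix_inv_unique)
  finally show ?thesis
    by (simp add: 2(5))
qed

lemma herm_log_coset:
  assumes "g \<in> SL" "h \<in> SL" "coset g = coset h"
  shows "herm_log g = herm_log h"
proof -
  obtain U x k where 1: "U \<in> SU" "x \<in> zero_sum" "k \<in> SU" "g = U ** ediag x ** k"
    "herm_log g = U ** rdiag x ** adj U"
    using herm_log_witness [OF assms(1)] .
  define l where "l = matrix_inv g ** h"
  have l: "l \<in> SU"
    using assms coset_eq_iff l_def by blast
  have "h = U ** ediag x ** (k ** l)"
    using assms by (simp add: l_def matrix_mul_assoc 1(4) [symmetric] SL_right_inverse)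
  then show ?thesis
    using herm_log_eq [OF 1(1,2) SU_mult [OF 1(3) l]] 1(5) by simp
qed

lemma adj_herm_part: "adj (herm_part A) = herm_part A"
  by (simp add: vec_eq_iff herm_part_def add.commute)

lemma norm_herm_part: "norm (A + adj A) = 2 * norm (herm_part A)"
  by (simp add: herm_part_def)

text \<open>
  On hermitian matrices the Killing form is \<open>4 n\<close> times the square of the Frobenius norm.
\<close>

lemma speed_eq:
  fixes g :: "real \<Rightarrow> complex^'n^'n"
  shows "speed g t = 2 * sqrt CARD('n) * norm (herm_part (matrix_inv (g t) ** vector_derivative g (at t)))"
proof -
  define X where "X = herm_part (matrix_inv (g t) ** vector_derivative g (at t))"
  have "killing X X = 4 * real CARD('n) * (norm X)\<^sup>2"
    using norm_sq_trace [of X] by (simp add: killing_def X_def adj_herm_part complex_eq_iff)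
  then have "speed g t = sqrt (4 * real CARD('n) * (norm X)\<^sup>2)"
    by (simp add: speed_def Let_def X_def)
  then show ?thesis
    by (simp add: real_sqrt_mult X_def)
qed

lemma has_vector_derivative_difference_quotient:
  assumes "(f has_vector_derivative D) (at t within S)"
  shows "((\<lambda>s. (1 / (s - t)) *\<^sub>R (f s - f t)) \<longlongrightarrow> D) (at t within S)"
proof -
  have "((\<lambda>s. (1 / norm (s - t)) *\<^sub>R (f s - (f t + (s - t) *\<^sub>R D))) \<longlongrightarrow> 0) (at t within S)"
    using assms by (simp add: has_vector_derivative_def has_derivative_within)
  then have lim: "((\<lambda>s. norm ((1 / norm (s - t)) *\<^sub>R (f s - (f t + (s - t) *\<^sub>R D)))) \<longlongrightarrow> 0) (at t within S)"
    by (rule tendsto_norm_zero)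
  have "norm ((1 / norm (s - t)) *\<^sub>R (f s - (f t + (s - t) *\<^sub>R D)))
    = norm ((1 / (s - t)) *\<^sub>R (f s - f t) - D)" if "s \<noteq> t" for s
  proof -
    have "(1 / (s - t)) *\<^sub>R (f s - (f t + (s - t) *\<^sub>R D))
      = (1 / (s - t)) *\<^sub>R (f s - f t) - (1 / (s - t) * (s - t)) *\<^sub>R D"
      by (simp only: scaleR_right_diff_distrib scaleR_add_right scaleR_scaleR diff_diff_eq)
    also have "\<dots> = (1 / (s - t)) *\<^sub>R (f s - f t) - D"
      using that by simp
    finally have "(1 / (s - t)) *\<^sub>R (f s - f t) - D = (1 / (s - t)) *\<^sub>R (f s - (f t + (s - t) *\<^sub>R D))"
      by simp
    then show ?thesis by simp
  qed
  then have "((\<lambda>s. norm ((1 / (s - t)) *\<^sub>R (f s - f t) - D)) \<longlongrightarrow> 0) (at t within S)"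
    by (intro Lim_transform_eventually [OF lim]) (simp add: eventually_at_filter)
  then show ?thesis
    by (simp add: tendsto_norm_zero_iff Lim_null [symmetric])
qed

text \<open>
  If \<open>m\<close> is \<open>1 + (s - t) A\<close> up to higher order, its inverse is \<open>1 - (s - t) A\<close>, and the difference
  \<open>m - (m\<^sup>-\<^sup>1)\<^sup>*\<close> is \<open>(s - t) (A + A\<^sup>*)\<close>.
\<close>

lemma infinitesimal_length:
  fixes g :: "real \<Rightarrow> complex^'n^'n"
  assumes der: "(g has_vector_derivative D) (at t within S)" and t: "t \<in> S"
    and cont: "continuous_on S g" and SL: "g ` S \<subseteq> SL"
  defines "A \<equiv> matrix_inv (g t) ** D"
  shows "((\<lambda>s. norm (matrix_inv (g t) ** g s - adj (matrix_inv (matrix_inv (g t) ** g s))) / \<bar>s - t\<bar>)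
     \<longlongrightarrow> norm (A + adj A)) (at t within S)"
proof -
  \<comment> \<open>The difference quotient of the inverse is minus \<open>m\<^sup>-\<^sup>1\<close> times that of \<open>m\<close>, so the continuity
    of the inverse suffices.\<close>
  define q where "q s = (1 / (s - t)) *\<^sub>R (matrix_inv (g t) ** g s - mat 1)" for s
  have gS: "g s \<in> SL" if "s \<in> S" for s
    using that SL by auto
  have "((\<lambda>s. (1 / (s - t)) *\<^sub>R (g s - g t)) \<longlongrightarrow> D) (at t within S)"
    using der by (rule has_vector_derivative_difference_quotient)
  have "((\<lambda>s. matrix_inv (g t) ** ((1 / (s - t)) *\<^sub>R (g s - g t))) \<longlongrightarrow> A) (at t within S)"
    unfolding A_def by (intro tendsto_matrix_mult tendsto_const) fact
  moreover have "matrix_inv (g t) ** ((1 / (s - t)) *\<^sub>R (g s - g t)) = q s" for s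
    by (simp add: q_def matrix_scaleR_right matrix_mult_diff_right SL_left_inverse gS t)
  ultimately have q: "(q \<longlongrightarrow> A) (at t within S)"
    by simp
  have "((\<lambda>s. matrix_inv (g s)) \<longlongrightarrow> matrix_inv (g t)) (at t within S)"
    using continuous_on_matrix_inv [OF cont SL] t by (simp add: continuous_on_def)
  then have "((\<lambda>s. matrix_inv (g s) ** g t) \<longlongrightarrow> matrix_inv (g t) ** g t) (at t within S)"
    by (intro tendsto_matrix_mult tendsto_const)
  then have "((\<lambda>s. (matrix_inv (g s) ** g t) ** q s) \<longlongrightarrow> mat 1 ** A) (at t within S)"
    by (intro tendsto_matrix_mult q) (simp add: SL_left_inverse gS t)
  then have "((\<lambda>s. q s + adj (matrix_inv (g s) ** g t ** q s)) \<longlongrightarrow> A + adj A) (at t within S)"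
    by (intro tendsto_add q bounded_linear.tendsto [OF bounded_linear_adj]) simp
  then have lim: "((\<lambda>s. norm (q s + adj (matrix_inv (g s) ** g t ** q s))) \<longlongrightarrow> norm (A + adj A)) (at t within S)"
    by (rule tendsto_norm)
  have "norm (q s + adj (matrix_inv (g s) ** g t ** q s))
    = norm (matrix_inv (g t) ** g s - adj (matrix_inv (matrix_inv (g t) ** g s))) / \<bar>s - t\<bar>"
    if s: "s \<in> S" for s
  proof -
    let ?m = "matrix_inv (g t) ** g s"
    have inv: "matrix_inv ?m = matrix_inv (g s) ** g t"
      using s t by (simp add: matrix_inv_mult gS SL_inv matrix_inv_inv)
    have "?m \<in> SL"
      using s t by (simp add: SL_mult SL_inv gS)
    then have "matrix_inv (g s) ** g t ** q s = (1 / (s - t)) *\<^sub>R (mat 1 - matrix_inv ?m)"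
      unfolding inv [symmetric] q_def
      by (simp add: matrix_scaleR_right matrix_mult_diff_right SL_left_inverse)
    moreover have "adj (c *\<^sub>R (mat 1 - N)) = c *\<^sub>R (mat 1 - adj N)" for c and N :: "complex^'n^'n"
      by (simp add: vec_eq_iff mat_def)
    ultimately have "q s + adj (matrix_inv (g s) ** g t ** q s) = (1 / (s - t)) *\<^sub>R (?m - adj (matrix_inv ?m))"
      by (simp add: q_def scaleR_right_diff_distrib)
    then show ?thesis
      by simp
  qed
  then show ?thesis
    by (intro Lim_transform_eventually [OF lim]) (simp add: eventually_at_filter)
qed

text \<open>
  A form of the fundamental theorem of calculus for maps that are controlled only through their
  local rate of increase. It is applied to \<open>herm_log\<close> along a curve, for which it replaces the
  derivative of the matrix logarithm. On a fine tagged division every increment is controlled at the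
  tag, and the sum of these bounds is close to the integral.
\<close>

lemma norm_increment_le_integral:
  fixes f :: "real \<Rightarrow> 'a::real_normed_vector"
  assumes "a \<le> b" and \<psi>: "(\<psi> has_integral I) {a..b}"
    and local: "\<And>t e. t \<in> {a..b} \<Longrightarrow> e > 0 \<Longrightarrow>
      \<exists>d>0. \<forall>s\<in>{a..b}. \<bar>s - t\<bar> < d \<longrightarrow> norm (f s - f t) \<le> (\<psi> t + e) * \<bar>s - t\<bar>"
  shows "norm (f b - f a) \<le> I"
proof (rule field_le_epsilon)
  fix e :: real
  assume e: "e > 0"
  define e' where "e' = e / (2 * (b - a + 1))"
  have e': "e' > 0" and e'2: "e' * (b - a) \<le> e / 2"
    using e \<open>a \<le> b\<close> by (simp_all add: e'_def divide_simps)
  obtain d where d: "\<And>t. d t > 0"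
    and fd: "\<And>t s. t \<in> {a..b} \<Longrightarrow> s \<in> {a..b} \<Longrightarrow> \<bar>s - t\<bar> < d t \<Longrightarrow> norm (f s - f t) \<le> (\<psi> t + e') * \<bar>s - t\<bar>"
  proof -
    have "\<exists>d>0. t \<in> {a..b} \<longrightarrow> (\<forall>s\<in>{a..b}. \<bar>s - t\<bar> < d \<longrightarrow> norm (f s - f t) \<le> (\<psi> t + e') * \<bar>s - t\<bar>)" for t
      using local [of t e'] e' by (cases "t \<in> {a..b}") (auto intro: exI [of _ 1])
    then show ?thesis using that by metis
  qed
  obtain \<gamma> where \<gamma>: "gauge \<gamma>"
    and \<gamma>I: "\<And>p. p tagged_division_of {a..b} \<Longrightarrow> \<gamma> fine p \<Longrightarrow>
       norm ((\<Sum>(x, K)\<in>p. measure lborel K *\<^sub>R \<psi> x) - I) < e / 2"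
    using \<psi> [unfolded has_integral_real] e by (metis half_gt_zero)
  have "gauge (\<lambda>t. \<gamma> t \<inter> ball t (d t))"
    by (intro gauge_Int \<gamma> gauge_ball_dependent) (auto simp: d)
  then obtain p where p: "p tagged_division_of {a..b}" and fine: "(\<lambda>t. \<gamma> t \<inter> ball t (d t)) fine p"
    using fine_division_exists_real by blast
  have fin: "finite p"
    using p by blast
  have "norm (f b - f a) = norm (\<Sum>(x, K)\<in>p. f (Sup K) - f (Inf K))"
    using additive_tagged_division_1 [OF \<open>a \<le> b\<close> p, of f] by simp
  also have "\<dots> \<le> (\<Sum>(x, K)\<in>p. (\<psi> x + e') * (Sup K - Inf K))"
  proof (rule sum_norm_le, safe)
    fix x K
    assume xK: "(x, K) \<in> p"
    obtain u v where K: "K = {u..v}" and xK': "x \<in> K" and Kab: "K \<subseteq> {a..b}"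
      using tagged_division_ofD(2-4) [OF p xK] by auto
    have "K \<subseteq> ball x (d x)"
      using fine xK unfolding fine_def by blast
    moreover have "u \<in> K" "v \<in> K"
      using xK' by (auto simp: K)
    ultimately have "u \<in> ball x (d x)" "v \<in> ball x (d x)"
      by auto
    then have uv: "u \<le> x" "x \<le> v" "\<bar>u - x\<bar> < d x" "\<bar>v - x\<bar> < d x" "u \<in> {a..b}" "v \<in> {a..b}" "x \<in> {a..b}"
      using xK' Kab unfolding K by (auto simp: dist_real_def)
    have "norm (f v - f u) \<le> norm (f v - f x) + norm (f u - f x)"
      using norm_triangle_ineq4 [of "f v - f x" "f u - f x"] by simp
    also have "\<dots> \<le> (\<psi> x + e') * (v - x) + (\<psi> x + e') * (x - u)"
      using fd [of x v] fd [of x u] uv by (intro add_mono) auto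
    finally show "norm (f (Sup K) - f (Inf K)) \<le> (\<psi> x + e') * (Sup K - Inf K)"
      using uv by (simp add: K algebra_simps)
  qed
  also have "\<dots> = (\<Sum>(x, K)\<in>p. measure lborel K *\<^sub>R \<psi> x) + (\<Sum>(x, K)\<in>p. e' * (Sup K - Inf K))"
  proof -
    have "(\<psi> x + e') * (Sup K - Inf K) = measure lborel K *\<^sub>R \<psi> x + e' * (Sup K - Inf K)"
      if xK: "(x, K) \<in> p" for x K
    proof -
      obtain u v where "K = {u..v}" "x \<in> K"
        using tagged_division_ofD(2,4) [OF p xK] by auto
      then show ?thesis by (simp add: algebra_simps)
    qed
    then show ?thesis
      by (simp add: sum.distrib [symmetric] split_def)
  qed
  also have "(\<Sum>(x, K)\<in>p. e' * (Sup K - Inf K)) = e' * (b - a)"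
    using additive_tagged_division_1 [OF \<open>a \<le> b\<close> p, of "\<lambda>x. x"]
    by (simp add: sum_distrib_left [symmetric] split_def)
  also have "(\<Sum>(x, K)\<in>p. measure lborel K *\<^sub>R \<psi> x) \<le> I + e / 2"
  proof -
    have "\<gamma> fine p"
      using fine by (auto simp: fine_def)
    then have "norm ((\<Sum>(x, K)\<in>p. measure lborel K *\<^sub>R \<psi> x) - I) < e / 2"
      by (rule \<gamma>I [OF p])
    then show ?thesis
      unfolding real_norm_def by linarith
  qed
  finally show "norm (f b - f a) \<le> I + e"
    using e'2 by linarith
qed

text \<open>
  The local rate of \<open>herm_log\<close> along \<open>g\<close> is at most the speed divided by \<open>2 \<surd>n\<close>, by
  \<open>herm_log_increment\<close> and \<open>infinitesimal_length\<close>.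
\<close>

lemma herm_log_le_curve_length:
  fixes g :: "real \<Rightarrow> complex^'n^'n"
  assumes C1: "g C1_differentiable_on {0..1}" and SL: "g ` {0..1} \<subseteq> SL"
  shows "2 * sqrt CARD('n) * norm (herm_log (g 1) - herm_log (g 0)) \<le> curve_length g"
proof -
  define A where "A t = matrix_inv (g t) ** vector_derivative g (at t)" for t
  have der: "(g has_vector_derivative vector_derivative g (at t)) (at t within {0..1})" if "t \<in> {0..1}" for t
    using C1 that unfolding C1_differentiable_on_eq
    by (auto simp: vector_derivative_works intro: has_vector_derivative_at_within)
  have cont: "continuous_on {0..1} g"
    using C1 C1_diff_imp_diff differentiable_imp_continuous_on by blast
  have "continuous_on {0..1} (\<lambda>t. vector_derivative g (at t))"
    using C1 by (simp add: C1_differentiable_on_eq)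
  then have "continuous_on {0..1} A"
    unfolding A_def by (intro continuous_on_matrix_mult continuous_on_matrix_inv cont SL)
  then have "continuous_on {0..1} (\<lambda>t. norm (herm_part (A t)))"
    unfolding herm_part_def
    by (intro continuous_intros bounded_linear.continuous_on [OF bounded_linear_adj])
  then have int: "((\<lambda>t. norm (herm_part (A t))) has_integral (integral {0..1} (\<lambda>t. norm (herm_part (A t))))) {0..1}"
    by (intro integrable_integral integrable_continuous_real)
  have "norm (herm_log (g 1) - herm_log (g 0)) \<le> integral {0..1} (\<lambda>t. norm (herm_part (A t)))"
  proof (rule norm_increment_le_integral [OF _ int])
    fix t e :: real
    assume t: "t \<in> {0..1}" and e: "e > 0"
    let ?m = "\<lambda>s. matrix_inv (g t) ** g s"
    let ?n = "\<lambda>s. norm (?m s - adj (matrix_inv (?m s)))"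
    have "((\<lambda>s. ?n s / \<bar>s - t\<bar>) \<longlongrightarrow> 2 * norm (herm_part (A t))) (at t within {0..1})"
      using infinitesimal_length [OF der [OF t] t cont SL] by (simp add: norm_herm_part A_def)
    then have "\<forall>\<^sub>F s in at t within {0..1}. dist (?n s / \<bar>s - t\<bar>) (2 * norm (herm_part (A t))) < 2 * e"
      using e by (intro tendstoD) auto
    then obtain d where d: "d > 0"
      and dn: "\<And>s. s \<in> {0..1} \<Longrightarrow> s \<noteq> t \<Longrightarrow> \<bar>s - t\<bar> < d \<Longrightarrow> \<bar>?n s / \<bar>s - t\<bar> - 2 * norm (herm_part (A t))\<bar> < 2 * e"
      unfolding eventually_at by (auto simp: dist_real_def)
    have "norm (herm_log (g s) - herm_log (g t)) \<le> (norm (herm_part (A t)) + e) * \<bar>s - t\<bar>"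
      if s: "s \<in> {0..1}" "\<bar>s - t\<bar> < d" for s
    proof (cases "s = t")
      case False
      have "2 * norm (herm_log (g s) - herm_log (g t)) \<le> ?n s"
        using herm_log_increment [of "g t" "g s"] s t SL
        by (auto simp: norm_minus_commute [of "herm_log (g s)"] image_subset_iff)
      also have "?n s \<le> 2 * ((norm (herm_part (A t)) + e) * \<bar>s - t\<bar>)"
      proof -
        have "?n s / \<bar>s - t\<bar> \<le> 2 * (norm (herm_part (A t)) + e)"
          using dn [OF s(1) False s(2)] by (auto simp: abs_if split: if_splits)
        then show ?thesis
          using False by (simp add: pos_divide_le_eq mult.assoc [symmetric])
      qed
      finally show ?thesis by simp
    qed simp
    then show "\<exists>d>0. \<forall>s\<in>{0..1}. \<bar>s - t\<bar> < d \<longrightarrow>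
        norm (herm_log (g s) - herm_log (g t)) \<le> (norm (herm_part (A t)) + e) * \<bar>s - t\<bar>"
      using d by blast
  qed simp
  then have "2 * sqrt CARD('n) * norm (herm_log (g 1) - herm_log (g 0))
    \<le> 2 * sqrt CARD('n) * integral {0..1} (\<lambda>t. norm (herm_part (A t)))"
    by (intro mult_left_mono) auto
  also have "\<dots> = curve_length g"
  proof -
    have "speed g = (\<lambda>t. 2 * sqrt CARD('n) * norm (herm_part (A t)))"
      by (simp add: fun_eq_iff speed_eq A_def)
    then show ?thesis
      by (simp add: curve_length_def)
  qed
  finally show ?thesis .
qed

text \<open>
  The matrix is written as a combination of the diagonal matrix units with scalar coefficients
  depending on \<open>t\<close>.
\<close>

lemma ediag_has_vector_derivative:
  fixes x :: "real^'n"
  shows "((\<lambda>t. ediag (t *\<^sub>R x)) has_vector_derivative ediag (t *\<^sub>R x) ** rdiag x) (at t)"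
proof -
  define E :: "'n \<Rightarrow> complex^'n^'n" where "E i = (\<chi> a b. if a = b \<and> a = i then 1 else 0)" for i
  have E: "(\<Sum>i\<in>UNIV. c i *\<^sub>R E i) = (\<chi> a b. if a = b then complex_of_real (c a) else 0)" for c :: "'n \<Rightarrow> real"
  proof -
    have "(\<Sum>i\<in>UNIV. c i *\<^sub>R E i) $ a $ b = (if a = b then complex_of_real (c a) else 0)" for a b
    proof -
      have "(\<Sum>i\<in>UNIV. c i *\<^sub>R E i) $ a $ b = (\<Sum>i\<in>UNIV. if a = i then (if a = b then complex_of_real (c a) else 0) else 0)"
        unfolding sum_component by (intro sum.cong refl) (auto simp: E_def scaleR_conv_of_real [where 'a = complex])
      then show ?thesis by simp
    qed
    then show ?thesis by (simp add: vec_eq_iff)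
  qed
  have "((\<lambda>t. \<Sum>i\<in>UNIV. exp (t * x $ i) *\<^sub>R E i) has_vector_derivative
      (\<Sum>i\<in>UNIV. (exp (t * x $ i) * x $ i) *\<^sub>R E i)) (at t)"
    by (intro has_vector_derivative_sum has_vector_derivative_scaleR [THEN has_vector_derivative_eq_rhs]
        has_vector_derivative_const) (auto intro!: derivative_eq_intros)
  moreover have "(\<Sum>i\<in>UNIV. (exp (t * x $ i) * x $ i) *\<^sub>R E i) = ediag (t *\<^sub>R x) ** rdiag x"
    by (simp add: E vec_eq_iff mult_rdiag_nth) (simp add: ediag_def)
  ultimately show ?thesis
    by (simp add: E ediag_def cong: if_cong)
qed

text \<open>
  The curve \<open>t \<mapsto> g e\<^sup>t\<^sup>x\<close> has the constant logarithmic derivative \<open>rdiag x\<close>, which is hermitian.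
\<close>

lemma exists_diagonal_curve:
  fixes g :: "complex^'n^'n"
  assumes g: "g \<in> SL" and x: "x \<in> zero_sum"
  shows "\<exists>c. c C1_differentiable_on {0..1} \<and> c ` {0..1} \<subseteq> SL \<and> coset (c 0) = coset g \<and>
    coset (c 1) = coset (g ** ediag x) \<and> curve_length c = 2 * sqrt CARD('n) * norm x"
proof -
  define c where "c t = g ** ediag (t *\<^sub>R x)" for t
  have der: "(c has_vector_derivative g ** (ediag (t *\<^sub>R x) ** rdiag x)) (at t)" for t
    unfolding c_def
    by (intro bounded_linear.has_vector_derivative [OF bounded_bilinear.bounded_linear_right
          [OF bounded_bilinear_matrix_mult]] ediag_has_vector_derivative)
  have SL: "c t \<in> SL" for t
    unfolding c_def by (intro SL_mult g ediag_SL zero_sum_scaleR x)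
  have "continuous_on {0..1} (\<lambda>t. ediag (t *\<^sub>R x))"
    by (intro continuous_at_imp_continuous_on ballI)
       (metis ediag_has_vector_derivative has_vector_derivative_continuous)
  then have "c C1_differentiable_on {0..1}"
    unfolding C1_differentiable_on_def using der
    by (intro exI [of _ "\<lambda>t. g ** (ediag (t *\<^sub>R x) ** rdiag x)"])
       (auto intro!: continuous_on_matrix_mult continuous_on_const)
  moreover have "speed c t = 2 * sqrt CARD('n) * norm x" for t
  proof -
    have "vector_derivative c (at t) = c t ** rdiag x"
      using vector_derivative_at [OF der] by (simp add: c_def matrix_mul_assoc)
    then have "matrix_inv (c t) ** vector_derivative c (at t) = rdiag x"
      by (simp add: SL_cancel_left SL)
    moreover have "herm_part (rdiag x) = rdiag x"
      by (simp add: herm_part_def scaleR_2 [symmetric])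
    ultimately show ?thesis
      by (simp add: speed_eq norm_rdiag)
  qed
  then have "speed c = (\<lambda>t. 2 * sqrt CARD('n) * norm x)"
    by blast
  then have "curve_length c = 2 * sqrt CARD('n) * norm x"
    by (simp add: curve_length_def)
  ultimately show ?thesis
    using SL by (intro exI [of _ c]) (auto simp: c_def)
qed

text \<open>
  Seen from any point, every other point lies in a diagonal direction after a rotation about the
  first point.
\<close>

lemma polar_position:
  assumes g: "g \<in> SL" and h: "h \<in> SL"
  obtains U x where "U \<in> SU" "x \<in> zero_sum" "coset h = coset (g ** U ** ediag x)"
proof -
  obtain U x V where U: "U \<in> SU" "x \<in> zero_sum" "V \<in> SU" "matrix_inv g ** h = U ** ediag x ** V"
    using SL_singular_value_decomposition [of "matrix_inv g ** h"] g h by (metis SL_inv SL_mult)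
  have "h = (g ** U ** ediag x) ** V"
    using g U(4) by (metis SL_cancel_left' matrix_mul_assoc)
  then have "coset h = coset (g ** U ** ediag x)"
    using U g by (simp add: coset_mult_SU SL_mult SU_SL ediag_SL)
  then show thesis
    using that U by blast
qed

lemma dist_Z_lower:
  fixes g h :: "complex^'n^'n"
  assumes g: "g \<in> SL" and h: "h \<in> SL"
  shows "2 * sqrt CARD('n) * norm (herm_log g - herm_log h) \<le> dist_Z (coset g) (coset h)"
  unfolding dist_Z_def
proof (rule cInf_greatest)
  obtain U x where U: "U \<in> SU" "x \<in> zero_sum" "coset h = coset (g ** U ** ediag x)"
    using polar_position [OF g h] .
  have "g ** U \<in> SL" "coset (g ** U) = coset g"
    using g U by (simp_all add: SL_mult SU_SL coset_mult_SU)
  then show "{curve_length c | c. c C1_differentiable_on {0..1} \<and> c ` {0..1} \<subseteq> SL \<and>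
      coset (c 0) = coset g \<and> coset (c 1) = coset h} \<noteq> {}"
    using exists_diagonal_curve [of "g ** U" x] U by auto
next
  fix r
  assume "r \<in> {curve_length c | c. c C1_differentiable_on {0..1} \<and> c ` {0..1} \<subseteq> SL \<and>
      coset (c 0) = coset g \<and> coset (c 1) = coset h}"
  then obtain c where c: "c C1_differentiable_on {0..1}" "c ` {0..1} \<subseteq> SL"
    "coset (c 0) = coset g" "coset (c 1) = coset h" "r = curve_length c"
    by blast
  have "herm_log (c 0) = herm_log g" "herm_log (c 1) = herm_log h"
    using c g h by (auto intro!: herm_log_coset)
  then show "2 * sqrt CARD('n) * norm (herm_log g - herm_log h) \<le> r"
    using herm_log_le_curve_length [OF c(1,2)] c(5) by (simp add: norm_minus_commute)
qed

lemma dist_Z_diagonal_le: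
  fixes g :: "complex^'n^'n"
  assumes "g \<in> SL" "x \<in> zero_sum"
  shows "dist_Z (coset g) (coset (g ** ediag x)) \<le> 2 * sqrt CARD('n) * norm x"
proof -
  obtain c where c: "c C1_differentiable_on {0..1}" "c ` {0..1} \<subseteq> SL" "coset (c 0) = coset g"
    "coset (c 1) = coset (g ** ediag x)" "curve_length c = 2 * sqrt CARD('n) * norm x"
    using exists_diagonal_curve [OF assms] by blast
  have "0 \<le> curve_length c" if "c C1_differentiable_on {0..1}" "c ` {0..1} \<subseteq> SL"
    for c :: "real \<Rightarrow> complex^'n^'n"
  proof -
    have "0 \<le> 2 * sqrt CARD('n) * norm (herm_log (c 1) - herm_log (c 0))"
      by simp
    also have "\<dots> \<le> curve_length c"
      by (rule herm_log_le_curve_length [OF that])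
    finally show ?thesis .
  qed
  then have "bdd_below {curve_length c | c :: real \<Rightarrow> complex^'n^'n. c C1_differentiable_on {0..1} \<and> c ` {0..1} \<subseteq> SL \<and>
      coset (c 0) = coset g \<and> coset (c 1) = coset (g ** ediag x)}"
    unfolding bdd_below_def by blast
  then show ?thesis
    unfolding dist_Z_def
  proof (rule cInf_lower2 [rotated 2])
    show "curve_length c \<in> {curve_length c | c. c C1_differentiable_on {0..1} \<and> c ` {0..1} \<subseteq> SL \<and>
      coset (c 0) = coset g \<and> coset (c 1) = coset (g ** ediag x)}"
      using c by blast
  qed (simp add: c)
qed

section \<open>Geodesics\<close>

lemma translated_curve:
  fixes c :: "real \<Rightarrow> complex^'n^'n"
  assumes s: "s \<in> SL" and C1: "c C1_differentiable_on {0..1}" and c: "c ` {0..1} \<subseteq> SL"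
  shows "(\<lambda>t. s ** c t) C1_differentiable_on {0..1}" (is ?C1)
    and "curve_length (\<lambda>t. s ** c t) = curve_length c" (is ?len)
proof -
  obtain D where D: "\<And>t. t \<in> {0..1} \<Longrightarrow> (c has_vector_derivative D t) (at t)"
    and cont: "continuous_on {0..1} D"
    using C1 unfolding C1_differentiable_on_def by blast
  have der: "((\<lambda>t. s ** c t) has_vector_derivative s ** D t) (at t)" if "t \<in> {0..1}" for t
    by (rule bounded_linear.has_vector_derivative [OF bounded_bilinear.bounded_linear_right
          [OF bounded_bilinear_matrix_mult] D [OF that]])
  show ?C1
    unfolding C1_differentiable_on_def using der cont
    by (intro exI [of _ "\<lambda>t. s ** D t"]) (auto intro!: continuous_on_matrix_mult continuous_on_const)
  have "speed (\<lambda>t. s ** c t) t = speed c t" if t: "t \<in> {0..1}" for t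
  proof -
    have "c t \<in> SL" using c t by blast
    then have "matrix_inv (s ** c t) ** (s ** D t) = matrix_inv (c t) ** (matrix_inv s ** (s ** D t))"
      by (simp only: matrix_inv_mult [OF s] matrix_mul_assoc)
    then show ?thesis
      by (simp only: speed_eq vector_derivative_at [OF der [OF t]] vector_derivative_at [OF D [OF t]]
          SL_cancel_left [OF s])
  qed
  then show ?len
    unfolding curve_length_def by (intro integral_cong) auto
qed

lemma dist_Z_translate:
  fixes s g h :: "complex^'n^'n"
  assumes s: "s \<in> SL"
  shows "dist_Z (coset (s ** g)) (coset (s ** h)) = dist_Z (coset g) (coset h)"
proof -
  define L where "L p q = {curve_length c | c. c C1_differentiable_on {0..1} \<and> c ` {0..1} \<subseteq> SL \<and>
      coset (c 0) = p \<and> coset (c 1) = q}" for p q :: "(complex^'n^'n) set"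
  have sub: "L (coset g) (coset h) \<subseteq> L (coset (s ** g)) (coset (s ** h))"
    if s: "s \<in> SL" for s g h :: "complex^'n^'n"
  proof
    fix r assume "r \<in> L (coset g) (coset h)"
    then obtain c where c: "c C1_differentiable_on {0..1}" "c ` {0..1} \<subseteq> SL"
      "coset (c 0) = coset g" "coset (c 1) = coset h" "r = curve_length c"
      unfolding L_def by blast
    have "(\<lambda>t. s ** c t) ` {0..1} \<subseteq> SL"
      using c(2) s by (auto intro: SL_mult)
    moreover have "coset (s ** c 0) = coset (s ** g)" "coset (s ** c 1) = coset (s ** h)"
      by (simp_all only: translate_coset [symmetric] c)
    ultimately show "r \<in> L (coset (s ** g)) (coset (s ** h))"
      unfolding L_def using translated_curve [OF s c(1,2)] c(5)
      by (intro CollectI exI [of _ "\<lambda>t. s ** c t"]) auto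
  qed
  have "L (coset (s ** g)) (coset (s ** h)) = L (coset g) (coset h)"
    using sub [OF s, of g h] sub [OF SL_inv [OF s], of "s ** g" "s ** h"]
    by (simp add: SL_cancel_left s)
  then show ?thesis
    unfolding dist_Z_def L_def by simp
qed

text \<open>
  The comparison of \<open>dist_Z_lower\<close> with \<open>coset g\<close> instead of the base point as the origin.
\<close>

lemma dist_Z_flat_lower:
  fixes g U :: "complex^'n^'n"
  assumes g: "g \<in> SL" and U: "U \<in> SU" and x: "x \<in> zero_sum" and y: "y \<in> zero_sum"
  shows "2 * sqrt CARD('n) * norm (rdiag x - U ** rdiag y ** adj U)
      \<le> dist_Z (coset (g ** ediag x)) (coset (g ** U ** ediag y))" (is ?A)
    and "2 * sqrt CARD('n) * norm (rdiag x - U ** rdiag y ** adj U)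
      \<le> dist_Z (coset (g ** U ** ediag y)) (coset (g ** ediag x))" (is ?B)
proof -
  have SL: "ediag x \<in> SL" "U ** ediag y \<in> SL"
    by (simp_all add: SL_mult SU_SL U ediag_SL x y)
  have log: "herm_log (ediag x) = rdiag x" "herm_log (U ** ediag y) = U ** rdiag y ** adj U"
    using herm_log_eq [OF SU_one x SU_one] herm_log_eq [OF U y SU_one] by simp_all
  have "dist_Z (coset (g ** ediag x)) (coset (g ** U ** ediag y)) = dist_Z (coset (ediag x)) (coset (U ** ediag y))"
    "dist_Z (coset (g ** U ** ediag y)) (coset (g ** ediag x)) = dist_Z (coset (U ** ediag y)) (coset (ediag x))"
    by (simp_all only: matrix_mul_assoc [symmetric] dist_Z_translate [OF g])
  then show ?A ?B
    using dist_Z_lower [OF SL] dist_Z_lower [OF SL(2,1)]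
    by (simp_all add: log norm_minus_commute [of "U ** rdiag y ** adj U"])
qed

lemma dist_Z_diagonal:
  fixes g :: "complex^'n^'n"
  assumes g: "g \<in> SL" and x: "x \<in> zero_sum"
  shows "dist_Z (coset g) (coset (g ** ediag x)) = 2 * sqrt CARD('n) * norm x"
proof (rule antisym)
  show "dist_Z (coset g) (coset (g ** ediag x)) \<le> 2 * sqrt CARD('n) * norm x"
    by (rule dist_Z_diagonal_le [OF g x])
  have "rdiag 0 = (0 :: complex^'n^'n)"
    by (simp add: rdiag_def vec_eq_iff)
  then show "2 * sqrt CARD('n) * norm x \<le> dist_Z (coset g) (coset (g ** ediag x))"
    using dist_Z_flat_lower(1) [OF g SU_one _ x, of 0]
    by (simp add: norm_rdiag) (simp add: zero_sum_def)
qed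

definition flow :: "complex^'n^'n \<Rightarrow> real^'n \<Rightarrow> real \<Rightarrow> (complex^'n^'n) set" where
  "flow g x t = coset (g ** ediag (t *\<^sub>R x))"

lemma flow_shift: "flow (g ** ediag (s *\<^sub>R x)) x t = flow g x (s + t)"
  by (simp add: flow_def matrix_mul_assoc [symmetric] ediag_add [symmetric] scaleR_add_left)

lemma flow_in_Z: "g \<in> SL \<Longrightarrow> x \<in> zero_sum \<Longrightarrow> flow g x t \<in> Z"
  by (simp add: flow_def Z_def SL_mult ediag_SL zero_sum_scaleR)

lemma dist_Z_flow:
  fixes g :: "complex^'n^'n"
  assumes g: "g \<in> SL" and x: "x \<in> zero_sum"
  shows "dist_Z (flow g x s) (flow g x t) = 2 * sqrt CARD('n) * norm x * \<bar>s - t\<bar>"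
proof -
  have "flow g x t = coset ((g ** ediag (s *\<^sub>R x)) ** ediag ((t - s) *\<^sub>R x))"
    using flow_shift [of g s x "t - s"] by (simp add: flow_def)
  then have "dist_Z (flow g x s) (flow g x t) = 2 * sqrt CARD('n) * norm ((t - s) *\<^sub>R x)"
    using dist_Z_diagonal [of "g ** ediag (s *\<^sub>R x)" "(t - s) *\<^sub>R x"] g x
    by (simp add: flow_def SL_mult ediag_SL zero_sum_scaleR)
  then show ?thesis
    by (simp add: abs_minus_commute)
qed

lemma geodesic_on_cong:
  "(\<And>t. t \<in> I \<Longrightarrow> \<gamma> t = \<delta> t) \<Longrightarrow> geodesic_on I c \<gamma> \<longleftrightarrow> geodesic_on I c \<delta>"
  unfolding geodesic_on_def by (simp add: image_subset_iff Ball_def)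

lemma geodesic_on_subset:
  assumes "geodesic_on I c \<gamma>" "J \<subseteq> I"
  shows "geodesic_on J c \<gamma>"
  unfolding geodesic_on_def
proof (intro conjI ballI)
  show "\<gamma> ` J \<subseteq> Z"
    using assms unfolding geodesic_on_def by blast
  fix t assume "t \<in> J"
  then obtain e where "e > 0" "\<forall>r\<in>I \<inter> ball t e. \<forall>s\<in>I \<inter> ball t e. dist_Z (\<gamma> r) (\<gamma> s) = c * \<bar>r - s\<bar>"
    using assms unfolding geodesic_on_def by blast
  then show "\<exists>e>0. \<forall>r\<in>J \<inter> ball t e. \<forall>s\<in>J \<inter> ball t e. dist_Z (\<gamma> r) (\<gamma> s) = c * \<bar>r - s\<bar>"
    using assms(2) by (intro exI [of _ e]) blast
qed

lemma geodesic_on_flow: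
  fixes g :: "complex^'n^'n"
  assumes "g \<in> SL" "x \<in> zero_sum"
  shows "geodesic_on I (2 * sqrt CARD('n) * norm x) (flow g x)"
  unfolding geodesic_on_def using assms
  by (auto simp: flow_in_Z dist_Z_flow intro: exI [of _ "1::real"])

text \<open>
  In Euclidean space a point is determined by its distances to the ends of a segment on which it
  lies. The identity behind it is
  \<open>(1 - s) \<bar>z + s x\<bar>\<^sup>2 + s \<bar>z - (1 - s) x\<bar>\<^sup>2 = \<bar>z\<bar>\<^sup>2 + s (1 - s) \<bar>x\<bar>\<^sup>2\<close>.
\<close>

lemma between_imp_zero:
  fixes x z :: "'a::real_inner"
  assumes s: "0 \<le> s" "s \<le> 1"
    and 1: "norm (z + s *\<^sub>R x) \<le> s * norm x" and 2: "norm (z - (1 - s) *\<^sub>R x) \<le> (1 - s) * norm x"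
  shows "z = 0"
proof -
  have sq: "(norm (z + c *\<^sub>R x))\<^sup>2 = z \<bullet> z + 2 * c * (z \<bullet> x) + (c * norm x)\<^sup>2" for c
    unfolding power_mult_distrib power2_norm_eq_inner
    by (simp add: inner_add_left inner_add_right inner_commute [of x z] power2_eq_square algebra_simps)
  have "(norm (z + s *\<^sub>R x))\<^sup>2 \<le> (s * norm x)\<^sup>2"
    using 1 by (intro power_mono) auto
  then have a: "z \<bullet> z + 2 * s * (z \<bullet> x) \<le> 0"
    by (simp add: sq)
  have "(norm (z + (- (1 - s)) *\<^sub>R x))\<^sup>2 \<le> ((- (1 - s)) * norm x)\<^sup>2"
    unfolding mult_minus_left power2_minus scaleR_minus_left diff_conv_add_uminus [symmetric]
    using 2 by (rule power_mono) simp
  then have b: "z \<bullet> z - 2 * (1 - s) * (z \<bullet> x) \<le> 0"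
    unfolding sq by (simp add: algebra_simps)
  have "z \<bullet> z = (1 - s) * (z \<bullet> z + 2 * s * (z \<bullet> x)) + s * (z \<bullet> z - 2 * (1 - s) * (z \<bullet> x))"
    by (simp add: algebra_simps)
  also have "\<dots> \<le> 0"
    using mult_nonneg_nonpos [OF _ a, of "1 - s"] mult_nonneg_nonpos [OF _ b, of s] s by linarith
  finally show ?thesis
    using inner_ge_zero [of z] inner_eq_zero_iff [of z] by linarith
qed

text \<open>
  Take the expected point \<open>a = g e\<^sup>s\<^sup>x\<close> as the origin. The ends of the segment then have the
  logarithms \<open>- s x\<close> and \<open>(1 - s) x\<close>, and the logarithm \<open>Y\<close> of \<open>h\<close> has at most the given
  distances to them. This forces \<open>Y = 0\<close> by \<open>between_imp_zero\<close>.
\<close>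

lemma point_between:
  fixes g h :: "complex^'n^'n"
  assumes g: "g \<in> SL" and h: "h \<in> SL" and x: "x \<in> zero_sum" and s: "0 \<le> s" "s \<le> 1"
    and 1: "dist_Z (coset g) (coset h) = s * dist_Z (coset g) (coset (g ** ediag x))"
    and 2: "dist_Z (coset h) (coset (g ** ediag x)) = (1 - s) * dist_Z (coset g) (coset (g ** ediag x))"
  shows "coset h = coset (g ** ediag (s *\<^sub>R x))"
proof -
  define a where "a = g ** ediag (s *\<^sub>R x)"
  have a: "a \<in> SL"
    unfolding a_def using g x by (simp add: SL_mult ediag_SL zero_sum_scaleR)
  have ga: "a ** ediag ((- s) *\<^sub>R x) = g" "a ** ediag ((1 - s) *\<^sub>R x) = g ** ediag x"
    by (simp_all add: a_def matrix_mul_assoc [symmetric] ediag_add [symmetric] scaleR_add_left [symmetric])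
  obtain U z where U: "U \<in> SU" and z: "z \<in> zero_sum" and hU: "coset h = coset (a ** U ** ediag z)"
    using polar_position [OF a h] .
  define Y where "Y = U ** rdiag z ** adj U"
  have C: "2 * sqrt CARD('n) > 0" by simp
  have rs: "rdiag (r *\<^sub>R x) = r *\<^sub>R rdiag x" for r
    by (simp add: vec_eq_iff rdiag_def scaleR_conv_of_real [where 'a = complex])
  have "2 * sqrt CARD('n) * norm (rdiag ((- s) *\<^sub>R x) - Y) \<le> 2 * sqrt CARD('n) * (s * norm (rdiag x))"
    using dist_Z_flat_lower(1) [OF a U zero_sum_scaleR [OF x] z, of "- s"] 1
    unfolding Y_def ga hU [symmetric] norm_rdiag by (simp add: dist_Z_diagonal [OF g x])
  then have "norm (rdiag ((- s) *\<^sub>R x) - Y) \<le> s * norm (rdiag x)"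
    using C by (simp only: mult_le_cancel_left_pos)
  then have A: "norm (Y + s *\<^sub>R rdiag x) \<le> s * norm (rdiag x)"
  proof -
    have "rdiag ((- s) *\<^sub>R x) - Y = - (Y + s *\<^sub>R rdiag x)"
      unfolding rs by simp
    then show ?thesis
      using \<open>norm (rdiag ((- s) *\<^sub>R x) - Y) \<le> s * norm (rdiag x)\<close> by (simp only: norm_minus_cancel)
  qed
  have "2 * sqrt CARD('n) * norm (rdiag ((1 - s) *\<^sub>R x) - Y) \<le> 2 * sqrt CARD('n) * ((1 - s) * norm (rdiag x))"
    using dist_Z_flat_lower(2) [OF a U zero_sum_scaleR [OF x] z, of "1 - s"] 2
    unfolding Y_def ga hU [symmetric] norm_rdiag by (simp add: dist_Z_diagonal [OF g x])
  then have "norm (rdiag ((1 - s) *\<^sub>R x) - Y) \<le> (1 - s) * norm (rdiag x)"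
    using C by (simp only: mult_le_cancel_left_pos)
  then have B: "norm (Y - (1 - s) *\<^sub>R rdiag x) \<le> (1 - s) * norm (rdiag x)"
    by (simp add: norm_minus_commute rs)
  have "Y = 0"
    by (rule between_imp_zero [OF s A B])
  moreover have "norm Y = norm z"
    using U unfolding Y_def
    by (simp add: norm_mult_unitary_right norm_mult_unitary_left SU_left SU_right norm_rdiag)
  ultimately have "z = 0" by simp
  then show ?thesis
    using hU a U by (simp add: coset_mult_SU a_def)
qed

text \<open>
  Move the first common point to parameter 0. There the two lifts differ by some \<open>k \<in> SU\<close>, and the
  equality of logarithms at the second common point says that \<open>k\<close> conjugates \<open>rdiag y\<close> into
  \<open>rdiag x\<close>. Then \<open>k\<close> also intertwines the exponentials at all times.
\<close>

lemma flow_determined_by_two_points: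
  fixes g h :: "complex^'n^'n"
  assumes g: "g \<in> SL" and h: "h \<in> SL" and x: "x \<in> zero_sum" and y: "y \<in> zero_sum"
    and "s \<noteq> t" and 1: "flow g x s = flow h y s" and 2: "flow g x t = flow h y t"
  shows "flow g x = flow h y"
proof -
  define g' h' k d where "g' = g ** ediag (s *\<^sub>R x)" and "h' = h ** ediag (s *\<^sub>R y)"
    and "k = matrix_inv g' ** h'" and "d = t - s"
  have SL: "g' \<in> SL" "h' \<in> SL"
    using g h x y by (simp_all add: g'_def h'_def SL_mult ediag_SL zero_sum_scaleR)
  have k: "k \<in> SU"
    using 1 coset_eq_iff [OF SL] by (simp add: flow_def g'_def h'_def k_def)
  have hk: "h' = g' ** k"
    by (simp add: k_def SL_cancel_left' SL)
  have dx: "d *\<^sub>R x \<in> zero_sum" "d *\<^sub>R y \<in> zero_sum"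
    using x y by (simp_all add: zero_sum_scaleR)
  have "coset (g' ** ediag (d *\<^sub>R x)) = coset (g' ** (k ** ediag (d *\<^sub>R y)))"
    using 2 flow_shift [of g s x d] flow_shift [of h s y d]
    by (simp add: d_def flow_def g'_def [symmetric] h'_def [symmetric] hk matrix_mul_assoc)
  then have "translate (matrix_inv g') (coset (g' ** ediag (d *\<^sub>R x)))
    = translate (matrix_inv g') (coset (g' ** (k ** ediag (d *\<^sub>R y))))"
    by simp
  then have "coset (ediag (d *\<^sub>R x)) = coset (k ** ediag (d *\<^sub>R y))"
    by (simp only: translate_coset SL_cancel_left [OF SL(1)])
  then have "herm_log (ediag (d *\<^sub>R x)) = herm_log (k ** ediag (d *\<^sub>R y))"
    using k dx by (intro herm_log_coset) (auto simp: SL_mult SU_SL ediag_SL)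
  then have "rdiag (d *\<^sub>R x) = k ** rdiag (d *\<^sub>R y) ** adj k"
    using herm_log_eq [OF SU_one dx(1) SU_one] herm_log_eq [OF k dx(2) SU_one] by simp
  then have "rdiag (d *\<^sub>R x) ** k = k ** rdiag (d *\<^sub>R y) ** (adj k ** k)"
    by (simp add: matrix_mul_assoc)
  then have comm: "rdiag (d *\<^sub>R x) ** k = k ** rdiag (d *\<^sub>R y)"
    by (simp add: SU_left k)
  have eq: "x $ i = y $ j" if "k $ i $ j \<noteq> 0" for i j
  proof -
    have "complex_of_real (d * x $ i) * k $ i $ j = k $ i $ j * complex_of_real (d * y $ j)"
      using arg_cong [OF comm, of "\<lambda>M. M $ i $ j"] by (simp add: rdiag_mult_nth mult_rdiag_nth)
    then have "complex_of_real (d * x $ i) = complex_of_real (d * y $ j)"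
      using that by (simp only: mult.commute [of _ "k $ i $ j"] mult_cancel_left) simp
    then show ?thesis
      using \<open>s \<noteq> t\<close> by (simp only: of_real_eq_iff) (simp add: d_def)
  qed
  have "ediag (r *\<^sub>R x) ** k = k ** ediag (r *\<^sub>R y)" for r
  proof -
    have "(ediag (r *\<^sub>R x) ** k) $ i $ j = (k ** ediag (r *\<^sub>R y)) $ i $ j" for i j
      using eq [of i j] by (cases "k $ i $ j = 0") (simp_all add: ediag_mult_nth mult_ediag_nth)
    then show ?thesis by (simp add: vec_eq_iff)
  qed
  then have "h' ** ediag (r *\<^sub>R y) = g' ** ediag (r *\<^sub>R x) ** k" for r
    by (metis hk matrix_mul_assoc)
  then have "flow h' y r = flow g' x r" for r
    unfolding flow_def using SL k x by (simp add: coset_mult_SU SL_mult ediag_SL zero_sum_scaleR)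
  then have "flow h y (s + r) = flow g x (s + r)" for r
    by (simp add: g'_def h'_def flow_shift)
  from this [of "r - s" for r] show ?thesis
    by (simp add: fun_eq_iff)
qed

definition is_flow :: "(real \<Rightarrow> (complex^'n^'n) set) \<Rightarrow> bool" where
  "is_flow l \<longleftrightarrow> (\<exists>g x. g \<in> SL \<and> x \<in> zero_sum \<and> l = flow g x)"

lemma is_flow_eqI:
  assumes "is_flow l" "is_flow m" "s \<noteq> t" "l s = m s" "l t = m t"
  shows "l = m"
proof -
  obtain g x where l: "g \<in> SL" "x \<in> zero_sum" "l = flow g x"
    using assms(1) unfolding is_flow_def by blast
  obtain h y where m: "h \<in> SL" "y \<in> zero_sum" "m = flow h y"
    using assms(2) unfolding is_flow_def by blast
  show ?thesis
    using flow_determined_by_two_points [OF l(1) m(1) l(2) m(2) assms(3)] assms(4,5)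
    by (simp add: l(3) m(3))
qed

lemma minimizing_segment_is_flow:
  fixes \<gamma> :: "real \<Rightarrow> (complex^'n^'n) set"
  assumes "a < b" and Z: "\<gamma> ` {a..b} \<subseteq> Z"
    and d: "\<And>r s. r \<in> {a..b} \<Longrightarrow> s \<in> {a..b} \<Longrightarrow> dist_Z (\<gamma> r) (\<gamma> s) = c * \<bar>r - s\<bar>"
  shows "\<exists>l. is_flow l \<and> (\<forall>t\<in>{a..b}. \<gamma> t = l t)"
proof -
  have "\<gamma> a \<in> Z" "\<gamma> b \<in> Z"
    using Z \<open>a < b\<close> by auto
  then obtain g h where g: "g \<in> SL" "\<gamma> a = coset g" and h: "h \<in> SL" "\<gamma> b = coset h"
    unfolding Z_def by blast
  obtain U w where U: "U \<in> SU" and w: "w \<in> zero_sum" and hU: "coset h = coset (g ** U ** ediag w)"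
    using polar_position [OF g(1) h(1)] .
  define g' where "g' = g ** U"
  have g': "g' \<in> SL" "\<gamma> a = coset g'" "\<gamma> b = coset (g' ** ediag w)"
    using g U h hU by (simp_all add: g'_def SL_mult SU_SL coset_mult_SU)
  define x where "x = (1 / (b - a)) *\<^sub>R w"
  have x: "x \<in> zero_sum"
    by (simp add: x_def zero_sum_scaleR w)
  define g0 where "g0 = g' ** ediag ((- a) *\<^sub>R x)"
  have g0: "g0 \<in> SL"
    by (simp add: g0_def SL_mult g' ediag_SL zero_sum_minus zero_sum_scaleR x)
  have "\<gamma> t = flow g0 x t" if t: "t \<in> {a..b}" for t
  proof -
    have "\<gamma> t \<in> Z" using Z t by blast
    then obtain m where m: "m \<in> SL" "\<gamma> t = coset m"
      unfolding Z_def by blast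
    have D: "dist_Z (coset g') (coset (g' ** ediag w)) = c * (b - a)"
      using d [of a b] \<open>a < b\<close> unfolding g'(2,3) [symmetric] by simp
    have "coset m = coset (g' ** ediag (((t - a) / (b - a)) *\<^sub>R w))"
    proof (rule point_between [OF g'(1) m(1) w])
      show "0 \<le> (t - a) / (b - a)" "(t - a) / (b - a) \<le> 1"
        using t \<open>a < b\<close> by (auto simp: divide_simps)
      show "dist_Z (coset g') (coset m) = (t - a) / (b - a) * dist_Z (coset g') (coset (g' ** ediag w))"
        unfolding D unfolding g'(2) [symmetric] m(2) [symmetric] using d [of a t] t \<open>a < b\<close> by simp
      have "1 - (t - a) / (b - a) = (b - t) / (b - a)"
        using \<open>a < b\<close> by (simp add: divide_simps)
      then show "dist_Z (coset m) (coset (g' ** ediag w)) = (1 - (t - a) / (b - a)) * dist_Z (coset g') (coset (g' ** ediag w))"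
        unfolding D unfolding g'(3) [symmetric] m(2) [symmetric] using d [of t b] t \<open>a < b\<close> by simp
    qed
    moreover have "((t - a) / (b - a)) *\<^sub>R w = (t - a) *\<^sub>R x"
      by (simp add: x_def)
    ultimately show ?thesis
      using flow_shift [of g' "- a" x t] by (simp add: m(2) flow_def g0_def)
  qed
  then show ?thesis
    unfolding is_flow_def using g0 x by blast
qed

text \<open>
  Near every parameter \<open>t\<close> the geodesic minimises and so is part of a flow \<open>L t\<close>. Neighbouring
  parameters have a whole interval in common and hence the same flow, so \<open>L\<close> is locally constant on
  the connected set \<open>{a..}\<close>.
\<close>

lemma geodesic_on_halfline_is_flow:
  fixes \<gamma> :: "real \<Rightarrow> (complex^'n^'n) set"
  assumes geo: "geodesic_on {a..} c \<gamma>"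
  shows "\<exists>l. is_flow l \<and> (\<forall>t\<ge>a. \<gamma> t = l t)"
proof -
  let ?P = "\<lambda>t l. is_flow l \<and> (\<exists>d>0. \<forall>s\<in>{a..}. \<bar>s - t\<bar> < d \<longrightarrow> \<gamma> s = l s)"
  have ex: "\<exists>l. ?P t l" if t: "t \<in> {a..}" for t
  proof -
    obtain e where e: "e > 0"
      and d: "\<And>r s. r \<in> {a..} \<inter> ball t e \<Longrightarrow> s \<in> {a..} \<inter> ball t e \<Longrightarrow> dist_Z (\<gamma> r) (\<gamma> s) = c * \<bar>r - s\<bar>"
      using geo t unfolding geodesic_on_def by meson
    define b where "b = max a (t - e/2)"
    have sub: "{b..t + e/2} \<subseteq> {a..} \<inter> ball t e"
      using e by (auto simp: b_def dist_real_def)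
    have "b < t + e/2"
      using e t by (auto simp: b_def)
    moreover have "\<gamma> ` {b..t + e/2} \<subseteq> Z"
      using sub geo unfolding geodesic_on_def by blast
    ultimately obtain l where l: "is_flow l" "\<forall>s\<in>{b..t + e/2}. \<gamma> s = l s"
      using minimizing_segment_is_flow [of b "t + e/2" \<gamma> c] d sub by blast
    have "s \<in> {b..t + e/2}" if "a \<le> s" "\<bar>s - t\<bar> < e/2" for s
      using that by (auto simp: b_def abs_if split: if_splits)
    then have "\<forall>s\<in>{a..}. \<bar>s - t\<bar> < e/2 \<longrightarrow> \<gamma> s = l s"
      using l(2) by simp
    then show ?thesis
      using l(1) e by (intro exI [of _ l]) (auto intro: exI [of _ "e/2"])
  qed
  define L where "L t = (SOME l. ?P t l)" for t
  have L: "?P t (L t)" if "t \<in> {a..}" for t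
    unfolding L_def by (rule someI_ex [OF ex [OF that]])
  have "L a = L t" if "t \<in> {a..}" for t
  proof (rule connected_equivalence_relation [of "{a..}" a t "\<lambda>s t. L s = L t"])
    fix t assume t: "t \<in> {a..}"
    obtain d where d: "d > 0" "\<forall>s\<in>{a..}. \<bar>s - t\<bar> < d \<longrightarrow> \<gamma> s = L t s"
      using L [OF t] by blast
    have "L t = L s" if s: "s \<in> {a..} \<inter> ball t d" for s
    proof -
      have sa: "s \<in> {a..}" using s by blast
      obtain d' where d': "d' > 0" "\<forall>r\<in>{a..}. \<bar>r - s\<bar> < d' \<longrightarrow> \<gamma> r = L s r"
        using L [OF sa] by blast
      define \<mu> where "\<mu> = min d' (d - \<bar>s - t\<bar>)"
      define r where "r = s + \<mu> / 2"
      have "d - \<bar>s - t\<bar> > 0"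
        using s by (auto simp: dist_real_def abs_minus_commute)
      then have "\<mu> > 0" "\<mu> \<le> d'" "\<mu> \<le> d - \<bar>s - t\<bar>"
        using d'(1) by (simp_all add: \<mu>_def)
      then have r: "r > s" "\<bar>r - s\<bar> < d'" "\<bar>r - t\<bar> < d"
        unfolding r_def by linarith+
      have st: "\<bar>s - t\<bar> < d"
        using s by (auto simp: dist_real_def abs_minus_commute)
      show ?thesis
      proof (rule is_flow_eqI [of _ _ s r])
        show "is_flow (L t)" "is_flow (L s)"
          using L [OF t] L [OF sa] by auto
        show "s \<noteq> r" using r by simp
        show "L t s = L s s"
          using d(2) d' sa st by force
        show "L t r = L s r"
          using d(2) d'(2) sa r by force
      qed
    qed
    then show "\<exists>T. openin (top_of_set {a..}) T \<and> t \<in> T \<and> (\<forall>s\<in>T. L t = L s)"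
      using t d by (intro exI [of _ "{a..} \<inter> ball t d"]) auto
  qed (use that in auto)
  then have "\<gamma> t = L a t" if "t \<in> {a..}" for t
    using L [OF that] that by force
  then show ?thesis
    using L [of a] by auto
qed

text \<open>
  The conditions on \<open>I\<close> provide two different parameters near \<open>a\<close>, so that the constant can be
  read off from one distance.
\<close>

lemma flow_speed_unique:
  fixes g :: "complex^'n^'n"
  assumes geo: "geodesic_on I c (flow g x)" and g: "g \<in> SL" and x: "x \<in> zero_sum"
    and I: "a \<in> I" "\<And>t. t \<ge> a \<Longrightarrow> t \<in> I"
  shows "c = 2 * sqrt CARD('n) * norm x"
proof -
  obtain e where e: "e > 0" and d: "\<And>r s. r \<in> I \<inter> ball a e \<Longrightarrow> s \<in> I \<inter> ball a e \<Longrightarrow>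
      dist_Z (flow g x r) (flow g x s) = c * \<bar>r - s\<bar>"
    using geo I unfolding geodesic_on_def by meson
  have "a + e/2 \<in> I \<inter> ball a e" "a \<in> I \<inter> ball a e"
    using e I by (auto simp: dist_real_def)
  from d [OF this] e show ?thesis
    by (simp add: dist_Z_flow [OF g x])
qed

lemma ray_iff:
  fixes \<rho> :: "real \<Rightarrow> (complex^'n^'n) set"
  shows "ray \<rho> \<longleftrightarrow> (\<exists>g x. g \<in> SL \<and> x \<in> zero_sum \<and> 2 * sqrt CARD('n) * norm x = 1 \<and> (\<forall>t\<ge>0. \<rho> t = flow g x t))"
    (is "_ \<longleftrightarrow> ?R")
proof
  assume "ray \<rho>"
  then have geo: "geodesic_on {0..} 1 \<rho>" by (simp add: ray_def)
  then obtain g x where gx: "g \<in> SL" "x \<in> zero_sum" and eq: "\<forall>t\<ge>0. \<rho> t = flow g x t"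
    using geodesic_on_halfline_is_flow [OF geo] unfolding is_flow_def by blast
  have "geodesic_on {0..} 1 (flow g x)"
    using geo eq geodesic_on_cong [of "{0..}" \<rho> "flow g x"] by simp
  then have "1 = 2 * sqrt CARD('n) * norm x"
    by (rule flow_speed_unique [OF _ gx, of "{0..}" 1 0]) auto
  then show ?R using gx eq by auto
next
  assume ?R
  then obtain g x where gx: "g \<in> SL" "x \<in> zero_sum" "2 * sqrt CARD('n) * norm x = 1"
    and eq: "\<forall>t\<ge>0. \<rho> t = flow g x t" by blast
  have "geodesic_on {0..} 1 (flow g x)"
    using geodesic_on_flow [OF gx(1,2), of "{0..}"] gx(3) by simp
  then show "ray \<rho>"
    using eq geodesic_on_cong [of "{0..}" \<rho> "flow g x"] by (simp add: ray_def)
qed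

lemma geodesic_line_is_flow:
  fixes \<gamma> :: "real \<Rightarrow> (complex^'n^'n) set"
  assumes geo: "geodesic_on UNIV c \<gamma>"
  shows "\<exists>g x. g \<in> SL \<and> x \<in> zero_sum \<and> 2 * sqrt CARD('n) * norm x = c \<and> \<gamma> = flow g x"
proof -
  have half: "\<exists>l. is_flow l \<and> (\<forall>t\<ge>a. \<gamma> t = l t)" for a
    by (rule geodesic_on_halfline_is_flow [OF geodesic_on_subset [OF geo subset_UNIV]])
  obtain l where l: "is_flow l" "\<forall>t\<ge>0. \<gamma> t = l t"
    using half by blast
  have "\<gamma> t = l t" for t
  proof -
    obtain m where m: "is_flow m" "\<forall>s\<ge>t. \<gamma> s = m s"
      using half by blast
    have "m u = l u" if "u \<ge> max 0 t" for u
      using l(2) m(2) that by (metis max.bounded_iff)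
    then have "m = l"
      by (intro is_flow_eqI [OF m(1) l(1), where s = "max 0 t" and t = "max 0 t + 1"]) simp_all
    then show ?thesis using m by simp
  qed
  then have "\<gamma> = l" by (rule ext)
  then obtain g x where gx: "g \<in> SL" "x \<in> zero_sum" and eq: "\<gamma> = flow g x"
    using l(1) unfolding is_flow_def by blast
  have "c = 2 * sqrt CARD('n) * norm x"
    using flow_speed_unique [OF geo [unfolded eq] gx, of 0] by simp
  then show ?thesis using gx eq by auto
qed

section \<open>Points at infinity\<close>

lemma ediag_eq_rdiag: "ediag z = rdiag (\<chi> i. exp (z $ i))"
  by (simp add: ediag_def rdiag_def vec_eq_iff)

lemma norm_ediag_le:
  fixes z :: "real^'n"
  shows "norm (ediag z) \<le> real CARD('n) * exp (norm z)"
proof -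
  have "norm (ediag z) \<le> (\<Sum>i\<in>UNIV. \<bar>(\<chi> i. exp (z $ i)) $ i\<bar>)"
    unfolding ediag_eq_rdiag norm_rdiag by (rule norm_le_l1_cart)
  also have "\<dots> \<le> (\<Sum>i\<in>(UNIV :: 'n set). exp (norm z))"
    using component_le_norm_cart [of z] by (intro sum_mono) (auto dest: abs_le_D1)
  finally show ?thesis by simp
qed

text \<open>
  An upper bound for all entries of \<open>z\<close> is also a lower bound for them because their sum is 0.
\<close>

lemma norm_zero_sum_le:
  fixes z :: "real^'n"
  assumes z: "z \<in> zero_sum" and M: "norm (ediag z) \<le> M" "M \<ge> 1"
  shows "norm z \<le> real CARD('n) * (real CARD('n) * ln M)"
proof -
  have "z $ i \<le> ln M" for i
  proof -
    have "exp (z $ i) \<le> norm (ediag z)"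
      unfolding ediag_eq_rdiag norm_rdiag
      using component_le_norm_cart [of "\<chi> i. exp (z $ i)" i] by simp
    then show ?thesis
      using M by (subst ln_ge_iff) auto
  qed
  note up = this
  have L: "ln M \<ge> 0" using M by simp
  have n: "real CARD('n) \<ge> 1"
    by (simp add: Suc_le_eq)
  have "\<bar>z $ i\<bar> \<le> real CARD('n) * ln M" for i
  proof -
    have "- z $ i = (\<Sum>j\<in>UNIV - {i}. z $ j)"
      using z by (simp add: zero_sum_def sum_diff1)
    also have "\<dots> \<le> (\<Sum>j\<in>UNIV - {i}. ln M)"
      by (intro sum_mono up)
    also have "\<dots> \<le> real CARD('n) * ln M"
      using L by (simp add: mult_right_mono)
    finally have "- z $ i \<le> real CARD('n) * ln M" .
    moreover have "z $ i \<le> real CARD('n) * ln M"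
      using up [of i] mult_right_mono [OF n L] by simp
    ultimately show ?thesis by (simp add: abs_le_iff)
  qed
  then have "(\<Sum>i\<in>UNIV. \<bar>z $ i\<bar>) \<le> (\<Sum>i\<in>(UNIV :: 'n set). real CARD('n) * ln M)"
    by (intro sum_mono)
  then show ?thesis
    using norm_le_l1_cart [of z] by simp
qed

text \<open>
  The distance of two points depends only on the singular values of \<open>g\<^sup>-\<^sup>1 h\<close>. So it is bounded
  on a family of pairs iff \<open>g\<^sup>-\<^sup>1 h\<close> is bounded, and then the inverse is bounded, too.
\<close>

lemma dist_Z_singular_values:
  fixes g h :: "complex^'n^'n"
  assumes g: "g \<in> SL" and h: "h \<in> SL"
  obtains z :: "real^'n" where "z \<in> zero_sum" "dist_Z (coset g) (coset h) = 2 * sqrt CARD('n) * norm z"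
    "norm (matrix_inv g ** h) = norm (ediag z)" "norm (matrix_inv (matrix_inv g ** h)) = norm (ediag (- z))"
proof -
  let ?m = "matrix_inv g ** h"
  obtain U and z :: "real^'n" and V where U: "U \<in> SU" "z \<in> zero_sum" "V \<in> SU" "?m = U ** ediag z ** V"
    using SL_singular_value_decomposition [of ?m] g h by (metis SL_inv SL_mult)
  have "h = (g ** U) ** ediag z ** V"
    using g U(4) by (metis SL_cancel_left' matrix_mul_assoc)
  then have "coset h = coset ((g ** U) ** ediag z)" "coset g = coset (g ** U)"
    using U g by (simp_all add: coset_mult_SU SL_mult SU_SL ediag_SL)
  then have "dist_Z (coset g) (coset h) = 2 * sqrt CARD('n) * norm z"
    using dist_Z_diagonal [of "g ** U" z] U g by (simp add: SL_mult SU_SL)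
  moreover have "norm ?m = norm (ediag z)"
    using U by (simp add: norm_mult_unitary_left norm_mult_unitary_right SU_left SU_right)
  moreover have "matrix_inv ?m = adj V ** ediag (- z) ** adj U"
    using U by (simp add: matrix_inv_mult SL_mult SU_SL ediag_SL SU_inv matrix_inv_ediag matrix_mul_assoc)
  then have "norm (matrix_inv ?m) = norm (ediag (- z))"
    using U by (simp add: norm_mult_unitary_left norm_mult_unitary_right SU_left SU_right)
  ultimately show thesis
    by (intro that [OF U(2)])
qed

lemma norm_le_if_dist_Z_le:
  fixes g h :: "complex^'n^'n"
  assumes "g \<in> SL" "h \<in> SL" "dist_Z (coset g) (coset h) \<le> B"
  shows "norm (matrix_inv g ** h) \<le> real CARD('n) * exp B"
    and "norm (matrix_inv (matrix_inv g ** h)) \<le> real CARD('n) * exp B"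
proof -
  obtain z :: "real^'n" where z: "dist_Z (coset g) (coset h) = 2 * sqrt CARD('n) * norm z"
    "norm (matrix_inv g ** h) = norm (ediag z)" "norm (matrix_inv (matrix_inv g ** h)) = norm (ediag (- z))"
    using dist_Z_singular_values [OF assms(1,2)] .
  have "1 * norm z \<le> 2 * sqrt CARD('n) * norm z"
  proof (rule mult_right_mono)
    have "1 \<le> sqrt CARD('n)"
      by (simp add: Suc_le_eq)
    then show "1 \<le> 2 * sqrt CARD('n)" by linarith
  qed simp
  then have "norm z \<le> B"
    using z assms by simp
  then have "real CARD('n) * exp (norm z) \<le> real CARD('n) * exp B"
    by simp
  then show "norm (matrix_inv g ** h) \<le> real CARD('n) * exp B"
    "norm (matrix_inv (matrix_inv g ** h)) \<le> real CARD('n) * exp B"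
    unfolding z using norm_ediag_le [of z] norm_ediag_le [of "- z", unfolded norm_minus_cancel] by linarith+
qed

lemma dist_Z_le_if_norm_le:
  fixes g h :: "complex^'n^'n"
  assumes "g \<in> SL" "h \<in> SL" "norm (matrix_inv g ** h) \<le> M"
  shows "dist_Z (coset g) (coset h) \<le> 2 * sqrt CARD('n) * (real CARD('n) * (real CARD('n) * ln (max M 1)))"
proof -
  obtain z :: "real^'n" where z: "z \<in> zero_sum" "dist_Z (coset g) (coset h) = 2 * sqrt CARD('n) * norm z"
    "norm (matrix_inv g ** h) = norm (ediag z)"
    using dist_Z_singular_values [OF assms(1,2)] by metis
  show ?thesis
    unfolding z(2) using norm_zero_sum_le [OF z(1), of "max M 1"] assms(3)
    by (intro mult_left_mono) (auto simp: z(3) [symmetric])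
qed

definition unit_dirs :: "(real^'n) set" where
  "unit_dirs = {x \<in> zero_sum. 2 * sqrt CARD('n) * norm x = 1}"

lemma unit_dirs_zero_sum: "x \<in> unit_dirs \<Longrightarrow> x \<in> zero_sum"
  by (simp add: unit_dirs_def)

lemma unit_dirs_minus: "x \<in> unit_dirs \<Longrightarrow> - x \<in> unit_dirs"
  by (simp add: unit_dirs_def zero_sum_minus)

lemma ray_flow: "g \<in> SL \<Longrightarrow> x \<in> unit_dirs \<Longrightarrow> ray (flow g x)"
  unfolding ray_iff unit_dirs_def by blast

lemma ray_cases:
  "ray \<rho> \<Longrightarrow> \<exists>g x. g \<in> SL \<and> x \<in> unit_dirs \<and> (\<forall>t\<ge>0. \<rho> t = flow g x t)"
  unfolding ray_iff unit_dirs_def by blast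

text \<open>
  The position of the second flow relative to the first one. The distance between the flows is
  bounded iff this matrix is.
\<close>

definition drift :: "complex^'n^'n \<Rightarrow> real^'n \<Rightarrow> complex^'n^'n \<Rightarrow> real^'n \<Rightarrow> real \<Rightarrow> complex^'n^'n" where
  "drift g x h y t = matrix_inv (g ** ediag (t *\<^sub>R x)) ** (h ** ediag (t *\<^sub>R y))"

lemma bounded_flow_dist_iff:
  fixes g h :: "complex^'n^'n"
  assumes g: "g \<in> SL" "x \<in> zero_sum" and h: "h \<in> SL" "y \<in> zero_sum"
  shows "(\<exists>B. \<forall>t\<ge>0. dist_Z (flow g x t) (flow h y t) \<le> B) \<longleftrightarrow> (\<exists>M. \<forall>t\<ge>0. norm (drift g x h y t) \<le> M)" (is "?A \<longleftrightarrow> ?B")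
    and "(\<exists>M. \<forall>t\<ge>0. norm (drift g x h y t) \<le> M) \<Longrightarrow> (\<exists>M. \<forall>t\<ge>0. norm (drift h y g x t) \<le> M)"
proof -
  have SL: "g ** ediag (t *\<^sub>R x) \<in> SL" "h ** ediag (t *\<^sub>R y) \<in> SL" for t
    using assms by (simp_all add: SL_mult ediag_SL zero_sum_scaleR)
  have inv: "drift h y g x t = matrix_inv (drift g x h y t)" for t
    unfolding drift_def using SL [of t] by (simp add: matrix_inv_mult SL_inv matrix_inv_inv)
  show *: "?A \<longleftrightarrow> ?B"
    unfolding flow_def drift_def
    using norm_le_if_dist_Z_le(1) [OF SL] dist_Z_le_if_norm_le [OF SL] by meson
  show "\<exists>M. \<forall>t\<ge>0. norm (drift h y g x t) \<le> M"
    if bounded: "\<exists>M. \<forall>t\<ge>0. norm (drift g x h y t) \<le> M"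
  proof -
    obtain B where "\<forall>t\<ge>0. dist_Z (flow g x t) (flow h y t) \<le> B"
      using bounded * by blast
    then have "\<forall>t\<ge>0. norm (drift h y g x t) \<le> real CARD('n) * exp B"
      unfolding inv unfolding flow_def drift_def using norm_le_if_dist_Z_le(2) [OF SL] by blast
    then show ?thesis by blast
  qed
qed

lemma asymptotic_iff_drift:
  fixes g h :: "complex^'n^'n"
  assumes g: "g \<in> SL" "x \<in> unit_dirs" "\<And>t. t \<ge> 0 \<Longrightarrow> \<rho> t = flow g x t"
    and h: "h \<in> SL" "y \<in> unit_dirs" "\<And>t. t \<ge> 0 \<Longrightarrow> \<sigma> t = flow h y t"
  shows "(\<rho>, \<sigma>) \<in> asymptotic \<longleftrightarrow> (\<exists>M. \<forall>t\<ge>0. norm (drift g x h y t) \<le> M)"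
proof -
  have "ray \<rho>" "ray \<sigma>"
    using g h unfolding ray_iff unit_dirs_def by auto
  moreover have "(\<forall>t\<ge>0. dist_Z (\<rho> t) (\<sigma> t) \<le> B) \<longleftrightarrow> (\<forall>t\<ge>0. dist_Z (flow g x t) (flow h y t) \<le> B)" for B
    using g(3) h(3) by simp
  ultimately show ?thesis
    using bounded_flow_dist_iff(1) [OF g(1) unit_dirs_zero_sum [OF g(2)] h(1) unit_dirs_zero_sum [OF h(2)]]
    by (simp add: asymptotic_def)
qed

lemma asymptotic_cases:
  assumes "(\<rho>, \<sigma>) \<in> asymptotic"
  shows "\<exists>g x h y. g \<in> SL \<and> x \<in> unit_dirs \<and> (\<forall>t\<ge>0. \<rho> t = flow g x t) \<and>
    h \<in> SL \<and> y \<in> unit_dirs \<and> (\<forall>t\<ge>0. \<sigma> t = flow h y t)"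
proof -
  have rays: "ray \<rho>" "ray \<sigma>"
    using assms by (auto simp: asymptotic_def)
  obtain g x where "g \<in> SL" "x \<in> unit_dirs" "\<And>t. t \<ge> 0 \<Longrightarrow> \<rho> t = flow g x t"
    using ray_cases [OF rays(1)] by blast
  moreover obtain h y where "h \<in> SL" "y \<in> unit_dirs" "\<And>t. t \<ge> 0 \<Longrightarrow> \<sigma> t = flow h y t"
    using ray_cases [OF rays(2)] by blast
  ultimately show ?thesis by blast
qed

text \<open>
  Transitivity comes from the product rule for \<open>drift\<close> with a third flow in between, which takes the
  place of the triangle inequality for \<open>dist_Z\<close>.
\<close>

lemma equiv_asymptotic: "equiv (Collect ray) (asymptotic :: ((real \<Rightarrow> (complex^'n^'n) set) \<times> _) set)"
proof (rule equivI)
  show "(asymptotic :: ((real \<Rightarrow> (complex^'n^'n) set) \<times> _) set) \<subseteq> Collect ray \<times> Collect ray"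
    by (auto simp: asymptotic_def)
  show "refl_on (Collect ray) (asymptotic :: ((real \<Rightarrow> (complex^'n^'n) set) \<times> _) set)"
  proof (rule refl_onI)
    fix \<rho> :: "real \<Rightarrow> (complex^'n^'n) set"
    assume "\<rho> \<in> Collect ray"
    then obtain g x where g: "g \<in> SL" "x \<in> unit_dirs" "\<And>t. t \<ge> 0 \<Longrightarrow> \<rho> t = flow g x t"
      using ray_cases by blast
    have "drift g x g x t = mat 1" for t
      unfolding drift_def using g
      by (simp add: SL_left_inverse SL_mult ediag_SL zero_sum_scaleR unit_dirs_zero_sum)
    then show "(\<rho>, \<rho>) \<in> asymptotic"
      using asymptotic_iff_drift [OF g g] by auto
  qed
  show "sym (asymptotic :: ((real \<Rightarrow> (complex^'n^'n) set) \<times> _) set)"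
  proof (rule symI)
    fix \<rho> \<sigma> :: "real \<Rightarrow> (complex^'n^'n) set"
    assume a: "(\<rho>, \<sigma>) \<in> asymptotic"
    obtain g x h y where g: "g \<in> SL" "x \<in> unit_dirs" "\<And>t. t \<ge> 0 \<Longrightarrow> \<rho> t = flow g x t"
      and h: "h \<in> SL" "y \<in> unit_dirs" "\<And>t. t \<ge> 0 \<Longrightarrow> \<sigma> t = flow h y t"
      using asymptotic_cases [OF a] by blast
    show "(\<sigma>, \<rho>) \<in> asymptotic"
      by (rule iffD2 [OF asymptotic_iff_drift [OF h g]
            bounded_flow_dist_iff(2) [OF g(1) unit_dirs_zero_sum [OF g(2)] h(1) unit_dirs_zero_sum [OF h(2)]
              iffD1 [OF asymptotic_iff_drift [OF g h] a]]])
  qed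
  show "trans (asymptotic :: ((real \<Rightarrow> (complex^'n^'n) set) \<times> _) set)"
  proof (rule transI)
    fix \<rho> \<sigma> \<tau> :: "real \<Rightarrow> (complex^'n^'n) set"
    assume a: "(\<rho>, \<sigma>) \<in> asymptotic" and b: "(\<sigma>, \<tau>) \<in> asymptotic"
    obtain g x h y where g: "g \<in> SL" "x \<in> unit_dirs" "\<And>t. t \<ge> 0 \<Longrightarrow> \<rho> t = flow g x t"
      and h: "h \<in> SL" "y \<in> unit_dirs" "\<And>t. t \<ge> 0 \<Longrightarrow> \<sigma> t = flow h y t"
      using asymptotic_cases [OF a] by blast
    have "ray \<tau>"
      using b by (simp add: asymptotic_def)
    then obtain k z where k: "k \<in> SL" "z \<in> unit_dirs" "\<And>t. t \<ge> 0 \<Longrightarrow> \<tau> t = flow k z t"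
      using ray_cases by blast
    obtain M where M: "\<And>t. t \<ge> 0 \<Longrightarrow> norm (drift g x h y t) \<le> M"
      using a asymptotic_iff_drift [OF g h] by blast
    obtain N where N: "\<And>t. t \<ge> 0 \<Longrightarrow> norm (drift h y k z t) \<le> N"
      using b asymptotic_iff_drift [OF h k] by blast
    obtain K where K: "K \<ge> 0" "\<forall>(A :: complex^'n^'n) (B :: complex^'n^'n). norm (A ** B) \<le> norm A * norm B * K"
      using bounded_bilinear.nonneg_bounded [OF bounded_bilinear_matrix_mult [where 'n = 'n]] by blast
    have "norm (drift g x k z t) \<le> M * N * K" if t: "t \<ge> 0" for t
    proof -
      have *: "(A ** p) ** (matrix_inv p ** C) = A ** C"
        if "p \<in> SL" for A p C :: "complex^'n^'n"
        using SL_cancel_left' [OF that, of C] by (simp only: matrix_mul_assoc [symmetric])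
      have "h ** ediag (t *\<^sub>R y) \<in> SL"
        using h by (simp add: SL_mult ediag_SL zero_sum_scaleR unit_dirs_zero_sum)
      then have "drift g x k z t = drift g x h y t ** drift h y k z t"
        unfolding drift_def by (simp only: *)
      also have "norm \<dots> \<le> norm (drift g x h y t) * norm (drift h y k z t) * K"
        using K(2) by blast
      also have "\<dots> \<le> M * N * K"
        using M [OF t] N [OF t] K(1)
        by (intro mult_right_mono mult_mono) (auto intro: order_trans [OF norm_ge_zero])
      finally show ?thesis .
    qed
    then show "(\<rho>, \<tau>) \<in> asymptotic"
      using asymptotic_iff_drift [OF g k] by blast
  qed
qed

text \<open>
  For \<open>x = y\<close> and \<open>w \<in> SL\<close> this is the parabolic subgroup that stabilizes the flag of the spaces
  \<open>coord {i. c \<le> x $ i}\<close>.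
\<close>

definition dominated :: "real^'n \<Rightarrow> real^'n \<Rightarrow> complex^'n^'n \<Rightarrow> bool" where
  "dominated x y w \<longleftrightarrow> (\<forall>i j. x $ i < y $ j \<longrightarrow> w $ i $ j = 0)"

text \<open>
  The \<open>(i, j)\<close> entry of \<open>g\<^sup>-\<^sup>1 h\<close> is multiplied by \<open>exp (t (y\<^sub>j - x\<^sub>i))\<close>, which is bounded for
  \<open>t \<ge> 0\<close> unless \<open>x\<^sub>i < y\<^sub>j\<close>.
\<close>

lemma drift_bounded_iff:
  fixes g h :: "complex^'n^'n"
  assumes g: "g \<in> SL" "x \<in> zero_sum" and h: "h \<in> SL" "y \<in> zero_sum"
  shows "(\<exists>M. \<forall>t\<ge>0. norm (drift g x h y t) \<le> M) \<longleftrightarrow> dominated x y (matrix_inv g ** h)"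
proof -
  define w where "w = matrix_inv g ** h"
  have nth: "drift g x h y t $ i $ j = w $ i $ j * complex_of_real (exp (t * (y $ j - x $ i)))" for t i j
  proof -
    have "drift g x h y t = ediag (- (t *\<^sub>R x)) ** w ** ediag (t *\<^sub>R y)"
      unfolding drift_def w_def using g
      by (simp add: matrix_inv_mult ediag_SL zero_sum_scaleR matrix_inv_ediag matrix_mul_assoc)
    moreover have "exp (- (t * x $ i)) * exp (t * y $ j) = exp (t * (y $ j - x $ i))"
      by (simp add: exp_add [symmetric] algebra_simps)
    then have "complex_of_real (exp (- (t * x $ i))) * complex_of_real (exp (t * y $ j))
      = complex_of_real (exp (t * (y $ j - x $ i)))"
      by (simp only: of_real_mult [symmetric])
    ultimately show ?thesis
      by (simp add: ediag_mult_nth mult_ediag_nth mult_ac del: of_real_exp)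
  qed
  show ?thesis
    unfolding w_def [symmetric]
  proof
    assume "\<exists>M. \<forall>t\<ge>0. norm (drift g x h y t) \<le> M"
    then obtain M where M: "\<And>t. t \<ge> 0 \<Longrightarrow> norm (drift g x h y t) \<le> M" by blast
    show "dominated x y w"
      unfolding dominated_def
    proof (intro allI impI, rule ccontr)
      fix i j
      assume lt: "x $ i < y $ j" and nz: "w $ i $ j \<noteq> 0"
      define d c where "d = y $ j - x $ i" and "c = cmod (w $ i $ j)"
      have d: "d > 0" and c: "c > 0"
        using lt nz by (simp_all add: d_def c_def)
      have M0: "M \<ge> 0"
        using M [of 0] norm_ge_zero order_trans by (meson order_refl)
      \<comment> \<open>At this time \<open>c exp (t d) \<ge> c (1 + t d) = c + M\<close> exceeds the bound.\<close>
      define t where "t = M / (c * d)"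
      have t: "t \<ge> 0" using M0 c d by (simp add: t_def)
      have "cmod (drift g x h y t $ i $ j) = c * exp (t * d)"
        unfolding nth norm_mult norm_of_real by (simp add: c_def d_def)
      moreover have "cmod (drift g x h y t $ i $ j) \<le> norm (drift g x h y t $ i)"
        "norm (drift g x h y t $ i) \<le> norm (drift g x h y t)"
        by (rule Finite_Cartesian_Product.norm_nth_le)+
      ultimately have "c * exp (t * d) \<le> M"
        using M [OF t] by linarith
      moreover have "c * (1 + t * d) \<le> c * exp (t * d)"
        using c by (intro mult_left_mono exp_ge_add_one_self) auto
      moreover have "c * (1 + t * d) = c + M"
        using c d by (simp add: t_def field_simps)
      ultimately show False using c by linarith
    qed
  next
    assume dom: "dominated x y w"
    have "norm (drift g x h y t) \<le> norm w" if t: "t \<ge> 0" for t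
    proof (rule norm_matrix_mono)
      fix i j
      show "cmod (drift g x h y t $ i $ j) \<le> cmod (w $ i $ j)"
      proof (cases "x $ i < y $ j")
        case True
        then show ?thesis using dom by (simp add: nth dominated_def)
      next
        case False
        then have "exp (t * (y $ j - x $ i)) \<le> 1"
          using t by (simp add: mult_nonneg_nonpos)
        then show ?thesis
          unfolding nth norm_mult norm_of_real by (simp add: mult_left_le)
      qed
    qed
    then show "\<exists>M. \<forall>t\<ge>0. norm (drift g x h y t) \<le> M" by blast
  qed
qed

definition endpoint :: "complex^'n^'n \<Rightarrow> real^'n \<Rightarrow> (real \<Rightarrow> (complex^'n^'n) set) set" where
  "endpoint g x = ray_class (flow g x)"

lemma ray_class_eq_endpoint:
  assumes "g \<in> SL" "x \<in> unit_dirs" "\<And>t. t \<ge> 0 \<Longrightarrow> \<rho> t = flow g x t"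
  shows "ray_class \<rho> = endpoint g x"
proof -
  have "dominated x x (matrix_inv g ** g)"
    using assms(1) by (auto simp: dominated_def SL_left_inverse mat_def)
  then have "(\<rho>, flow g x) \<in> asymptotic"
    using asymptotic_iff_drift [OF assms assms(1,2), of "flow g x"]
      drift_bounded_iff [of g x g x] assms by (simp add: unit_dirs_zero_sum)
  then show ?thesis
    unfolding ray_class_def endpoint_def by (rule equiv_class_eq [OF equiv_asymptotic])
qed

lemma endpoint_eq_iff:
  assumes "g \<in> SL" "x \<in> unit_dirs" "h \<in> SL" "y \<in> unit_dirs"
  shows "endpoint g x = endpoint h y \<longleftrightarrow> dominated x y (matrix_inv g ** h)"
proof -
  have "endpoint g x = endpoint h y \<longleftrightarrow> (flow g x, flow h y) \<in> asymptotic"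
    unfolding endpoint_def ray_class_def
    using eq_equiv_class_iff [OF equiv_asymptotic, of "flow g x" "flow h y"] assms
    by (simp add: ray_flow)
  also have "\<dots> \<longleftrightarrow> dominated x y (matrix_inv g ** h)"
    using asymptotic_iff_drift [OF assms(1,2) _ assms(3,4), of "flow g x" "flow h y"]
      drift_bounded_iff [of g x h y] assms by (simp add: unit_dirs_zero_sum)
  finally show ?thesis .
qed

lemma Z_inf_iff: "z \<in> Z_inf \<longleftrightarrow> (\<exists>g x. g \<in> SL \<and> x \<in> unit_dirs \<and> z = endpoint g x)"
proof
  assume "z \<in> Z_inf"
  then obtain \<rho> where \<rho>: "ray \<rho>" "z = ray_class \<rho>"
    unfolding Z_inf_def quotient_def ray_class_def by blast
  obtain g x where "g \<in> SL" "x \<in> unit_dirs" "\<And>t. t \<ge> 0 \<Longrightarrow> \<rho> t = flow g x t"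
    using ray_cases [OF \<rho>(1)] by blast
  then show "\<exists>g x. g \<in> SL \<and> x \<in> unit_dirs \<and> z = endpoint g x"
    using ray_class_eq_endpoint \<rho>(2) by blast
next
  assume "\<exists>g x. g \<in> SL \<and> x \<in> unit_dirs \<and> z = endpoint g x"
  then show "z \<in> Z_inf"
    unfolding Z_inf_def endpoint_def ray_class_def by (auto intro: quotientI simp: ray_flow)
qed

lemma translate_flow: "translate s (flow g x t) = flow (s ** g) x t"
  by (simp add: flow_def translate_coset matrix_mul_assoc)

lemma translate_asymptotic:
  assumes s: "s \<in> SL" and a: "(\<rho>, \<sigma>) \<in> asymptotic"
  shows "(translate s \<circ> \<rho>, translate s \<circ> \<sigma>) \<in> asymptotic"
proof -
  obtain g x h y where g: "g \<in> SL" "x \<in> unit_dirs" "\<And>t. t \<ge> 0 \<Longrightarrow> \<rho> t = flow g x t"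
    and h: "h \<in> SL" "y \<in> unit_dirs" "\<And>t. t \<ge> 0 \<Longrightarrow> \<sigma> t = flow h y t"
    using asymptotic_cases [OF a] by blast
  have "drift (s ** g) x (s ** h) y t = drift g x h y t" for t
  proof -
    have *: "g ** ediag (t *\<^sub>R x) \<in> SL"
      using g by (simp add: SL_mult ediag_SL zero_sum_scaleR unit_dirs_zero_sum)
    have "drift (s ** g) x (s ** h) y t
      = matrix_inv (s ** (g ** ediag (t *\<^sub>R x))) ** (s ** (h ** ediag (t *\<^sub>R y)))"
      by (simp add: drift_def matrix_mul_assoc)
    also have "\<dots> = matrix_inv (g ** ediag (t *\<^sub>R x)) ** (matrix_inv s ** (s ** (h ** ediag (t *\<^sub>R y))))"
      unfolding matrix_inv_mult [OF s *] by (simp only: matrix_mul_assoc)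
    finally show ?thesis
      by (simp only: SL_cancel_left [OF s] drift_def)
  qed
  then show ?thesis
    using a asymptotic_iff_drift [OF g h]
      asymptotic_iff_drift [of "s ** g" x "translate s \<circ> \<rho>" "s ** h" y "translate s \<circ> \<sigma>"] g h s
    by (simp add: SL_mult translate_flow)
qed

lemma translate_inverse: "s \<in> SL \<Longrightarrow> translate s (translate (matrix_inv s) p) = p"
  by (simp add: translate_def image_image SL_cancel_left')

text \<open>
  Translation by \<open>s\<close> acts on whole rays, including their arbitrary values at negative parameters.
  It maps a class onto a class because translation by the inverse of \<open>s\<close> undoes it.
\<close>

lemma act_inf_endpoint:
  assumes s: "s \<in> SL" and g: "g \<in> SL" and x: "x \<in> unit_dirs"
  shows "act_inf s (endpoint g x) = endpoint (s ** g) x"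
proof -
  have eq: "translate r \<circ> flow h x = flow (r ** h) x" for r h
    by (simp add: fun_eq_iff translate_flow)
  show ?thesis
  proof (intro subset_antisym subsetI)
    fix \<tau> assume "\<tau> \<in> act_inf s (endpoint g x)"
    then obtain \<sigma> where "(flow g x, \<sigma>) \<in> asymptotic" "\<tau> = translate s \<circ> \<sigma>"
      unfolding act_inf_def endpoint_def ray_class_def by blast
    then show "\<tau> \<in> endpoint (s ** g) x"
      using translate_asymptotic [OF s] unfolding endpoint_def ray_class_def by (metis Image_singleton_iff eq)
  next
    fix \<tau> assume "\<tau> \<in> endpoint (s ** g) x"
    then have "(flow (s ** g) x, \<tau>) \<in> asymptotic"
      unfolding endpoint_def ray_class_def by blast
    from translate_asymptotic [OF SL_inv [OF s] this]
    have "(flow g x, translate (matrix_inv s) \<circ> \<tau>) \<in> asymptotic"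
      by (simp add: eq SL_cancel_left s)
    moreover have "\<tau> = translate s \<circ> (translate (matrix_inv s) \<circ> \<tau>)"
      by (simp add: fun_eq_iff translate_inverse s)
    ultimately show "\<tau> \<in> act_inf s (endpoint g x)"
      unfolding act_inf_def endpoint_def ray_class_def by blast
  qed
qed

lemma stab_inf_endpoint:
  assumes g: "g \<in> SL" and x: "x \<in> unit_dirs"
  shows "stab_inf (endpoint g x) = {s \<in> SL. dominated x x (matrix_inv g ** (s ** g))}"
proof -
  have "act_inf s (endpoint g x) = endpoint g x \<longleftrightarrow> dominated x x (matrix_inv g ** (s ** g))"
    if "s \<in> SL" for s
    using endpoint_eq_iff [OF g x SL_mult [OF that g] x] act_inf_endpoint [OF that g x] by auto
  then show ?thesis
    unfolding stab_inf_def by blast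
qed

section \<open>Subspaces and adapted frames\<close>

definition coord :: "'n set \<Rightarrow> (complex^'n) set" where
  "coord S = {v. \<forall>i. i \<notin> S \<longrightarrow> v $ i = 0}"

lemma subspace_coord: "vec.subspace (coord S)"
  by (simp add: vec.subspace_def coord_def)

lemma dim_coord: "vec.dim (coord S :: (complex^'n) set) = card S"
  unfolding coord_def by (rule dim_substandard_cart)

lemma axis_in_coord: "axis i 1 \<in> coord S \<longleftrightarrow> i \<in> S"
  by (auto simp: coord_def axis_def)

lemma subspace_image_matrix: "vec.subspace W \<Longrightarrow> vec.subspace ((*v) (g :: complex^'n^'n) ` W)"
  by (rule vec.linear_subspace_image) (rule matrix_vector_mul_linear_gen)

lemma image_mult: "(*v) (g ** h) ` W = (*v) g ` (*v) h ` W" for g h :: "complex^'n^'n"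
  by (simp add: image_image matrix_vector_mul_assoc)

lemma image_mat1: "(*v) (mat 1) ` W = W" for W :: "(complex^'n) set"
  by simp

lemma SL_inj: "g \<in> SL \<Longrightarrow> inj ((*v) g)"
  by (rule inj_matrix_vector_mult) (simp add: SL_def invertible_det_nz)

lemma image_cancel: "g \<in> SL \<Longrightarrow> (*v) (matrix_inv g) ` (*v) g ` W = W"
  and image_cancel': "g \<in> SL \<Longrightarrow> (*v) g ` (*v) (matrix_inv g) ` W = W"
  by (simp_all only: image_mult [symmetric] SL_left_inverse SL_right_inverse image_mat1)

lemma SL_surj: "g \<in> SL \<Longrightarrow> surj ((*v) g)"
  by (rule surjI [of _ "(*v) (matrix_inv g)"]) (simp add: matrix_vector_mul_assoc SL_right_inverse)

lemma coord_Int_Compl: "coord S \<inter> coord (- S) = {0}"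
  by (auto simp: coord_def vec_eq_iff) blast

lemma coord_decomposition:
  fixes g :: "complex^'n^'n"
  assumes g: "g \<in> SL"
  shows "\<exists>a\<in>coord S. \<exists>b\<in>coord (- S). w = g *v a + g *v b"
proof -
  define v where "v = matrix_inv g *v w"
  have w: "w = g *v v"
    using g by (simp add: v_def matrix_vector_mul_assoc SL_right_inverse)
  define a b :: "complex^'n" where "a = (\<chi> i. if i \<in> S then v $ i else 0)"
    and "b = (\<chi> i. if i \<in> S then 0 else v $ i)"
  have "v = a + b"
    by (simp add: a_def b_def vec_eq_iff)
  then have "w = g *v a + g *v b"
    by (simp only: w matrix_vector_right_distrib)
  moreover have "a \<in> coord S" "b \<in> coord (- S)"
    by (simp_all add: a_def b_def coord_def)
  ultimately show ?thesis by blast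
qed

lemma image_subset_imp_eq:
  fixes g :: "complex^'n^'n"
  assumes g: "g \<in> SL" and W: "vec.subspace W" and sub: "(*v) g ` W \<subseteq> W"
  shows "(*v) g ` W = W"
proof (rule vec.subspace_dim_equal [OF subspace_image_matrix [OF W] W sub])
  have "vec.dim ((*v) g ` W) = vec.dim W"
    by (rule vec.dim_image_eq [OF matrix_vector_mul_linear_gen]) (rule inj_on_subset [OF SL_inj [OF g] subset_UNIV])
  then show "vec.dim W \<le> vec.dim ((*v) g ` W)" by simp
qed

lemma card_eq_if_image_coord_eq:
  fixes g h :: "complex^'n^'n"
  assumes "g \<in> SL" "h \<in> SL" "(*v) g ` coord S = (*v) h ` coord T"
  shows "card S = card T"
proof -
  have "vec.dim ((*v) k ` coord R) = card R" if "k \<in> SL" for k :: "complex^'n^'n" and R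
    unfolding dim_coord [symmetric]
    by (rule vec.dim_image_eq [OF matrix_vector_mul_linear_gen]) (rule inj_on_subset [OF SL_inj [OF that] subset_UNIV])
  then show ?thesis
    using assms by metis
qed

text \<open>
  A linear projection onto \<open>W\<close> exists, and its kernel is a complement.
\<close>

lemma exists_complement:
  fixes W :: "(complex^'n) set"
  assumes W: "vec.subspace W"
  shows "\<exists>W'. vec.subspace W' \<and> W \<inter> W' = {0} \<and> (\<forall>v. \<exists>w\<in>W. \<exists>w'\<in>W'. v = w + w')"
proof -
  obtain p where p: "p ` UNIV \<subseteq> W" "Vector_Spaces.linear (*s) (*s) p" "\<forall>v\<in>W. p v = v"
    using vec.linear_exists_left_inverse_on [OF vec.linear_id W] by auto
  let ?W' = "{v. p v = 0}"
  have "v - p v \<in> ?W'" for v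
    using p by (simp add: vec.linear_diff [OF p(2)] image_subset_iff)
  then have "\<exists>w\<in>W. \<exists>w'\<in>?W'. v = w + w'" for v
    using p(1) by (intro bexI [of _ "p v"] bexI [of _ "v - p v"]) auto
  moreover have "vec.subspace ?W'"
    by (rule vec.linear_subspace_kernel [OF p(2)])
  moreover have "W \<inter> ?W' = {0}"
    using p(3) vec.subspace_0 [OF W] by auto
  ultimately show ?thesis by blast
qed

text \<open>
  Take a basis of the whole space from \<open>W \<union> W'\<close> as the columns of a matrix, and rescale one column
  so that the determinant becomes 1. If \<open>S\<close> collects the columns in \<open>W\<close>, the images of the two
  coordinate spaces lie in \<open>W\<close> and \<open>W'\<close> and together span everything. As \<open>W\<close> and \<open>W'\<close> meet only in
  0, they exhaust \<open>W\<close> and \<open>W'\<close>.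
\<close>

lemma adapted_frame:
  fixes W W' :: "(complex^'n) set"
  assumes W: "vec.subspace W" and W': "vec.subspace W'" and int: "W \<inter> W' = {0}"
    and sum: "\<And>v. \<exists>w\<in>W. \<exists>w'\<in>W'. v = w + w'"
  shows "\<exists>q S. q \<in> SL \<and> (*v) q ` coord S = W \<and> (*v) q ` coord (- S) = W'"
proof -
  obtain B where B: "B \<subseteq> W \<union> W'" "vec.independent B" "W \<union> W' \<subseteq> vec.span B"
    using vec.basis_exists [of "W \<union> W'"] by metis
  have span: "vec.span B = UNIV"
  proof -
    have "v \<in> vec.span B" for v
    proof -
      obtain w w' where "w \<in> W" "w' \<in> W'" "v = w + w'"
        using sum by blast
      then show ?thesis
        using B(3) by (auto intro: vec.span_add)
    qed
    then show ?thesis by blast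
  qed
  then have "card B = vec.dim (UNIV :: (complex^'n) set)"
    using B(2) by (intro vec.basis_card_eq_dim) auto
  then have "card B = CARD('n)"
    by (simp only: vec_dim_card)
  then obtain f where f: "bij_betw f (UNIV :: 'n set) B"
    using finite_same_card_bij [of "UNIV :: 'n set" B] vec.finiteI_independent [OF B(2)] by auto
  define q0 :: "complex^'n^'n" where "q0 = (\<chi> i j. f j $ i)"
  have col0: "column j q0 = f j" for j
    by (simp add: q0_def column_def vec_eq_iff)
  have "columns q0 = B"
    using f by (auto simp: columns_def col0 bij_betw_def)
  then obtain C where "q0 ** C = mat 1"
    using matrix_right_invertible_span_columns [of q0] span by auto
  then have "det q0 * det C = 1"
    using det_mul [of q0 C] by simp
  then have d: "det q0 \<noteq> 0" by auto
  obtain j0 :: 'n where True by simp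
  define c where "c j = (if j = j0 then 1 / det q0 else 1)" for j
  define D :: "complex^'n^'n" where "D = (\<chi> i j. if i = j then c j else 0)"
  define q where "q = q0 ** D"
  have "det D = 1 / det q0"
    by (subst det_diagonal) (simp_all add: D_def c_def)
  then have q: "q \<in> SL"
    using d by (simp add: SL_def q_def det_mul)
  define S where "S = {j. f j \<in> W}"
  have col: "column j q = c j *s f j" for j
    by (simp add: q_def D_def q0_def column_def vec_eq_iff matrix_matrix_mult_def if_distrib mult.commute cong: if_cong)
  have fB: "f j \<in> W \<union> W'" for j
    using f B(1) by (auto simp: bij_betw_def)
  have colW: "column j q \<in> W" if "j \<in> S" for j
    using that W by (simp add: col S_def vec.subspace_scale)
  have colW': "column j q \<in> W'" if "j \<notin> S" for j
    using that fB [of j] W' by (auto simp: col S_def vec.subspace_scale)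
  have sub: "q *v v \<in> W" if "v \<in> coord S" for v
    unfolding matrix_mult_sum
  proof (rule vec.subspace_sum [OF W])
    fix i
    show "v $ i *s column i q \<in> W"
      using that colW [of i] W by (cases "i \<in> S") (auto simp: coord_def vec.subspace_scale vec.subspace_0)
  qed
  have sub': "q *v v \<in> W'" if "v \<in> coord (- S)" for v
    unfolding matrix_mult_sum
  proof (rule vec.subspace_sum [OF W'])
    fix i
    show "v $ i *s column i q \<in> W'"
      using that colW' [of i] W' by (cases "i \<in> S") (auto simp: coord_def vec.subspace_scale vec.subspace_0)
  qed
  have "(*v) q ` coord S = W"
  proof (intro subset_antisym subsetI)
    fix w assume w: "w \<in> W"
    obtain a b where ab: "a \<in> coord S" "b \<in> coord (- S)" "w = q *v a + q *v b"
      using coord_decomposition [OF q] by blast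
    have "q *v b = w - q *v a" using ab by simp
    then have "q *v b \<in> W \<inter> W'"
      using sub' [OF ab(2)] vec.subspace_diff [OF W w sub [OF ab(1)]] by simp
    then have "w = q *v a" using int ab(3) by simp
    then show "w \<in> (*v) q ` coord S" using ab(1) by blast
  qed (use sub in auto)
  moreover have "(*v) q ` coord (- S) = W'"
  proof (intro subset_antisym subsetI)
    fix w assume w: "w \<in> W'"
    obtain a b where ab: "a \<in> coord S" "b \<in> coord (- S)" "w = q *v a + q *v b"
      using coord_decomposition [OF q] by blast
    have "q *v a = w - q *v b" using ab by simp
    then have "q *v a \<in> W \<inter> W'"
      using sub [OF ab(1)] vec.subspace_diff [OF W' w sub' [OF ab(2)]] by simp
    then have "w = q *v b" using int ab(3) by simp
    then show "w \<in> (*v) q ` coord (- S)" using ab(2) by blast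
  qed (use sub' in auto)
  ultimately show ?thesis using q by blast
qed

section \<open>Two-level directions and stabilizers\<close>

definition step_dir :: "'n set \<Rightarrow> real \<Rightarrow> real \<Rightarrow> real^'n" where
  "step_dir S a b = (\<chi> i. if i \<in> S then a else b)"

lemma step_dir_nth [simp]: "step_dir S a b $ i = (if i \<in> S then a else b)"
  by (simp add: step_dir_def)

lemma sum_step:
  "(\<Sum>i\<in>UNIV. if i \<in> S then a else b) = real (card S) * a + real (card (- S)) * b"
  for S :: "'n::finite set" and a b :: real
  by (subst sum.If_cases) (simp_all add: Compl_eq)

lemma step_dir_unit_iff:
  fixes S :: "'n::finite set"
  shows "step_dir S a b \<in> unit_dirs \<longleftrightarrow>
    real (card S) * a + real (card (- S)) * b = 0 \<and>
    2 * sqrt CARD('n) * sqrt (real (card S) * a\<^sup>2 + real (card (- S)) * b\<^sup>2) = 1"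
proof -
  have "(\<Sum>i\<in>UNIV. step_dir S a b $ i) = real (card S) * a + real (card (- S)) * b"
    by (simp add: sum_step)
  moreover have "norm (step_dir S a b) = sqrt (\<Sum>i\<in>UNIV. if i \<in> S then a\<^sup>2 else b\<^sup>2)"
    by (auto simp: norm_vec_def L2_set_def intro!: arg_cong [of _ _ sqrt] sum.cong)
  ultimately show ?thesis
    by (simp add: unit_dirs_def zero_sum_def sum_step)
qed

lemma unit_step_dir_proper:
  fixes S :: "'n::finite set"
  assumes "step_dir S a b \<in> unit_dirs"
  shows "S \<noteq> {}" "S \<noteq> UNIV"
  using assms unfolding step_dir_unit_iff by auto

text \<open>
  With \<open>k\<close> entries on \<open>S\<close> and \<open>l\<close> off \<open>S\<close>, trace 0 leaves the multiples of the direction with the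
  values \<open>l\<close> and \<open>- k\<close>.
\<close>

lemma exists_unit_step_dir:
  fixes S :: "'n::finite set"
  assumes "S \<noteq> {}" "S \<noteq> UNIV"
  shows "\<exists>a b. b < a \<and> step_dir S a b \<in> unit_dirs"
proof -
  define k l where "k = real (card S)" and "l = real (card (- S))"
  have pos: "k > 0" "l > 0"
    using assms by (auto simp: k_def l_def card_gt_0_iff)
  define N where "N = 2 * sqrt CARD('n) * sqrt (k * l\<^sup>2 + l * k\<^sup>2)"
  have "k * l\<^sup>2 + l * k\<^sup>2 > 0"
    using pos by (intro add_pos_pos mult_pos_pos) auto
  then have N: "N > 0" by (simp add: N_def)
  have "k * (l / N) + l * (- k / N) = 0" by simp
  moreover have "k * (l / N)\<^sup>2 + l * (- k / N)\<^sup>2 = (k * l\<^sup>2 + l * k\<^sup>2) / N\<^sup>2"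
    by (simp add: power_divide add_divide_distrib)
  then have "2 * sqrt CARD('n) * sqrt (k * (l / N)\<^sup>2 + l * (- k / N)\<^sup>2) = N / N"
    using N by (simp add: real_sqrt_divide N_def [symmetric])
  then have "2 * sqrt CARD('n) * sqrt (k * (l / N)\<^sup>2 + l * (- k / N)\<^sup>2) = 1"
    using N by simp
  moreover have "- k / N < l / N"
    using pos N by (intro divide_strict_right_mono) auto
  ultimately show ?thesis
    unfolding step_dir_unit_iff k_def l_def by blast
qed

text \<open>
  Trace 0 makes the lower level a fixed multiple of the upper one, unit length determines the upper
  one up to sign, and it is positive since it exceeds the lower one.
\<close>

lemma unit_step_dir_levels_unique:
  fixes S T :: "'n::finite set"
  assumes x: "step_dir S a b \<in> unit_dirs" "b < a" and y: "step_dir T c d \<in> unit_dirs" "d < c"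
    and card: "card S = card T"
  shows "a = c" "b = d"
proof -
  define k l where "k = real (card S)" and "l = real (card (- S))"
  have kl: "k = real (card T)" "l = real (card (- T))"
    using card by (simp_all add: k_def l_def Compl_eq_Diff_UNIV card_Diff_subset)
  have pos: "k > 0" "l > 0"
    using unit_step_dir_proper [OF x(1)] by (auto simp: k_def l_def card_gt_0_iff)
  have s: "k * a + l * b = 0" "k * c + l * d = 0"
    and "2 * sqrt CARD('n) * sqrt (k * a\<^sup>2 + l * b\<^sup>2) = 2 * sqrt CARD('n) * sqrt (k * c\<^sup>2 + l * d\<^sup>2)"
    using x(1) y(1) unfolding step_dir_unit_iff kl [symmetric] k_def [symmetric] l_def [symmetric] by auto
  then have n: "k * a\<^sup>2 + l * b\<^sup>2 = k * c\<^sup>2 + l * d\<^sup>2"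
    by simp
  have b: "b = - k * a / l" and d: "d = - k * c / l"
    using s pos by (simp_all add: field_simps)
  have pos_level: "0 < a" if "k * a + l * b = 0" "b < a" for a b
  proof (rule ccontr)
    assume "\<not> 0 < a"
    then have "k * a \<le> 0" "l * b < 0"
      using pos that by (auto simp: mult_le_0_iff mult_less_0_iff)
    then show False using that by simp
  qed
  have ac: "0 < a" "0 < c"
    using pos_level s x y by blast+
  have "k * t\<^sup>2 + l * (- k * t / l)\<^sup>2 = (k + k\<^sup>2 / l) * t\<^sup>2" for t
    using pos by (simp add: power_divide power_mult_distrib field_simps power2_eq_square)
  then have "(k + k\<^sup>2 / l) * a\<^sup>2 = (k + k\<^sup>2 / l) * c\<^sup>2"
    using n unfolding b d by simp
  moreover have "k + k\<^sup>2 / l > 0"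
    using pos by (intro add_pos_pos) auto
  ultimately have "a\<^sup>2 = c\<^sup>2"
    by (simp only: mult_cancel_left) simp
  then show "a = c"
    using ac by (simp add: power2_eq_iff_nonneg)
  then show "b = d" by (simp add: b d)
qed

lemma dominated_imp_flag_invariant:
  assumes "dominated y y w" "v \<in> coord {i. c \<le> y $ i}"
  shows "w *v v \<in> coord {i. c \<le> y $ i}"
  unfolding coord_def
proof (intro CollectI allI impI)
  fix i
  assume "i \<notin> {i. c \<le> y $ i}"
  then have "w $ i $ j * v $ j = 0" for j
    using assms by (cases "c \<le> y $ j") (auto simp: dominated_def coord_def)
  then show "(w *v v) $ i = 0"
    by (simp only: matrix_vector_mult_def vec_lambda_beta sum.neutral_const)
qed

lemma dominated_step_dir_iff:
  fixes w :: "complex^'n^'n"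
  assumes "b < a"
  shows "dominated (step_dir S a b) (step_dir T a b) w \<longleftrightarrow> (*v) w ` coord T \<subseteq> coord S"
proof
  assume dom: "dominated (step_dir S a b) (step_dir T a b) w"
  have "w *v v \<in> coord S" if v: "v \<in> coord T" for v
    unfolding coord_def
  proof (intro CollectI allI impI)
    fix i assume "i \<notin> S"
    then have "w $ i $ j * v $ j = 0" for j
      using dom v assms by (cases "j \<in> T") (auto simp: dominated_def coord_def)
    then show "(w *v v) $ i = 0"
      by (simp only: matrix_vector_mult_def vec_lambda_beta sum.neutral_const)
  qed
  then show "(*v) w ` coord T \<subseteq> coord S" by blast
next
  assume sub: "(*v) w ` coord T \<subseteq> coord S"
  have "w $ i $ j = 0" if "i \<notin> S" "j \<in> T" for i j
  proof -
    have "w *v axis j 1 \<in> coord S"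
      using sub that(2) axis_in_coord [of j T] by blast
    then show ?thesis
      using that(1) by (simp add: mult_axis column_def coord_def)
  qed
  then show "dominated (step_dir S a b) (step_dir T a b) w"
    using assms by (auto simp: dominated_def split: if_splits)
qed

lemma stab_inf_step_endpoint:
  fixes g :: "complex^'n^'n"
  assumes g: "g \<in> SL" and x: "step_dir S a b \<in> unit_dirs" and ab: "b < a"
  shows "stab_inf (endpoint g (step_dir S a b)) = stab_subspace ((*v) g ` coord S)"
proof -
  have "(*v) (matrix_inv g ** (s ** g)) ` coord S \<subseteq> coord S \<longleftrightarrow> (*v) s ` (*v) g ` coord S = (*v) g ` coord S"
    if s: "s \<in> SL" for s
  proof -
    let ?w = "matrix_inv g ** (s ** g)"
    have w: "?w \<in> SL"
      using g s by (simp add: SL_mult SL_inv)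
    have "(*v) ?w ` coord S \<subseteq> coord S \<longleftrightarrow> (*v) ?w ` coord S = coord S"
      using image_subset_imp_eq [OF w subspace_coord] by blast
    also have "\<dots> \<longleftrightarrow> (*v) g ` (*v) ?w ` coord S = (*v) g ` coord S"
      using inj_image_eq_iff [OF SL_inj [OF g]] by metis
    also have "(*v) g ` (*v) ?w ` coord S = (*v) s ` (*v) g ` coord S"
      by (simp only: image_mult image_cancel' [OF g])
    finally show ?thesis .
  qed
  then show ?thesis
    unfolding stab_inf_endpoint [OF g x] dominated_step_dir_iff [OF ab] stab_subspace_def
    by (intro Collect_cong conj_cong refl) blast
qed

text \<open>
  The missing unit vector \<open>e\<^sub>j\<close> is what remains of \<open>u\<close> when its other coordinates are subtracted.
\<close>

lemma coord_subset_subspace: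
  fixes F :: "(complex^'n) set"
  assumes F: "vec.subspace F" and u: "u \<in> F" "u \<in> coord A" "u $ j \<noteq> 0" "j \<in> A"
    and ax: "\<And>i. i \<in> A \<Longrightarrow> i \<noteq> j \<Longrightarrow> axis i 1 \<in> F"
  shows "coord A \<subseteq> F"
proof -
  have expand: "v = (\<Sum>i\<in>A. v $ i *s axis i 1)" if "v \<in> coord A" for v :: "complex^'n"
  proof -
    have "(\<Sum>i\<in>A. v $ i *s axis i 1) = (\<Sum>i\<in>UNIV. v $ i *s axis i 1)"
      using that by (intro sum.mono_neutral_left) (auto simp: coord_def)
    then show ?thesis by (simp add: basis_expansion)
  qed
  have "u = u $ j *s axis j 1 + (\<Sum>i\<in>A - {j}. u $ i *s axis i 1)"
    using expand [OF u(2)] u(4) by (simp add: sum.remove [of A j])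
  then have "u $ j *s axis j 1 = u - (\<Sum>i\<in>A - {j}. u $ i *s axis i 1)"
    by (simp add: algebra_simps)
  also have "\<dots> \<in> F"
    using u(1) ax by (intro vec.subspace_diff vec.subspace_sum vec.subspace_scale F) auto
  finally have "(1 / u $ j) *s (u $ j *s axis j 1) \<in> F"
    by (rule vec.subspace_scale [OF F])
  then have axj: "axis j 1 \<in> F"
    using u(3) by simp
  show ?thesis
  proof
    fix v :: "complex^'n"
    assume "v \<in> coord A"
    then have "v = (\<Sum>i\<in>A. v $ i *s axis i 1)" by (rule expand)
    also have "\<dots> \<in> F"
      using axj ax by (intro vec.subspace_sum vec.subspace_scale F) auto
    finally show "v \<in> F" .
  qed
qed

text \<open>
  For \<open>i \<noteq> j\<close> with \<open>i \<in> S\<close> or \<open>j \<notin> S\<close> the transvection \<open>1 + e\<^sub>i\<^sub>j\<close> stabilizes \<open>coord S\<close>. So if \<open>F\<close>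
  contains a vector whose \<open>j\<close>-th coordinate is not 0, it contains \<open>e\<^sub>i\<close>. A vector of \<open>F\<close> outside
  \<open>coord S\<close> thus produces all unit vectors, and a nonzero vector inside produces those of \<open>coord S\<close>.
\<close>

lemma invariant_subspace_of_coord_stabilizer:
  fixes F :: "(complex^'n) set"
  assumes F: "vec.subspace F"
    and inv: "\<And>w. w \<in> SL \<Longrightarrow> (*v) w ` coord S = coord S \<Longrightarrow> (*v) w ` F \<subseteq> F"
  shows "F = {0} \<or> F = coord S \<or> F = UNIV"
proof -
  have ax: "axis i 1 \<in> F" if u: "u \<in> F" "u $ j \<noteq> 0" and ij: "i \<noteq> j" "i \<in> S \<or> j \<notin> S" for u i j
  proof -
    define E :: "complex^'n^'n" where
      "E = (\<chi> k. if k = i then row i (mat 1) + 1 *s row j (mat 1) else row k (mat 1))"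
    have E: "E \<in> SL"
      using det_row_operation [OF ij(1), of "mat 1 :: complex^'n^'n" 1] by (simp add: SL_def E_def)
    have Ev: "E *v v = v + v $ j *s axis i 1" for v
    proof -
      have row: "(\<Sum>l\<in>UNIV. row k (mat 1) $ l * v $ l) = v $ k" for k
        by (simp add: row_def mat_def if_distrib if_distribR cong: if_cong)
      have "(E *v v) $ k = v $ k + (if k = i then v $ j else 0)" for k
        by (simp add: matrix_vector_mult_def E_def row distrib_right sum.distrib)
      then show ?thesis
        by (simp add: vec_eq_iff axis_def)
    qed
    have "(*v) E ` coord S \<subseteq> coord S"
      using ij by (auto simp: Ev coord_def axis_def)
    then have "(*v) E ` coord S = coord S"
      by (rule image_subset_imp_eq [OF E subspace_coord])
    then have "E *v u \<in> F"
      using inv [OF E] u(1) by blast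
    then have "E *v u - u \<in> F"
      by (rule vec.subspace_diff [OF F _ u(1)])
    then have "(1 / u $ j) *s (u $ j *s axis i 1) \<in> F"
      by (rule vec.subspace_scale [OF F, OF back_subst [of "\<lambda>v. v \<in> F"]]) (simp add: Ev)
    then show ?thesis using u(2) by simp
  qed
  show ?thesis
  proof (cases "F \<subseteq> coord S")
    case False
    then obtain u j where "u \<in> F" "u $ j \<noteq> 0" "j \<notin> S"
      unfolding coord_def by blast
    then have "coord UNIV \<subseteq> F"
      using ax by (intro coord_subset_subspace [OF F, of u UNIV j]) (auto simp: coord_def)
    then show ?thesis by (auto simp: coord_def)
  next
    case True
    show ?thesis
    proof (cases "F = {0}")
      case False
      then obtain u where u: "u \<in> F" "u \<noteq> 0"
        using vec.subspace_0 [OF F] by blast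
      then obtain j where j: "u $ j \<noteq> 0"
        by (auto simp: vec_eq_iff)
      have uS: "u \<in> coord S" using u True by blast
      then have "j \<in> S" using j by (auto simp: coord_def)
      then have "coord S \<subseteq> F"
        using ax [OF u(1) j] u uS j by (intro coord_subset_subspace [OF F, of u S j]) auto
      then show ?thesis using True by blast
    qed simp
  qed
qed

text \<open>
  The stabilizer of \<open>endpoint h y\<close> preserves, up to the translation by \<open>h\<close>, all members
  \<open>{v. v\<^sub>i = 0 unless c \<le> y\<^sub>i}\<close> of the flag of \<open>y\<close>. The stabilizer of \<open>W\<close> preserves only \<open>0\<close>, \<open>W\<close> and
  the whole space. So the first nonzero member, which is proper as \<open>y\<close> is not constant, corresponds
  to \<open>W\<close>, and the next one is the whole space. Hence \<open>y\<close> is constant off the set of its maxima.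
\<close>

lemma endpoint_with_subspace_stabilizer:
  fixes W :: "(complex^'n) set"
  assumes h: "h \<in> SL" and y: "y \<in> unit_dirs" and W: "vec.subspace W" "W \<noteq> {0}" "W \<noteq> UNIV"
    and stab: "stab_inf (endpoint h y) = stab_subspace W"
  shows "\<exists>T a b. b < a \<and> y = step_dir T a b \<and> W = (*v) h ` coord T"
proof -
  obtain W' where W': "vec.subspace W'" "W \<inter> W' = {0}" "\<And>v. \<exists>w\<in>W. \<exists>w'\<in>W'. v = w + w'"
    using exists_complement [OF W(1)] by blast
  obtain q S where q: "q \<in> SL" "(*v) q ` coord S = W"
    using adapted_frame [OF W(1) W'] by blast
  define V where "V = (*v) (matrix_inv h) ` W"
  have hV: "(*v) h ` V = W"
    by (simp add: V_def image_cancel' h)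
  define m where "m = matrix_inv h ** q"
  have m: "m \<in> SL" and mV: "(*v) m ` coord S = V"
    using h q by (simp_all add: m_def SL_mult SL_inv image_mult V_def)
  have flag_inv: "(*v) w ` coord {i. c \<le> y $ i} \<subseteq> coord {i. c \<le> y $ i}"
    if w: "w \<in> SL" "(*v) w ` V = V" for w c
  proof -
    define s where "s = h ** w ** matrix_inv h"
    have s: "s \<in> SL"
      using h w by (simp add: s_def SL_mult SL_inv)
    have "(*v) s ` W = W"
      using w(2) by (simp only: s_def image_mult V_def [symmetric] hV)
    then have "s \<in> stab_inf (endpoint h y)"
      using s by (simp add: stab stab_subspace_def)
    then have "dominated y y (matrix_inv h ** (s ** h))"
      by (simp add: stab_inf_endpoint h y)
    moreover have "matrix_inv h ** (s ** h) = w"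
      by (simp only: s_def matrix_mul_assoc [symmetric] SL_left_inverse [OF h] matrix_mul_rid SL_cancel_left [OF h])
    ultimately show ?thesis
      using dominated_imp_flag_invariant by auto
  qed
  have flag: "coord {i. c \<le> y $ i} = {0} \<or> coord {i. c \<le> y $ i} = V \<or> coord {i. c \<le> y $ i} = (UNIV :: (complex^'n) set)" for c
  proof -
    let ?F = "coord {i. c \<le> y $ i} :: (complex^'n) set"
    let ?G = "(*v) (matrix_inv m) ` ?F"
    have mG: "(*v) m ` ?G = ?F"
      by (rule image_cancel' [OF m])
    have "?G = {0} \<or> ?G = coord S \<or> ?G = UNIV"
    proof (rule invariant_subspace_of_coord_stabilizer [OF subspace_image_matrix [OF subspace_coord]])
      fix w :: "complex^'n^'n"
      assume w: "w \<in> SL" "(*v) w ` coord S = coord S"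
      let ?w = "m ** w ** matrix_inv m"
      have "?w \<in> SL"
        using m w by (simp add: SL_mult SL_inv)
      moreover have "(*v) ?w ` V = V"
        unfolding mV [symmetric] image_mult image_cancel [OF m] w(2) ..
      ultimately have "(*v) ?w ` ?F \<subseteq> ?F"
        by (rule flag_inv)
      then have "(*v) (matrix_inv m) ` (*v) ?w ` ?F \<subseteq> ?G"
        by (rule image_mono)
      then show "(*v) w ` ?G \<subseteq> ?G"
        by (simp only: image_mult image_cancel [OF m])
    qed
    then have "(*v) m ` ?G = (*v) m ` {0} \<or> (*v) m ` ?G = (*v) m ` coord S \<or> (*v) m ` ?G = (*v) m ` UNIV"
      by (elim disjE) (simp_all only: simp_thms)
    then show ?thesis
      unfolding mG mV using SL_surj [OF m] by simp
  qed
  have coord_UNIV: "T = UNIV" if "coord T = (UNIV :: (complex^'n) set)" for T :: "'n set"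
    using axis_in_coord [of _ T] that by blast
  define a where "a = Max (range (($) y))"
  define T where "T = {i. a \<le> y $ i}"
  have le: "y $ i \<le> a" for i
    by (simp add: a_def)
  have "a \<in> range (($) y)"
    unfolding a_def by (rule Max_in) auto
  then obtain i0 where i0: "y $ i0 = a" by auto
  have nconst: "\<not> (\<forall>i. y $ i = a)"
  proof
    assume *: "\<forall>i. y $ i = a"
    have "y \<in> zero_sum" using y by (rule unit_dirs_zero_sum)
    then have "a = 0" using * by (simp add: zero_sum_def)
    then have "y = 0" using * by (simp add: vec_eq_iff)
    then show False using y by (simp add: unit_dirs_def)
  qed
  obtain j where "y $ j \<noteq> a"
    using nconst by blast
  then have ja: "y $ j < a"
    using le [of j] by simp
  then have j: "j \<notin> T"
    by (simp add: T_def)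
  have T: "coord T = V"
  proof -
    have "coord T \<noteq> ({0} :: (complex^'n) set)"
    proof
      assume "coord T = ({0} :: (complex^'n) set)"
      moreover have "axis i0 1 \<in> (coord T :: (complex^'n) set)"
        by (simp add: axis_in_coord T_def i0)
      ultimately show False by (simp add: axis_eq_0_iff)
    qed
    moreover have "coord T \<noteq> (UNIV :: (complex^'n) set)"
      using coord_UNIV [of T] j by blast
    ultimately show ?thesis
      using flag [of a] unfolding T_def by blast
  qed
  have low: "y $ j \<le> y $ i" if "j \<notin> T" "i \<notin> T" for i j
  proof -
    let ?R = "{i. y $ j \<le> y $ i}"
    have jR: "axis j 1 \<in> (coord ?R :: (complex^'n) set)"
      by (simp add: axis_in_coord)
    have "coord ?R \<noteq> ({0} :: (complex^'n) set)"
    proof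
      assume "coord ?R = ({0} :: (complex^'n) set)"
      then show False using jR by (simp add: axis_eq_0_iff)
    qed
    moreover have "coord ?R \<noteq> V"
      using jR that(1) axis_in_coord [of j T] unfolding T [symmetric] by blast
    ultimately have "?R = UNIV"
      using flag [of "y $ j"] coord_UNIV [of ?R] by blast
    then show ?thesis by blast
  qed
  have "y $ i = step_dir T a (y $ j) $ i" for i
  proof (cases "i \<in> T")
    case True
    then show ?thesis
      using le [of i] by (simp add: T_def)
  next
    case False
    then show ?thesis
      using low [OF j False] low [OF False j] by simp
  qed
  then have "y = step_dir T a (y $ j)"
    by (intro vec_eq_iff [THEN iffD2] allI)
  moreover note ja
  moreover have "W = (*v) h ` coord T"
    by (simp add: T hV)
  ultimately show ?thesis by blast
qed

text \<open>
  Equal subspaces have equal dimensions, so the two directions have the same levels.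
\<close>

lemma endpoint_eq_if_subspace_eq:
  fixes g h :: "complex^'n^'n"
  assumes g: "g \<in> SL" "step_dir S a b \<in> unit_dirs" "b < a"
    and h: "h \<in> SL" "step_dir T c d \<in> unit_dirs" "d < c"
    and eq: "(*v) g ` coord S = (*v) h ` coord T"
  shows "endpoint g (step_dir S a b) = endpoint h (step_dir T c d)"
proof -
  have "card S = card T"
    by (rule card_eq_if_image_coord_eq [OF g(1) h(1) eq])
  then have ac: "a = c" "b = d"
    using unit_step_dir_levels_unique [OF g(2,3) h(2,3)] by blast+
  have "(*v) (matrix_inv g ** h) ` coord T \<subseteq> coord S"
    by (simp only: image_mult eq [symmetric] image_cancel [OF g(1)] subset_refl)
  then have "dominated (step_dir S a b) (step_dir T c d) (matrix_inv g ** h)"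
    using dominated_step_dir_iff [OF g(3)] unfolding ac by blast
  then show ?thesis
    using endpoint_eq_iff g h by blast
qed

lemma z_point_eq_endpoint:
  fixes g :: "complex^'n^'n"
  assumes g: "g \<in> SL" and x: "step_dir S a b \<in> unit_dirs" "b < a"
    and W: "(*v) g ` coord S = W" "W \<noteq> {0}" "W \<noteq> UNIV"
  shows "z_point W = endpoint g (step_dir S a b)"
  unfolding z_point_def
proof (rule the_equality)
  show "endpoint g (step_dir S a b) \<in> Z_inf \<and> stab_inf (endpoint g (step_dir S a b)) = stab_subspace W"
    using g x stab_inf_step_endpoint [OF g x] unfolding Z_inf_iff W(1) by blast
  fix z
  assume z: "z \<in> Z_inf \<and> stab_inf z = stab_subspace W"
  then obtain h y where h: "h \<in> SL" "y \<in> unit_dirs" "z = endpoint h y"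
    unfolding Z_inf_iff by blast
  have "vec.subspace W"
    unfolding W(1) [symmetric] by (rule subspace_image_matrix [OF subspace_coord])
  then obtain T c d where "d < c" "y = step_dir T c d" "W = (*v) h ` coord T"
    using endpoint_with_subspace_stabilizer [OF h(1,2) _ W(2,3)] z h(3) by blast
  then show "z = endpoint g (step_dir S a b)"
    using endpoint_eq_if_subspace_eq [OF g x h(1), of T c d] h W(1) by simp
qed

lemma stab_inf_z_point:
  fixes W :: "(complex^'n) set"
  assumes W: "vec.subspace W" "W \<noteq> {0}" "W \<noteq> UNIV"
  shows "stab_inf (z_point W) = stab_subspace W"
proof -
  obtain W' where W': "vec.subspace W'" "W \<inter> W' = {0}" "\<And>v. \<exists>w\<in>W. \<exists>w'\<in>W'. v = w + w'"
    using exists_complement [OF W(1)] by blast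
  obtain q S where q: "q \<in> SL" "(*v) q ` coord S = W"
    using adapted_frame [OF W(1) W'] by blast
  have "coord {} = ({0} :: (complex^'n) set)" "coord UNIV = (UNIV :: (complex^'n) set)"
    by (auto simp: coord_def vec_eq_iff)
  then have "S \<noteq> {}" "S \<noteq> UNIV"
    using W(2,3) q(2) SL_surj [OF q(1)] by auto
  then obtain a b where "b < a" "step_dir S a b \<in> unit_dirs"
    using exists_unit_step_dir by blast
  then show ?thesis
    using z_point_eq_endpoint [OF q(1) _ _ q(2) W(2,3)] stab_inf_step_endpoint [OF q(1)] q(2) by metis
qed

section \<open>Geodesics joining two subspaces\<close>

lemma minus_step_dir: "- step_dir S a b = step_dir (- S) (- b) (- a)"
  by (simp add: vec_eq_iff)

lemma flow_uminus: "flow g x (- t) = flow g (- x) t"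
  by (simp add: flow_def)

lemma flow_rescale: "flow g x (t / c) = flow g ((1 / c) *\<^sub>R x) t"
  by (simp add: flow_def)

theorem lemma4p8:
  fixes W W' :: "(complex^'n) set"
  assumes "CARD('n) \<ge> 2"
    and "vec.subspace W" and "W \<noteq> {0}" and "W \<noteq> UNIV"
    and "vec.subspace W'" and "W' \<noteq> {0}" and "W' \<noteq> UNIV"
  shows "(\<exists>\<gamma>. geodesic \<gamma> \<and> joins \<gamma> (z_point W) (z_point W')) \<longleftrightarrow>
         W \<inter> W' = {0} \<and> {w + w' | w w'. w \<in> W \<and> w' \<in> W'} = UNIV"
proof
  assume "\<exists>\<gamma>. geodesic \<gamma> \<and> joins \<gamma> (z_point W) (z_point W')"
  then obtain \<gamma> c where c: "c > 0" and geo: "geodesic_on UNIV c \<gamma>"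
    and ends: "z_point W = ray_class (\<lambda>t. \<gamma> (t / c)) \<and> z_point W' = ray_class (\<lambda>t. \<gamma> (- t / c)) \<or>
      z_point W = ray_class (\<lambda>t. \<gamma> (- t / c)) \<and> z_point W' = ray_class (\<lambda>t. \<gamma> (t / c))"
    unfolding joins_def Let_def by blast
  obtain g x where g: "g \<in> SL" and x: "x \<in> zero_sum" "2 * sqrt CARD('n) * norm x = c" and \<gamma>: "\<gamma> = flow g x"
    using geodesic_line_is_flow [OF geo] by blast
  define u where "u = (1 / c) *\<^sub>R x"
  have u: "u \<in> unit_dirs"
    using x c by (simp add: unit_dirs_def u_def zero_sum_scaleR)
  have "ray_class (\<lambda>t. \<gamma> (t / c)) = endpoint g u"
    by (rule ray_class_eq_endpoint [OF g u]) (simp add: \<gamma> flow_rescale u_def)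
  moreover have "ray_class (\<lambda>t. \<gamma> (- t / c)) = endpoint g (- u)"
  proof (rule ray_class_eq_endpoint [OF g unit_dirs_minus [OF u]])
    fix t
    have "\<gamma> (- t / c) = flow g u (- t)"
      unfolding \<gamma> u_def by (rule flow_rescale)
    then show "\<gamma> (- t / c) = flow g (- u) t"
      by (simp only: flow_uminus)
  qed
  ultimately obtain v where v: "v \<in> unit_dirs" "z_point W = endpoint g v" "z_point W' = endpoint g (- v)"
    using ends u unit_dirs_minus [OF u] by (metis minus_minus)
  obtain T a b where T: "b < a" "v = step_dir T a b" "W = (*v) g ` coord T"
    using endpoint_with_subspace_stabilizer [OF g v(1) assms(2-4)] stab_inf_z_point [OF assms(2-4)] v(2)
    by auto
  obtain T' a' b' where T': "b' < a'" "- v = step_dir T' a' b'" "W' = (*v) g ` coord T'"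
    using endpoint_with_subspace_stabilizer [OF g unit_dirs_minus [OF v(1)] assms(5-7)]
      stab_inf_z_point [OF assms(5-7)] v(3)
    by auto
  \<comment> \<open>Reversing the direction turns its minima into maxima.\<close>
  have "T' = - T"
  proof -
    have proper: "\<exists>i. i \<in> T" "\<exists>i. i \<notin> T" "\<exists>i. i \<in> T'" "\<exists>i. i \<notin> T'"
      using unit_step_dir_proper [of T a b] unit_step_dir_proper [of T' a' b'] v(1) unit_dirs_minus [OF v(1)]
      unfolding T(2) [symmetric] T'(2) [symmetric] by blast+
    have eq: "(if i \<in> T' then a' else b') = (if i \<in> T then - a else - b)" for i
      using arg_cong [OF T'(2), of "\<lambda>w. w $ i"] by (simp add: T(2) split: if_splits)
    have "b' < (if i \<in> T' then a' else b') \<longleftrightarrow> i \<in> T'" for i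
      using T'(1) by simp
    moreover have "- a < (if i \<in> T then - a else - b) \<longleftrightarrow> i \<notin> T" for i
      using T(1) by simp
    moreover have "b' = - a"
    proof -
      obtain i j where "i \<in> T" "j \<notin> T'" using proper by blast
      then have "- a = (if i \<in> T' then a' else b')" "b' = (if j \<in> T then - a else - b)"
        using eq [of i] eq [of j] by simp_all
      then show ?thesis
        using T(1) T'(1) by (auto split: if_splits)
    qed
    ultimately have "i \<in> T' \<longleftrightarrow> i \<notin> T" for i
      using eq [of i] by metis
    then show ?thesis by blast
  qed
  then have W': "W' = (*v) g ` coord (- T)"
    by (simp add: T'(3))
  have "W \<inter> W' = {0}"
  proof -
    have "W \<inter> W' = (*v) g ` (coord T \<inter> coord (- T))"
      unfolding T(3) W' by (rule image_Int [OF SL_inj [OF g], symmetric])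
    then show ?thesis by (simp add: coord_Int_Compl)
  qed
  moreover have "v \<in> {w + w' | w w'. w \<in> W \<and> w' \<in> W'}" for v
    using coord_decomposition [OF g, of T v] unfolding T(3) W' by blast
  ultimately show "W \<inter> W' = {0} \<and> {w + w' | w w'. w \<in> W \<and> w' \<in> W'} = UNIV"
    by blast
next
  assume direct: "W \<inter> W' = {0} \<and> {w + w' | w w'. w \<in> W \<and> w' \<in> W'} = UNIV"
  then have int: "W \<inter> W' = {0}" by blast
  have sum: "\<exists>w\<in>W. \<exists>w'\<in>W'. v = w + w'" for v
  proof -
    have "v \<in> {w + w' | w w'. w \<in> W \<and> w' \<in> W'}"
      using direct by simp
    then show ?thesis by blast
  qed
  obtain q S where q: "q \<in> SL" "(*v) q ` coord S = W" "(*v) q ` coord (- S) = W'"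
    using adapted_frame [OF assms(2,5) int sum] by blast
  have "coord {} = ({0} :: (complex^'n) set)" "coord UNIV = (UNIV :: (complex^'n) set)"
    by (auto simp: coord_def vec_eq_iff)
  then have "S \<noteq> {}" "S \<noteq> UNIV"
    using assms(3,4) q(2) SL_surj [OF q(1)] by auto
  then obtain a b where ab: "b < a" and x: "step_dir S a b \<in> unit_dirs"
    using exists_unit_step_dir by blast
  have x': "step_dir (- S) (- b) (- a) \<in> unit_dirs"
    using unit_dirs_minus [OF x] by (simp only: minus_step_dir)
  define \<gamma> where "\<gamma> = flow q (step_dir S a b)"
  have geo: "geodesic_on UNIV 1 \<gamma>"
    using geodesic_on_flow [OF q(1) unit_dirs_zero_sum [OF x], of UNIV] x
    by (simp add: unit_dirs_def \<gamma>_def)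
  have "ray_class (\<lambda>t. \<gamma> (t / 1)) = z_point W"
    unfolding z_point_eq_endpoint [OF q(1) x ab q(2) assms(3,4)]
    by (rule ray_class_eq_endpoint [OF q(1) x]) (simp add: \<gamma>_def)
  moreover have "ray_class (\<lambda>t. \<gamma> (- t / 1)) = z_point W'"
    unfolding z_point_eq_endpoint [OF q(1) x' _ q(3) assms(6,7), unfolded neg_less_iff_less, OF ab]
    by (rule ray_class_eq_endpoint [OF q(1) x']) (simp add: \<gamma>_def flow_uminus minus_step_dir)
  ultimately have "joins \<gamma> (z_point W) (z_point W')"
    using geo unfolding joins_def Let_def by (metis zero_less_one)
  moreover have "geodesic \<gamma>"
    using geo unfolding geodesic_def by (metis zero_less_one)
  ultimately show "\<exists>\<gamma>. geodesic \<gamma> \<and> joins \<gamma> (z_point W) (z_point W')"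
    by blast
qed

end
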